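(* Suppose that for each $t\in(0,1)$ the law of $\xi_t$ has a density $\rho_t(x)$, that $\eta_1\sim\nu$, and that for each $T<1$, $$\int_0^T\mathbb{E}|\eta_t'-(\log\sigma_t)'\eta_t|\,\mathrm{d}t<\infty.$$ Then for each $t\in(0,1)$, $X_t=\xi_t+\eta_t$ admits the density $\varphi_t(x)=\mathbb{E}\rho_t(x-\eta_t)$, which satisfies the Fokker–Planck equation $$\partial_t\varphi_t=\frac{a_t'\sigma_t^2}{2}\Delta\varphi_t-\nabla\cdot(b\varphi_t)$$ (in the distributional sense), where $$b(t,x)=(\log\sigma_t)'x+\frac{\mathbb{E}\big[(\eta'_t-(\log\sigma_t)'\eta_t)\rho_t(x-\eta_t)\big]}{\mathbb{E}\rho_t(x-\eta_t)}.$$ Moreover, for $p\ge1$ and $\mu_t(\mathrm{d}x)=\varphi_t(x)\,\mathrm{d}x$, $$\mathcal{W}_p(\mu_t,\nu)\le\sigma_t\big(\|\xi_0\|_p+c_p\sqrt{a_t}\big)+\|\eta_t-\eta_1\|_p .$$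
   Context: $\mu,\nu$ are probability measures on $\mathbb{R}^d$. $\sigma_t,a_t:[0,1)\to[0,\infty)$ are $C^1$ functions with $\sigma_t>0$ on $[0,1)$, $\sigma_0=1$, $\sigma_1=0$ (as the limit $t\to1$), $a_0=0$, $a'_t\ge0$. $W$ is a $d$-dimensional standard Brownian motion; $\eta_t:[0,1]\to\mathbb{R}^d$ is a random $C^1$ function of time independent of $W$; $\xi_0$ is independent of $(\eta,W)$; $\xi_t$ solves the linear SDE $$\mathrm{d}\xi_t=(\log\sigma_t)'\xi_t\,\mathrm{d}t+\sigma_t\sqrt{a'_t}\,\mathrm{d}W_t,$$ i.e. $\xi_t=\sigma_t\xi_0+\sigma_t\int_0^t\sqrt{a_s'}\,\mathrm{d}W_s$, and $X_t=\xi_t+\eta_t$ with $X_0\sim\mu$. $\|\cdot\|_p$ is the $L^p(\mathbb{P})$ norm; $\mathcal{W}_p(\mu,\nu)=\inf_{\xi\sim\mu,\eta\sim\nu}\|\xi-\eta\|_p$ is the $p$-Wasserstein metric; $c_p=\big[(2\pi)^{-d/2}\int_{\mathbb{R}^d}|x|^pe^{-|x|^2/2}\,\mathrm{d}x\big]^{1/p}$. The drift $b(t,\cdot)$ is defined where $\varphi_t>0$. *)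

theory Defs
  imports "HOL-Probability.Probability"
begin

section \<open>Calculus\<close>

text \<open>Derivatives on an interval are taken within that interval, hence one-sided at its endpoints.\<close>

definition C1_on :: "real set \<Rightarrow> (real \<Rightarrow> 'a::real_normed_vector) \<Rightarrow> bool" where
  "C1_on S f \<longleftrightarrow>
     (\<forall>t\<in>S. f differentiable (at t within S)) \<and>
     continuous_on S (\<lambda>t. vector_derivative f (at t within S))"

definition deriv_on :: "real set \<Rightarrow> (real \<Rightarrow> 'a::real_normed_vector) \<Rightarrow> real \<Rightarrow> 'a" where
  "deriv_on S f t = vector_derivative f (at t within S)"

definition partial :: "'a \<Rightarrow> ('a::real_normed_vector \<Rightarrow> 'b::real_normed_vector) \<Rightarrow> 'a \<Rightarrow> 'b" where
  "partial v f x = frechet_derivative f (at x) v"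

definition grad :: "('a::euclidean_space \<Rightarrow> real) \<Rightarrow> 'a \<Rightarrow> 'a" where
  "grad f x = (\<Sum>i\<in>Basis. partial i f x *\<^sub>R i)"

definition laplacian :: "('a::euclidean_space \<Rightarrow> real) \<Rightarrow> 'a \<Rightarrow> real" where
  "laplacian f x = (\<Sum>i\<in>Basis. partial i (partial i f) x)"

primrec C_k :: "nat \<Rightarrow> ('a::euclidean_space \<Rightarrow> real) \<Rightarrow> bool" where
  "C_k 0 f \<longleftrightarrow> continuous_on UNIV f"
| "C_k (Suc k) f \<longleftrightarrow> (\<forall>x. f differentiable (at x)) \<and> (\<forall>v. C_k k (partial v f))"

text \<open>The space of smooth functions on \<open>(0,1) \<times> \<real>\<^sup>d\<close> with compact support, extended by zero.\<close>

definition test_function :: "(real \<times> 'a::euclidean_space \<Rightarrow> real) \<Rightarrow> bool" where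
  "test_function \<psi> \<longleftrightarrow>
     (\<forall>k. C_k k \<psi>) \<and> compact (closure {z. \<psi> z \<noteq> 0}) \<and>
     closure {z. \<psi> z \<noteq> 0} \<subseteq> {0<..<1} \<times> UNIV"


section \<open>Independence, Brownian motion, Wiener integral\<close>

text \<open>The library's \<open>indep_var\<close> requires both variables to take values in the same type.\<close>

definition indep_rv :: "'w measure \<Rightarrow> 'b measure \<Rightarrow> ('w \<Rightarrow> 'b) \<Rightarrow> 'c measure \<Rightarrow> ('w \<Rightarrow> 'c) \<Rightarrow> bool" where
  "indep_rv M A X B Y \<longleftrightarrow>
     X \<in> measurable M A \<and> Y \<in> measurable M B \<and>
     prob_space.indep_set M
       {X -` S \<inter> space M | S. S \<in> sets A} {Y -` S \<inter> space M | S. S \<in> sets B}"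

text \<open>A process as a single random variable with values in path space, with the product \<open>\<sigma>\<close>-algebra.\<close>

definition sample_path :: "real set \<Rightarrow> (real \<Rightarrow> 'w \<Rightarrow> 'a) \<Rightarrow> 'w \<Rightarrow> real \<Rightarrow> 'a" where
  "sample_path I Z \<omega> = (\<lambda>t\<in>I. Z t \<omega>)"

abbreviation path_space :: "real set \<Rightarrow> (real \<Rightarrow> 'a::topological_space) measure" where
  "path_space I \<equiv> (\<Pi>\<^sub>M t\<in>I. borel)"

definition gauss_density :: "real \<Rightarrow> 'a::euclidean_space \<Rightarrow> real" where
  "gauss_density v x =
     (2 * pi * v) powr (- real DIM('a) / 2) * exp (- (norm x)\<^sup>2 / (2 * v))"

definition brownian_motion :: "'w measure \<Rightarrow> (real \<Rightarrow> 'w \<Rightarrow> 'a::euclidean_space) \<Rightarrow> bool" where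
  "brownian_motion M W \<longleftrightarrow>
     prob_space M \<and>
     (\<forall>t\<ge>0. W t \<in> borel_measurable M) \<and>
     (AE \<omega> in M. W 0 \<omega> = 0) \<and>
     (AE \<omega> in M. continuous_on {0..} (\<lambda>t. W t \<omega>)) \<and>
     (\<forall>s t. 0 \<le> s \<longrightarrow> s < t \<longrightarrow>
        distributed M lborel (\<lambda>\<omega>. W t \<omega> - W s \<omega>) (\<lambda>x. ennreal (gauss_density (t - s) x))) \<and>
     (\<forall>(n::nat) \<tau>. 0 \<le> \<tau> 0 \<longrightarrow> (\<forall>i<n. \<tau> i < \<tau> (Suc i)) \<longrightarrow>
        prob_space.indep_vars M (\<lambda>_. borel) (\<lambda>i \<omega>. W (\<tau> (Suc i)) \<omega> - W (\<tau> i) \<omega>) {..<n})"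

definition step_fun :: "nat \<Rightarrow> (nat \<Rightarrow> real) \<Rightarrow> (nat \<Rightarrow> real) \<Rightarrow> real \<Rightarrow> real" where
  "step_fun n \<tau> c s = (\<Sum>i<n. c i * indicator {\<tau> i<..\<tau> (Suc i)} s)"

definition step_integral ::
  "(real \<Rightarrow> 'w \<Rightarrow> 'a::real_vector) \<Rightarrow> nat \<Rightarrow> (nat \<Rightarrow> real) \<Rightarrow> (nat \<Rightarrow> real) \<Rightarrow> 'w \<Rightarrow> 'a" where
  "step_integral W n \<tau> c \<omega> = (\<Sum>i<n. c i *\<^sub>R (W (\<tau> (Suc i)) \<omega> - W (\<tau> i) \<omega>))"

text \<open>
  \<open>J\<close> is (a version of) the stochastic integral over \<open>[0,t]\<close> of the deterministic integrand \<open>f\<close>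
  with respect to \<open>W\<close>: the \<open>L\<^sup>2\<close> limit of the integrals of step functions
  that converge to \<open>f\<close> in \<open>L\<^sup>2[0,t]\<close>.
\<close>

definition wiener_integral ::
  "'w measure \<Rightarrow> (real \<Rightarrow> 'w \<Rightarrow> 'a::euclidean_space) \<Rightarrow> (real \<Rightarrow> real) \<Rightarrow> real \<Rightarrow> ('w \<Rightarrow> 'a) \<Rightarrow> bool" where
  "wiener_integral M W f t J \<longleftrightarrow>
     J \<in> borel_measurable M \<and>
     (\<exists>n \<tau> c.
        (\<forall>k::nat. \<tau> k 0 = 0 \<and> \<tau> k (n k) = t \<and> (\<forall>i<n k. \<tau> k i \<le> \<tau> k (Suc i))) \<and>
        (\<lambda>k. \<integral>\<^sup>+s\<in>{0..t}. ennreal ((step_fun (n k) (\<tau> k) (c k) s - f s)\<^sup>2) \<partial>lborel)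
          \<longlonglongrightarrow> 0 \<and>
        (\<lambda>k. \<integral>\<^sup>+\<omega>. ennreal ((norm (step_integral W (n k) (\<tau> k) (c k) \<omega> - J \<omega>))\<^sup>2) \<partial>M)
          \<longlonglongrightarrow> 0)"

text \<open>
  The solution of the linear SDE
  \<open>d\<xi> = (log \<sigma>)' \<xi> dt + \<sigma> \<surd>a' dW\<close> on \<open>[0,1)\<close> started at \<open>\<xi> 0\<close> (with \<open>\<sigma> 0 = 1\<close>), i.e.
  \<open>\<xi> t = \<sigma> t \<xi> 0 + \<sigma> t \<integral>\<^sub>0\<^sup>t \<surd>(a' s) dW s\<close> almost surely.
\<close>

definition linear_SDE_solution ::
  "'w measure \<Rightarrow> (real \<Rightarrow> 'w \<Rightarrow> 'a::euclidean_space) \<Rightarrow> (real \<Rightarrow> real) \<Rightarrow> (real \<Rightarrow> real) \<Rightarrow>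
   (real \<Rightarrow> 'w \<Rightarrow> 'a) \<Rightarrow> bool" where
  "linear_SDE_solution M W \<sigma> a \<xi> \<longleftrightarrow>
     (\<forall>t\<in>{0..<1}. \<xi> t \<in> borel_measurable M \<and>
        (\<exists>J. wiener_integral M W (\<lambda>s. sqrt (deriv_on {0..<1} a s)) t J \<and>
             (AE \<omega> in M. \<xi> t \<omega> = \<sigma> t *\<^sub>R \<xi> 0 \<omega> + \<sigma> t *\<^sub>R J \<omega>)))"


section \<open>Interpolated density and drift\<close>

definition log_deriv :: "(real \<Rightarrow> real) \<Rightarrow> real \<Rightarrow> real" where
  "log_deriv \<sigma> t = deriv_on {0..<1} (\<lambda>s. ln (\<sigma> s)) t"

text \<open>\<open>\<eta>'\<^sub>t - (log \<sigma>\<^sub>t)' \<eta>\<^sub>t\<close>\<close>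

definition eta_drift ::
  "(real \<Rightarrow> real) \<Rightarrow> (real \<Rightarrow> 'w \<Rightarrow> 'a::real_normed_vector) \<Rightarrow> real \<Rightarrow> 'w \<Rightarrow> 'a" where
  "eta_drift \<sigma> \<eta> t \<omega> =
     deriv_on {0..1} (\<lambda>s. \<eta> s \<omega>) t - log_deriv \<sigma> t *\<^sub>R \<eta> t \<omega>"

text \<open>
  Expectations are Bochner integrals, hence \<open>0\<close> when divergent. Under the assumptions made on
  \<open>\<rho>\<close> and \<open>\<eta>\<close> this can happen only for \<open>x\<close> in a null set (in \<open>interp_density\<close>), respectively
  for \<open>(t,x)\<close> with \<open>t\<close> in a null set or \<open>x\<close> in a null set depending on \<open>t\<close> (in \<open>drift\<close>).
\<close>

definition interp_density ::
  "'w measure \<Rightarrow> (real \<Rightarrow> 'w \<Rightarrow> 'a::euclidean_space) \<Rightarrow> (real \<Rightarrow> 'a \<Rightarrow> real) \<Rightarrow> real \<Rightarrow> 'a \<Rightarrow> real" where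
  "interp_density M \<eta> \<rho> t x = (\<integral>\<omega>. \<rho> t (x - \<eta> t \<omega>) \<partial>M)"

text \<open>
  Where \<open>interp_density\<close> vanishes the value is a convention (division by zero); the drift only
  enters multiplied by \<open>interp_density\<close>.
\<close>

definition drift ::
  "'w measure \<Rightarrow> (real \<Rightarrow> real) \<Rightarrow> (real \<Rightarrow> 'w \<Rightarrow> 'a::euclidean_space) \<Rightarrow> (real \<Rightarrow> 'a \<Rightarrow> real) \<Rightarrow>
   real \<Rightarrow> 'a \<Rightarrow> 'a" where
  "drift M \<sigma> \<eta> \<rho> t x =
     log_deriv \<sigma> t *\<^sub>R x +
     (\<integral>\<omega>. \<rho> t (x - \<eta> t \<omega>) *\<^sub>R eta_drift \<sigma> \<eta> t \<omega> \<partial>M) /\<^sub>R interp_density M \<eta> \<rho> t x"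


section \<open>The Fokker--Planck equation in the sense of distributions\<close>

text \<open>
  The densities are only given separately for each \<open>t\<close> and up to null sets in \<open>x\<close>, so nothing is
  assumed about joint measurability in \<open>(t,x)\<close>. Integrals over \<open>(0,1) \<times> \<real>\<^sup>d\<close> are therefore
  written as iterated integrals, and their absolute convergence is part of what is claimed.
  For a jointly measurable function they are the usual integrals, by Fubini. The integrals over
  time use the completion \<open>lebesgue\<close>, since \<open>b t\<close> is meaningful only for almost every \<open>t\<close>.
\<close>

definition loc_integrable :: "(real \<Rightarrow> 'a::euclidean_space \<Rightarrow> 'b::euclidean_space) \<Rightarrow> bool" where
  "loc_integrable f \<longleftrightarrow>
     (\<forall>K. compact K \<longrightarrow> K \<subseteq> {0<..<1} \<times> UNIV \<longrightarrow>
        (AE t in lborel. set_integrable lborel {x. (t, x) \<in> K} (f t)) \<and>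
        (\<integral>\<^sup>+t. (\<integral>\<^sup>+x. ennreal (norm (f t x)) * indicator K (t, x) \<partial>lborel) \<partial>lborel) < \<infinity>)"

text \<open>
  \<open>\<partial>\<^sub>t \<phi> = D(t) \<Delta>\<phi> - \<nabla>\<cdot>(b \<phi>)\<close> on \<open>(0,1) \<times> \<real>\<^sup>d\<close>, all derivatives moved onto the test function.
\<close>

definition fokker_planck_distr ::
  "(real \<Rightarrow> real) \<Rightarrow> (real \<Rightarrow> 'a::euclidean_space \<Rightarrow> 'a) \<Rightarrow> (real \<Rightarrow> 'a \<Rightarrow> real) \<Rightarrow> bool" where
  "fokker_planck_distr D b \<phi> \<longleftrightarrow>
     loc_integrable \<phi> \<and> loc_integrable (\<lambda>t x. \<phi> t x *\<^sub>R b t x) \<and>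
     (\<forall>\<psi>. test_function \<psi> \<longrightarrow>
       (let I\<^sub>t = (\<lambda>t. LINT x|lborel. \<phi> t x * vector_derivative (\<lambda>s. \<psi> (s, x)) (at t));
            I\<^sub>\<Delta> = (\<lambda>t. LINT x|lborel. \<phi> t x * (D t * laplacian (\<lambda>y. \<psi> (t, y)) x));
            I\<^sub>b = (\<lambda>t. LINT x|lborel. (\<phi> t x *\<^sub>R b t x) \<bullet> grad (\<lambda>y. \<psi> (t, y)) x)
        in set_integrable lebesgue {0<..<1} I\<^sub>t \<and>
           set_integrable lebesgue {0<..<1} I\<^sub>\<Delta> \<and>
           set_integrable lebesgue {0<..<1} I\<^sub>b \<and>
           - (LINT t:{0<..<1}|lebesgue. I\<^sub>t t) =
             (LINT t:{0<..<1}|lebesgue. I\<^sub>\<Delta> t) + (LINT t:{0<..<1}|lebesgue. I\<^sub>b t)))"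


section \<open>\<open>L\<^sup>p\<close> norms and the Wasserstein metric\<close>

definition Lp_norm :: "'w measure \<Rightarrow> real \<Rightarrow> ('w \<Rightarrow> 'a::real_normed_vector) \<Rightarrow> ennreal" where
  "Lp_norm M p f =
     (let m = \<integral>\<^sup>+\<omega>. ennreal (norm (f \<omega>) powr p) \<partial>M
      in if m = \<infinity> then \<infinity> else ennreal (enn2real m powr (1 / p)))"

text \<open>
  The infimum is over random variables \<open>\<xi> \<sim> \<mu>\<close>, \<open>\<eta> \<sim> \<nu>\<close> on a common probability space. Taking
  \<open>'a \<times> 'a\<close> as the type of its points is no restriction, as \<open>\<parallel>\<xi> - \<eta>\<parallel>\<^sub>p\<close> depends only on the joint
  law of \<open>(\<xi>, \<eta>)\<close>.
\<close>

definition Wasserstein :: "real \<Rightarrow> 'a::euclidean_space measure \<Rightarrow> 'a measure \<Rightarrow> ennreal" where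
  "Wasserstein p \<mu> \<nu> =
     Inf {Lp_norm N p (\<lambda>\<omega>. \<xi> \<omega> - \<eta> \<omega>) | (N :: ('a \<times> 'a) measure) \<xi> \<eta>.
            prob_space N \<and> \<xi> \<in> borel_measurable N \<and> \<eta> \<in> borel_measurable N \<and>
            distr N borel \<xi> = \<mu> \<and> distr N borel \<eta> = \<nu>}"

definition gauss_Lp_const :: "'a::euclidean_space itself \<Rightarrow> real \<Rightarrow> real" where
  "gauss_Lp_const _ p =
     ((2 * pi) powr (- real DIM('a) / 2) *
        (\<integral>x. norm (x::'a) powr p * exp (- (norm x)\<^sup>2 / 2) \<partial>lborel)) powr (1 / p)"

end

theory Submission
  imports Defs
begin

text \<open>
  Write \<open>\<xi> t = \<sigma> t \<xi> 0 + \<sigma> t J\<close> with the Wiener integral \<open>J\<close> of \<open>\<surd>a'\<close> over \<open>[0,t]\<close>. It is an \<open>L\<^sup>2\<close> limit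
  of step integrals, which are functions of the path of \<open>W\<close> and centred Gaussian. Hence \<open>J\<close> is Gaussian
  of variance \<open>a t\<close> and independent of \<open>(\<xi> 0, \<eta>)\<close>. In the form of \<open>distr_add_wiener_integral\<close> this
  says that \<open>\<xi> t\<close> and \<open>X t\<close> have the laws of \<open>\<sigma> x + \<sigma> \<surd>a z\<close> and of \<open>Y t = \<sigma> x + \<eta> + \<sigma> \<surd>a z\<close>, where \<open>x\<close> has
  the law of \<open>\<xi> 0\<close>, \<open>z\<close> is standard Gaussian, and \<open>x\<close>, \<open>\<eta>\<close>, \<open>z\<close> are independent. Conditioning on \<open>\<eta>\<close>
  gives the density \<open>\<phi> t x = E (\<rho> t (x - \<eta> t))\<close> (\<open>joint_density\<close>, \<open>density_\<phi>\<close>).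

  The Fokker--Planck equation involves only the laws at single times, so it may be proved for \<open>Y\<close>,
  without stochastic calculus. Let \<open>\<psi>\<close> be a test function. For fixed \<open>x\<close>, \<open>\<eta>\<close>, \<open>z\<close> the function
  \<open>\<psi> (t, Y t)\<close> has compact support in time, so its derivative integrates to zero. That derivative is
  \<open>\<partial>\<^sub>t \<psi> + \<nabla>\<psi> \<bullet> ((log \<sigma>)' Y + \<eta>' - (log \<sigma>)' \<eta>)\<close> plus \<open>\<sigma> a' / (2 \<surd>a)\<close> times \<open>z \<bullet> \<nabla>\<psi>\<close>. Integrating the last
  term by parts against the Gaussian density of \<open>z\<close> turns it into \<open>(\<sigma>\<^sup>2 a' / 2) \<Delta>\<psi>\<close>, and the singular factor
  disappears (\<open>integral_noise_part\<close>). As \<open>\<surd>a\<close> need not be differentiable where \<open>a\<close> vanishes, the argument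
  is carried out with \<open>a + e\<close> in place of \<open>a\<close>, and \<open>e\<close> is sent to zero at the end (\<open>weak_equation\<close>). Grouping
  the derivative around \<open>Y\<close> rather than \<open>\<xi> 0\<close> is what makes every term integrable: \<open>Y\<close> is bounded on the
  support of \<open>\<psi>\<close>, while \<open>\<xi> 0\<close> need not have any moments. Conditioning on \<open>Y t = x\<close> finally turns
  \<open>(log \<sigma>)' Y + \<eta>' - (log \<sigma>)' \<eta>\<close> into \<open>b (t, x)\<close> (\<open>integral_\<phi>_drift\<close>).

  For the Wasserstein bound couple \<open>X t\<close> with \<open>\<eta> 1\<close>. Then
  \<open>X t - \<eta> 1 = \<sigma> t (\<xi> 0 + J) + (\<eta> t - \<eta> 1)\<close>, and Minkowski's inequality together with the Gaussian law of \<open>J\<close>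
  gives the claim.
\<close>

section \<open>Centred Gaussian measures\<close>

lemma gauss_density_nonneg [simp]: "0 \<le> gauss_density v x"
  by (simp add: gauss_density_def)

lemma borel_measurable_gauss_density [measurable]: "gauss_density v \<in> borel_measurable borel"
  unfolding gauss_density_def by measurable

lemma powr_half_neg_eq:
  assumes "0 < (y::real)"
  shows "y powr (- real n / 2) = (1 / sqrt y) ^ n"
proof -
  have "y powr (- real n / 2) = (y powr (- (1/2))) powr real n"
    by (simp only: powr_powr) simp
  also have "y powr (- (1/2)) = 1 / sqrt y"
    using assms by (simp only: powr_minus powr_half_sqrt inverse_eq_divide less_imp_le)
  also have "(1 / sqrt y) powr real n = (1 / sqrt y) ^ n"
    using assms by (intro powr_realpow) simp
  finally show ?thesis .
qed

lemma gauss_density_eq_prod: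
  fixes x :: "'a::euclidean_space"
  assumes "0 < v"
  shows "gauss_density v x = (\<Prod>b\<in>Basis. normal_density 0 (sqrt v) (x \<bullet> b))"
proof -
  have nd: "normal_density 0 (sqrt v) y = (1 / sqrt (2 * pi * v)) * exp (- y\<^sup>2 / (2 * v))" for y
    using assms by (simp add: normal_density_def)
  have "(\<Prod>b\<in>Basis. normal_density 0 (sqrt v) (x \<bullet> b)) =
      (1 / sqrt (2 * pi * v)) ^ DIM('a) * exp (\<Sum>b\<in>Basis. - (x \<bullet> b)\<^sup>2 / (2 * v))"
    by (simp only: nd prod.distrib prod_constant exp_sum[OF finite_Basis])
  also have "(\<Sum>b\<in>Basis. - (x \<bullet> b)\<^sup>2 / (2 * v)) = - (norm x)\<^sup>2 / (2 * v)"
  proof -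
    have "(\<Sum>b\<in>Basis. - (x \<bullet> b)\<^sup>2 / (2 * v)) = - (\<Sum>b\<in>Basis. (x \<bullet> b)\<^sup>2) / (2 * v)"
      by (simp add: sum_negf sum_divide_distrib)
    also have "(\<Sum>b\<in>Basis. (x \<bullet> b)\<^sup>2) = (norm x)\<^sup>2"
      by (simp only: power2_norm_eq_inner euclidean_inner[of x x] power2_eq_square[of "x \<bullet> _"])
    finally show ?thesis .
  qed
  also have "(1 / sqrt (2 * pi * v)) ^ DIM('a) = (2 * pi * v) powr (- real DIM('a) / 2)"
    using assms by (intro powr_half_neg_eq[symmetric]) simp
  finally show ?thesis by (simp only: gauss_density_def)
qed

text \<open>
  The density factorizes over the coordinates, so its total mass is a product of masses of
  one-dimensional normal densities.
\<close>

lemma nn_integral_gauss_density: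
  assumes "0 < v"
  shows "(\<integral>\<^sup>+x. ennreal (gauss_density v (x :: 'a::euclidean_space)) \<partial>lborel) = 1"
proof -
  have 1: "(\<integral>\<^sup>+x. ennreal (normal_density 0 (sqrt v) x) \<partial>lborel) = 1"
    using assms by (subst nn_integral_eq_integral) auto
  have "(\<integral>\<^sup>+x. ennreal (gauss_density v (x :: 'a)) \<partial>lborel) =
      (\<integral>\<^sup>+x. (\<Prod>b\<in>Basis. ennreal (normal_density 0 (sqrt v) ((x :: 'a) \<bullet> b))) \<partial>lborel)"
    using assms by (simp add: gauss_density_eq_prod prod_ennreal)
  also have "\<dots> = 1"
    by (subst nn_integral_lborel_prod) (auto simp: 1)
  finally show ?thesis .
qed

lemma nn_integral_lborel_affine:
  fixes t :: "'a::euclidean_space"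
  assumes [measurable]: "f \<in> borel_measurable borel" and "c \<noteq> 0"
  shows "(\<integral>\<^sup>+x. f x \<partial>lborel) = ennreal (\<bar>c\<bar> ^ DIM('a)) * (\<integral>\<^sup>+x. f (t + c *\<^sub>R x) \<partial>lborel)"
  by (subst lborel_affine[OF \<open>c \<noteq> 0\<close>, of t])
     (simp add: nn_integral_density nn_integral_distr nn_integral_cmult)

abbreviation std_gaussian :: "'a::euclidean_space measure" where
  "std_gaussian \<equiv> density lborel (\<lambda>z. ennreal (gauss_density 1 z))"

text \<open>
  Defining the centred Gaussian measure of variance \<open>v\<close> as an image of the standard one makes the
  degenerate case \<open>v = 0\<close>, a Dirac measure, available on the same footing as the others.
\<close>

definition gaussian :: "real \<Rightarrow> 'a::euclidean_space measure" where
  "gaussian v = distr std_gaussian borel (\<lambda>z. sqrt v *\<^sub>R z)"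

lemma sets_gaussian [simp, measurable_cong]: "sets (gaussian v) = sets borel"
  and space_gaussian [simp]: "space (gaussian v) = UNIV"
  by (auto simp: gaussian_def)

lemma prob_space_std_gaussian: "prob_space (std_gaussian :: 'a::euclidean_space measure)"
  by (rule prob_spaceI) (simp add: emeasure_density nn_integral_gauss_density)

lemma prob_space_gaussian: "prob_space (gaussian v :: 'a::euclidean_space measure)"
  unfolding gaussian_def by (rule prob_space.prob_space_distr[OF prob_space_std_gaussian]) auto

lemma nn_integral_gaussian:
  assumes [measurable]: "f \<in> borel_measurable borel"
  shows "(\<integral>\<^sup>+x. f x \<partial>gaussian v) = (\<integral>\<^sup>+z. f (sqrt v *\<^sub>R z) \<partial>std_gaussian)"
  unfolding gaussian_def by (simp add: nn_integral_distr)

lemma gaussian_eq_density: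
  assumes v: "0 < v"
  shows "(gaussian v :: 'a::euclidean_space measure) = density lborel (\<lambda>x. ennreal (gauss_density v x))"
proof (rule measure_eqI)
  fix A :: "'a set" assume "A \<in> sets (gaussian v)"
  then have [measurable]: "A \<in> sets borel" by simp
  have *: "ennreal (sqrt v ^ DIM('a)) * (ennreal (gauss_density v (sqrt v *\<^sub>R x)) * i) =
      ennreal (gauss_density 1 x) * i" for x :: 'a and i :: ennreal
  proof -
    have "sqrt v ^ DIM('a) * gauss_density v (sqrt v *\<^sub>R x) = gauss_density 1 x"
    proof -
      have "sqrt v ^ DIM('a) * (2 * pi * v) powr (- real DIM('a) / 2) = (2 * pi) powr (- real DIM('a) / 2)"
        using v by (simp only: powr_half_neg_eq mult_pos_pos pi_gt_zero zero_less_numeral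
          power_mult_distrib[symmetric]) (simp add: real_sqrt_mult)
      then show ?thesis
        using v by (simp add: gauss_density_def power_mult_distrib mult.assoc[symmetric] del: minus_divide_left)
    qed
    then show ?thesis
      by (metis ennreal_mult mult.assoc gauss_density_nonneg real_sqrt_ge_zero v
          zero_le_power less_imp_le)
  qed
  have "emeasure (density lborel (\<lambda>x. ennreal (gauss_density v x))) A =
      (\<integral>\<^sup>+x. ennreal (gauss_density v x) * indicator A x \<partial>lborel)"
    by (simp add: emeasure_density)
  also have "\<dots> = ennreal (sqrt v ^ DIM('a)) *
      (\<integral>\<^sup>+x. ennreal (gauss_density v (sqrt v *\<^sub>R x)) * indicator A (sqrt v *\<^sub>R x) \<partial>lborel)"
    using v by (subst nn_integral_lborel_affine[of _ "sqrt v" 0]) auto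
  also have "\<dots> = (\<integral>\<^sup>+x. ennreal (gauss_density 1 x) * indicator A (sqrt v *\<^sub>R x) \<partial>lborel)"
    by (subst nn_integral_cmult[symmetric]) (auto simp: *)
  also have "\<dots> = (\<integral>\<^sup>+x. indicator A (sqrt v *\<^sub>R x) \<partial>std_gaussian)"
    by (simp add: nn_integral_density)
  also have "\<dots> = emeasure (gaussian v) A"
    by (subst nn_integral_gaussian[symmetric, where f = "indicator A"]) auto
  finally show "emeasure (gaussian v) A = emeasure (density lborel (\<lambda>x. ennreal (gauss_density v x))) A" ..
qed simp

lemma std_gaussian_uminus: "distr std_gaussian borel (\<lambda>z. - z) = (std_gaussian :: 'a::euclidean_space measure)"
proof (rule measure_eqI)
  fix A :: "'a set" assume "A \<in> sets (distr std_gaussian borel (\<lambda>z. - z))"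
  then have [measurable]: "A \<in> sets borel" by simp
  have "emeasure std_gaussian A = (\<integral>\<^sup>+x. ennreal (gauss_density 1 x) * indicator A x \<partial>lborel)"
    by (simp add: emeasure_density)
  also have "\<dots> = (\<integral>\<^sup>+x. ennreal (gauss_density 1 x) * indicator A (- x) \<partial>lborel)"
    by (subst nn_integral_lborel_affine[of _ "-1" 0]) (auto simp: gauss_density_def)
  also have "\<dots> = (\<integral>\<^sup>+x. indicator A (- x) \<partial>std_gaussian)"
    by (simp add: nn_integral_density)
  also have "\<dots> = (\<integral>\<^sup>+x. indicator A x \<partial>distr std_gaussian borel (\<lambda>z. - z))"
    by (subst nn_integral_distr) auto
  also have "\<dots> = emeasure (distr std_gaussian borel (\<lambda>z. - z)) A"
    by (subst nn_integral_indicator) auto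
  finally show "emeasure (distr std_gaussian borel (\<lambda>z. - z)) A = emeasure std_gaussian A" ..
qed simp

text \<open>
  Negative factors are covered because the standard Gaussian measure is symmetric.
\<close>

lemma gaussian_scaleR:
  assumes "0 \<le> v"
  shows "distr (gaussian v) borel (\<lambda>x. c *\<^sub>R x) = (gaussian (c\<^sup>2 * v) :: 'a::euclidean_space measure)"
proof -
  have eq: "distr (gaussian v) borel (\<lambda>x. c *\<^sub>R x) = distr std_gaussian borel (\<lambda>z. (c * sqrt v) *\<^sub>R (z::'a))"
    unfolding gaussian_def by (subst distr_distr) (auto simp: o_def)
  show ?thesis
  proof (cases "0 \<le> c")
    case True
    then show ?thesis unfolding eq unfolding gaussian_def by (simp add: real_sqrt_mult)
  next
    case False
    have "distr (distr std_gaussian borel (\<lambda>z. - z)) borel (\<lambda>z. (c * sqrt v) *\<^sub>R (z::'a)) =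
        distr std_gaussian borel (\<lambda>z. sqrt (c\<^sup>2 * v) *\<^sub>R z)"
      using False by (subst distr_distr) (auto simp: o_def real_sqrt_mult scaleR_minus_left[symmetric]
          simp del: scaleR_minus_left)
    then show ?thesis unfolding eq unfolding gaussian_def std_gaussian_uminus .
  qed
qed

text \<open>
  Completing the square: in the product of two Gaussian densities the integration variable
  separates from the sum of the variables.
\<close>

lemma gauss_density_mult:
  fixes x u :: "'a::euclidean_space"
  assumes v: "0 < v" and w: "0 < w"
  shows "gauss_density v x * gauss_density w (u - x) =
    gauss_density (v + w) u * gauss_density (v * w / (v + w)) (x - (v / (v + w)) *\<^sub>R u)"
proof -
  have sq: "(norm x)\<^sup>2 / (2 * v) + (norm (u - x))\<^sup>2 / (2 * w) =
      (norm u)\<^sup>2 / (2 * (v + w)) + (norm (x - (v / (v + w)) *\<^sub>R u))\<^sup>2 / (2 * (v * w / (v + w)))"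
  proof -
    define p q r where "p = x \<bullet> x" and "q = x \<bullet> u" and "r = u \<bullet> u"
    have 1: "(norm x)\<^sup>2 = p" "(norm u)\<^sup>2 = r" "(norm (u - x))\<^sup>2 = r - 2 * q + p"
      by (auto simp: p_def q_def r_def power2_norm_eq_inner inner_diff inner_commute)
    have 2: "(norm (x - (v / (v + w)) *\<^sub>R u))\<^sup>2 = p - 2 * (v / (v + w)) * q + (v / (v + w))\<^sup>2 * r"
      unfolding p_def q_def r_def power2_norm_eq_inner
      by (simp add: inner_diff inner_commute[of u x] power2_eq_square right_diff_distrib)
    have pos: "v + w \<noteq> 0" "v \<noteq> 0" "w \<noteq> 0" using v w by auto
    let ?k = "(v + w) / (2 * (v * w))"
    have "p / (2 * v) + (r - 2 * q + p) / (2 * w) = p * ?k - q * (1 / w) + r * (1 / (2 * w))"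
      using pos by (simp add: divide_simps) (simp add: algebra_simps)
    also have "1 / w = ?k * (2 * (v / (v + w)))"
      using pos by (simp add: divide_simps)
    also have "1 / (2 * w) = 1 / (2 * (v + w)) + ?k * (v / (v + w))\<^sup>2"
      using pos by (simp add: divide_simps power2_eq_square) (simp add: algebra_simps)
    also have "p * ?k - q * (?k * (2 * (v / (v + w)))) + r * (1 / (2 * (v + w)) + ?k * (v / (v + w))\<^sup>2) =
        r / (2 * (v + w)) + (p - 2 * (v / (v + w)) * q + (v / (v + w))\<^sup>2 * r) * ?k"
      by (simp add: algebra_simps)
    finally show ?thesis unfolding 1 2 by simp
  qed
  have const: "(2 * pi * v) powr e * (2 * pi * w) powr e =
      (2 * pi * (v + w)) powr e * (2 * pi * (v * w / (v + w))) powr e" for e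
  proof -
    have "(2 * pi * v) * (2 * pi * w) = (2 * pi * (v + w)) * (2 * pi * (v * w / (v + w)))"
      using v w by (simp add: add_pos_pos less_imp_neq[symmetric])
    then show ?thesis using v w by (simp only: powr_mult[symmetric])
  qed
  have exps: "exp (- (norm x)\<^sup>2 / (2 * v)) * exp (- (norm (u - x))\<^sup>2 / (2 * w)) =
    exp (- (norm u)\<^sup>2 / (2 * (v + w))) *
      exp (- (norm (x - (v / (v + w)) *\<^sub>R u))\<^sup>2 / (2 * (v * w / (v + w))))"
    unfolding exp_add[symmetric] using sq by simp
  show ?thesis
    unfolding gauss_density_def
    using arg_cong2[OF const[of "- real DIM('a) / 2"] exps, of "(*)"] by (simp only: mult_ac)
qed

lemma nn_integral_gauss_density_conv:
  fixes u :: "'a::euclidean_space"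
  assumes v: "0 < v" and w: "0 < w"
  shows "(\<integral>\<^sup>+x. ennreal (gauss_density v x) * ennreal (gauss_density w (u - x)) \<partial>lborel) =
    ennreal (gauss_density (v + w) u)"
proof -
  define r where "r = v * w / (v + w)"
  have r: "0 < r" using v w by (simp add: r_def)
  have "(\<integral>\<^sup>+x. ennreal (gauss_density v x) * ennreal (gauss_density w (u - x)) \<partial>lborel) =
     (\<integral>\<^sup>+x. ennreal (gauss_density (v + w) u) * ennreal (gauss_density r (x - (v / (v + w)) *\<^sub>R u)) \<partial>lborel)"
    by (intro nn_integral_cong) (simp add: ennreal_mult[symmetric] gauss_density_mult[OF v w] r_def)
  also have "\<dots> = ennreal (gauss_density (v + w) u) *
      (\<integral>\<^sup>+x. ennreal (gauss_density r (x - (v / (v + w)) *\<^sub>R u)) \<partial>lborel)"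
    by (subst nn_integral_cmult) auto
  also have "(\<integral>\<^sup>+x. ennreal (gauss_density r (x - (v / (v + w)) *\<^sub>R u)) \<partial>lborel) = 1"
    by (subst nn_integral_lborel_affine[of _ 1 "(v / (v + w)) *\<^sub>R u"])
       (auto simp: nn_integral_gauss_density[OF r])
  finally show ?thesis by simp
qed

lemma gaussian_0: "gaussian 0 = return borel (0 :: 'a::euclidean_space)"
proof -
  have "(\<lambda>z :: 'a. sqrt 0 *\<^sub>R z) = (\<lambda>_. 0)" by auto
  then show ?thesis
    unfolding gaussian_def by (simp only: prob_space.distr_const[OF prob_space_std_gaussian] space_borel UNIV_I)
qed

text \<open>
  Sums of independent centred Gaussians: if a variance is zero that summand is a Dirac measure at
  the origin, otherwise the densities convolve.
\<close>

lemma nn_integral_gaussian_add: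
  fixes f :: "'a::euclidean_space \<Rightarrow> ennreal"
  assumes [measurable]: "f \<in> borel_measurable borel" and vw: "0 \<le> v" "0 \<le> w"
  shows "(\<integral>\<^sup>+x. \<integral>\<^sup>+y. f (x + y) \<partial>gaussian w \<partial>gaussian v) = (\<integral>\<^sup>+x. f x \<partial>gaussian (v + w))"
proof -
  consider "v = 0" | "w = 0" | "0 < v" "0 < w" using vw by force
  then show ?thesis
  proof cases
    case 3
    have translate: "(\<integral>\<^sup>+y. ennreal (gauss_density w y) * f (x + y) \<partial>lborel) =
          (\<integral>\<^sup>+u. ennreal (gauss_density w (u - x)) * f u \<partial>lborel)" for x
      by (subst (2) nn_integral_lborel_affine[of _ 1 x]) auto
    have "(\<integral>\<^sup>+x. \<integral>\<^sup>+y. f (x + y) \<partial>gaussian w \<partial>gaussian v) =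
       (\<integral>\<^sup>+x. ennreal (gauss_density v x) * (\<integral>\<^sup>+y. ennreal (gauss_density w y) * f (x + y) \<partial>lborel) \<partial>lborel)"
      using 3 by (simp add: gaussian_eq_density nn_integral_density)
    also have "\<dots> = (\<integral>\<^sup>+x. ennreal (gauss_density v x) *
        (\<integral>\<^sup>+u. ennreal (gauss_density w (u - x)) * f u \<partial>lborel) \<partial>lborel)"
      unfolding translate ..
    also have "\<dots> = (\<integral>\<^sup>+x. \<integral>\<^sup>+u. ennreal (gauss_density v x) * ennreal (gauss_density w (u - x)) * f u \<partial>lborel \<partial>lborel)"
      by (subst nn_integral_cmult[symmetric]) (auto simp: mult.assoc)
    also have "\<dots> = (\<integral>\<^sup>+u. \<integral>\<^sup>+x. ennreal (gauss_density v x) * ennreal (gauss_density w (u - x)) * f u \<partial>lborel \<partial>lborel)"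
      by (rule lborel_pair.Fubini') measurable
    also have "\<dots> = (\<integral>\<^sup>+u. ennreal (gauss_density (v + w) u) * f u \<partial>lborel)"
      using 3 by (simp add: nn_integral_multc nn_integral_gauss_density_conv)
    also have "\<dots> = (\<integral>\<^sup>+x. f x \<partial>gaussian (v + w))"
      using 3 by (simp add: gaussian_eq_density nn_integral_density)
    finally show ?thesis .
  next
    case 1
    interpret G: prob_space "gaussian w :: 'a measure" by (rule prob_space_gaussian)
    have "(\<lambda>x. \<integral>\<^sup>+y. f (x + y) \<partial>gaussian w) \<in> borel_measurable borel" by measurable
    with 1 show ?thesis by (simp add: gaussian_0 nn_integral_return)
  next
    case 2
    then show ?thesis by (simp add: gaussian_0 nn_integral_return)
  qed
qed

text \<open>
  All moments are finite because \<open>s\<^sup>p \<le> exp (p s) \<le> exp (p\<^sup>2 + s\<^sup>2/4)\<close>, which leaves a Gaussian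
  factor of variance \<open>2\<close>.
\<close>

lemma integrable_gauss_moment:
  assumes "0 \<le> p"
  shows "integrable lborel (\<lambda>x :: 'a::euclidean_space. norm x powr p * exp (- (norm x)\<^sup>2 / 2))"
proof -
  have g2: "integrable lborel (\<lambda>x::'a. gauss_density 2 x)"
    by (rule integrableI_nonneg) (auto simp: nn_integral_gauss_density)
  let ?C = "exp (p\<^sup>2) / ((2 * pi * 2) powr (- real DIM('a) / 2))"
  have "norm (norm x powr p * exp (- (norm x)\<^sup>2 / 2)) \<le> norm (?C * gauss_density 2 x)" for x :: 'a
  proof -
    define s where "s = norm x"
    have s: "0 \<le> s" by (simp add: s_def)
    have "s powr p \<le> exp (p\<^sup>2 + s\<^sup>2 / 4)"
    proof (cases "s = 0")
      case False
      then have "s powr p = exp (p * ln s)" by (simp add: powr_def)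
      also have "\<dots> \<le> exp (p * s)" using assms False s
        by (auto intro!: mult_left_mono order.trans[OF ln_le_minus_one])
      also have "\<dots> \<le> exp (p\<^sup>2 + s\<^sup>2 / 4)"
        using zero_le_power2[of "p - s / 2"] by (auto simp: power2_eq_square algebra_simps)
      finally show ?thesis .
    qed simp
    then have "s powr p * exp (- s\<^sup>2 / 2) \<le> exp (p\<^sup>2 + s\<^sup>2 / 4) * exp (- s\<^sup>2 / 2)"
      by (intro mult_right_mono) auto
    also have "\<dots> = exp (p\<^sup>2) * exp (- s\<^sup>2 / 4)" by (simp add: exp_add[symmetric])
    finally show ?thesis by (simp add: gauss_density_def s_def)
  qed
  note bound = this
  show ?thesis
    by (rule Bochner_Integration.integrable_bound[OF integrable_mult_right[OF g2, of ?C]])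
       (measurable, rule AE_I2, rule bound)
qed

section \<open>Directional derivatives and Gaussian integration by parts\<close>

lemma has_real_derivative_along_path:
  assumes "F differentiable (at (p t))" and "(p has_vector_derivative p') (at t)"
  shows "((\<lambda>t. F (p t) :: real) has_real_derivative partial p' F (p t)) (at t)"
proof -
  have F: "(F has_derivative frechet_derivative F (at (p t))) (at (p t))"
    using assms(1) by (simp add: frechet_derivative_works)
  have "((\<lambda>t. F (p t)) has_derivative (\<lambda>h. frechet_derivative F (at (p t)) (h *\<^sub>R p'))) (at t)"
    using diff_chain_at[OF assms(2)[unfolded has_vector_derivative_def] F] by (simp add: o_def)
  moreover have "(\<lambda>h. frechet_derivative F (at (p t)) (h *\<^sub>R p')) = (\<lambda>h. h * partial p' F (p t))"
    using linear_cmul[OF has_derivative_linear[OF F]] by (auto simp: partial_def)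
  ultimately show ?thesis
    by (simp add: has_field_derivative_def mult_commute_abs)
qed

lemma has_derivative_partial:
  assumes "(F has_derivative F') (at x)"
  shows "partial v F x = F' v"
  using frechet_derivative_at[OF assms] by (simp add: partial_def)

lemma partial_add:
  "F differentiable (at x) \<Longrightarrow> partial (v + w) F x = partial v F x + partial w F x"
  unfolding partial_def
  by (meson frechet_derivative_works has_derivative_linear linear_add)

lemma partial_scaleR:
  "F differentiable (at x) \<Longrightarrow> partial (c *\<^sub>R v) F x = c *\<^sub>R partial v F x"
  unfolding partial_def
  by (meson frechet_derivative_works has_derivative_linear linear_cmul)

lemma partial_zero: "F differentiable (at x) \<Longrightarrow> partial 0 F x = 0"
  using partial_scaleR[of F x 0 0] by simp

lemma partial_sum:
  "finite I \<Longrightarrow> F differentiable (at x) \<Longrightarrow> partial (\<Sum>i\<in>I. v i) F x = (\<Sum>i\<in>I. partial (v i) F x)"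
  by (induction I rule: finite_induct) (auto simp: partial_add partial_zero)

lemma integrable_lborel_bounded_support:
  fixes f :: "'a::euclidean_space \<Rightarrow> real"
  assumes [measurable]: "f \<in> borel_measurable borel"
    and "\<And>x. \<bar>f x\<bar> \<le> B" and "\<And>x. R < norm x \<Longrightarrow> f x = 0"
  shows "integrable lborel f"
proof (rule Bochner_Integration.integrable_bound)
  have "emeasure lborel (cball 0 R :: 'a set) < \<infinity>"
    by (rule emeasure_bounded_finite) auto
  then show "integrable lborel (\<lambda>x :: 'a. B * indicator (cball 0 R) x)"
    by (intro integrable_mult_right integrable_real_indicator) auto
  show "AE x in lborel. norm (f x) \<le> norm (B * indicator (cball 0 R) x)"
  proof (rule AE_I2)
    fix x
    show "norm (f x) \<le> norm (B * indicator (cball 0 R) x)"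
      using assms(2)[of x] assms(3)[of x] by (auto simp: indicator_def)
  qed
qed simp

lemma bounded_of_bounded_support:
  fixes f :: "'a::euclidean_space \<Rightarrow> real"
  assumes "continuous_on UNIV f" and "\<And>x. R < norm x \<Longrightarrow> f x = 0"
  obtains B where "\<And>x. \<bar>f x\<bar> \<le> B"
proof -
  have "bounded (f ` cball 0 R)"
    by (intro compact_imp_bounded compact_continuous_image continuous_on_subset[OF assms(1)]) auto
  then obtain B where B: "\<And>x. x \<in> cball 0 R \<Longrightarrow> \<bar>f x\<bar> \<le> B"
    unfolding bounded_iff by (metis imageI real_norm_def)
  have "\<bar>f x\<bar> \<le> max B 0" for x
    using B[of x] assms(2)[of x] by (cases "R < norm x") auto
  then show thesis by (rule that)
qed

lemma partial_zero_outside: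
  fixes F :: "'a::real_normed_vector \<Rightarrow> real"
  assumes "open S" "x \<in> S" "\<And>y. y \<in> S \<Longrightarrow> F y = 0"
  shows "partial v F x = 0"
proof -
  have "(F has_derivative (\<lambda>_. 0)) (at x)"
    by (rule has_derivative_transform_within_open[of "\<lambda>_. 0" _ _ _ S]) (use assms in auto)
  then show ?thesis by (rule has_derivative_partial)
qed

lemma partial_zero_outside_ball:
  fixes F :: "'a::real_normed_vector \<Rightarrow> real"
  assumes "\<And>x. R < norm x \<Longrightarrow> F x = 0" and "R < norm x"
  shows "partial v F x = 0"
  by (rule partial_zero_outside[of "- cball 0 R"]) (use assms in auto)

text \<open>
  By translation invariance of Lebesgue measure every difference quotient of \<open>F\<close> has integral zero,
  and the difference quotients converge boundedly to the directional derivative.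
\<close>

lemma integral_partial_eq_0:
  fixes F :: "'a::euclidean_space \<Rightarrow> real"
  assumes F: "\<And>x. F differentiable (at x)" and cont: "continuous_on UNIV (partial v F)"
    and R: "\<And>x. R < norm x \<Longrightarrow> F x = 0"
  shows "(\<integral>x. partial v F x \<partial>lborel) = 0"
proof -
  have contF: "continuous_on UNIV F"
    using F by (simp add: continuous_at_imp_continuous_on differentiable_imp_continuous_within)
  have [measurable]: "F \<in> borel_measurable borel" "partial v F \<in> borel_measurable borel"
    using contF cont by (auto intro: borel_measurable_continuous_onI)
  obtain C where C: "\<And>x. \<bar>F x\<bar> \<le> C" using bounded_of_bounded_support[OF contF R] by blast
  have R': "R < norm x \<Longrightarrow> partial v F x = 0" for x by (rule partial_zero_outside_ball[OF R])
  obtain B where B: "\<And>x. \<bar>partial v F x\<bar> \<le> B" using bounded_of_bounded_support[OF cont R'] by blast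
  have intF: "integrable lborel F" by (rule integrable_lborel_bounded_support[OF _ C R]) auto
  have shift: "integrable lborel (\<lambda>x. F (x + w))" "(\<integral>x. F (x + w) \<partial>lborel) = (\<integral>x. F x \<partial>lborel)" for w
  proof -
    have "integrable (distr lborel borel ((+) w)) F" using intF by (simp add: lborel_distr_plus)
    then show "integrable lborel (\<lambda>x. F (x + w))"
      by (subst (asm) integrable_distr_eq) (auto simp: add.commute)
    have "(\<integral>x. F x \<partial>lborel) = (\<integral>x. F x \<partial>distr lborel borel ((+) w))" by (simp add: lborel_distr_plus)
    also have "\<dots> = (\<integral>x. F (x + w) \<partial>lborel)"
      by (subst integral_distr) (auto simp: add.commute)
    finally show "(\<integral>x. F (x + w) \<partial>lborel) = (\<integral>x. F x \<partial>lborel)" ..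
  qed
  have deriv: "((\<lambda>s. F (x + s *\<^sub>R v)) has_real_derivative partial v F (x + s *\<^sub>R v)) (at s)" for x s
    by (rule has_real_derivative_along_path[OF F]) (auto intro!: derivative_eq_intros)
  define h :: "nat \<Rightarrow> real" where "h n = 1 / (real n + 1)" for n
  have h: "0 < h n" "h n \<le> 1" for n by (auto simp: h_def)
  define Q where "Q n x = (F (x + h n *\<^sub>R v) - F x) / h n" for n x
  have Q_bound: "\<bar>Q n x\<bar> \<le> B" for n x
  proof -
    obtain z where "F (x + h n *\<^sub>R v) - F (x + 0 *\<^sub>R v) = (h n - 0) * partial v F (x + z *\<^sub>R v)"
      using MVT2[OF h(1) deriv[of x]] by blast
    then have "Q n x = partial v F (x + z *\<^sub>R v)" using h(1)[of n] by (simp add: Q_def)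
    then show ?thesis using B by simp
  qed
  have Q_supp: "Q n x = 0" if "R + norm v < norm x" for n x
  proof -
    have "norm (h n *\<^sub>R v) \<le> norm v" using h[of n] by (simp add: mult_left_le_one_le)
    then have "R < norm (x + h n *\<^sub>R v)" using that norm_triangle_ineq4[of "x + h n *\<^sub>R v" "h n *\<^sub>R v"] by simp
    moreover have "R < norm x" using that norm_ge_zero[of v] by linarith
    ultimately show ?thesis using R by (simp add: Q_def)
  qed
  have "(\<lambda>n. \<integral>x. Q n x \<partial>lborel) \<longlonglongrightarrow> (\<integral>x. partial v F x \<partial>lborel)"
  proof (rule integral_dominated_convergence[where w = "\<lambda>x. B * indicator (cball 0 (R + norm v)) x"])
    have "emeasure lborel (cball 0 (R + norm v) :: 'a set) < \<infinity>"
      by (rule emeasure_bounded_finite) auto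
    then show "integrable lborel (\<lambda>x :: 'a. B * indicator (cball 0 (R + norm v)) x)"
      by (intro integrable_mult_right integrable_real_indicator) auto
    show "AE x in lborel. norm (Q n x) \<le> B * indicator (cball 0 (R + norm v)) x" for n
      using Q_bound[of n] Q_supp[of _ n] by (intro AE_I2) (auto simp: indicator_def)
    show "AE x in lborel. (\<lambda>n. Q n x) \<longlonglongrightarrow> partial v F x"
    proof (rule AE_I2)
      fix x
      have lim: "((\<lambda>s. (F (x + s *\<^sub>R v) - F x) / s) \<longlongrightarrow> partial v F x) (at 0)"
        using deriv[of x 0] by (simp add: has_field_derivative_iff)
      have "filterlim h (at 0) sequentially"
        unfolding filterlim_at using h(1)
        by (auto simp: h_def[abs_def] less_imp_neq[symmetric] intro!: LIMSEQ_inverse_real_of_nat[unfolded inverse_eq_divide of_nat_Suc add.commute[of 1]])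
      from filterlim_compose[OF lim this] show "(\<lambda>n. Q n x) \<longlonglongrightarrow> partial v F x" by (simp add: Q_def)
    qed
  qed (simp_all add: Q_def)
  moreover have "(\<integral>x. Q n x \<partial>lborel) = 0" for n
    using shift intF by (simp add: Q_def)
  ultimately show ?thesis by (simp add: LIMSEQ_const_iff)
qed

text \<open>
  Stein's identity for \<open>y + s Z\<close>: integrate \<open>\<partial>\<^sub>i (\<gamma> z * g (y + s z))\<close>, using
  \<open>\<partial>\<^sub>i \<gamma> z = - z\<^sub>i * \<gamma> z\<close> for the standard Gaussian density \<open>\<gamma>\<close>.
\<close>

lemma gaussian_integration_by_parts:
  fixes g :: "'a::euclidean_space \<Rightarrow> real"
  assumes g: "\<And>x. g differentiable (at x)" and cont: "continuous_on UNIV (partial i g)"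
    and R: "\<And>x. R < norm x \<Longrightarrow> g x = 0" and s: "0 < s"
  shows "(\<integral>z. (z \<bullet> i) * g (y + s *\<^sub>R z) \<partial>std_gaussian) = s * (\<integral>z. partial i g (y + s *\<^sub>R z) \<partial>std_gaussian)"
proof -
  let ?\<gamma> = "gauss_density 1 :: 'a \<Rightarrow> real"
  define F where "F z = ?\<gamma> z * g (y + s *\<^sub>R z)" for z
  define A where "A z = ?\<gamma> z * ((z \<bullet> i) * g (y + s *\<^sub>R z))" for z
  define B where "B z = ?\<gamma> z * (s * partial i g (y + s *\<^sub>R z))" for z
  have \<gamma>: "(?\<gamma> has_derivative (\<lambda>h. - (z \<bullet> h) * ?\<gamma> z)) (at z)" for z
  proof -
    have "((\<lambda>z. - (norm z)\<^sup>2 / (2 * 1)) has_derivative (\<lambda>h. - (z \<bullet> h))) (at z)"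
      unfolding power2_norm_eq_inner
      by (rule derivative_eq_intros refl | simp add: inner_commute)+
    then have "((\<lambda>z. exp (- (norm z)\<^sup>2 / (2 * 1))) has_derivative (\<lambda>h. - (z \<bullet> h) * exp (- (norm z)\<^sup>2 / (2 * 1)))) (at z)"
      by (rule has_derivative_exp[THEN has_derivative_eq_rhs]) (simp add: fun_eq_iff)
    then have "((\<lambda>z. c * exp (- (norm z)\<^sup>2 / (2 * 1))) has_derivative (\<lambda>h. c * (- (z \<bullet> h) * exp (- (norm z)\<^sup>2 / (2 * 1))))) (at z)" for c
      by (rule has_derivative_mult_right)
    then show ?thesis unfolding gauss_density_def
      by (rule has_derivative_eq_rhs) (simp add: fun_eq_iff)
  qed
  have g': "((\<lambda>z. g (y + s *\<^sub>R z)) has_derivative (\<lambda>h. frechet_derivative g (at (y + s *\<^sub>R z)) (s *\<^sub>R h))) (at z)" for z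
  proof -
    have 1: "(g has_derivative frechet_derivative g (at (y + s *\<^sub>R z))) (at (y + s *\<^sub>R z))"
      using g by (simp add: frechet_derivative_works)
    have 2: "((\<lambda>z. y + s *\<^sub>R z) has_derivative (\<lambda>h. s *\<^sub>R h)) (at z)"
      by (auto intro!: derivative_eq_intros)
    show ?thesis using diff_chain_at[OF 2 1] by (simp add: o_def)
  qed
  have F': "(F has_derivative (\<lambda>h. ?\<gamma> z * frechet_derivative g (at (y + s *\<^sub>R z)) (s *\<^sub>R h)
      + (- (z \<bullet> h) * ?\<gamma> z) * g (y + s *\<^sub>R z))) (at z)" for z
    unfolding F_def by (rule has_derivative_mult[OF \<gamma> g'])
  have pF: "partial i F = (\<lambda>z. B z - A z)"
  proof
    fix z
    have "frechet_derivative g (at (y + s *\<^sub>R z)) (s *\<^sub>R i) = s * partial i g (y + s *\<^sub>R z)"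
      using partial_scaleR[OF g] by (simp add: partial_def)
    then show "partial i F z = B z - A z"
      unfolding has_derivative_partial[OF F'] A_def B_def by (simp add: algebra_simps)
  qed
  have contg: "continuous_on UNIV g"
    using g by (simp add: continuous_at_imp_continuous_on differentiable_imp_continuous_within)
  have cont\<gamma>: "continuous_on UNIV ?\<gamma>"
    unfolding gauss_density_def by (intro continuous_intros) auto
  have contA: "continuous_on UNIV A" unfolding A_def
    by (intro continuous_intros cont\<gamma> continuous_on_compose2[OF contg]) auto
  have contB: "continuous_on UNIV B" unfolding B_def
    by (intro continuous_intros cont\<gamma> continuous_on_compose2[OF cont]) auto
  have far: "R < norm (y + s *\<^sub>R z)" if "(\<bar>R\<bar> + norm y) / s < norm z" for z
  proof -
    have "\<bar>R\<bar> + norm y < s * norm z" using that s by (simp add: field_simps)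
    then show ?thesis using norm_triangle_ineq4[of "y + s *\<^sub>R z" y] s by simp
  qed
  have suppA: "A z = 0" and suppB: "B z = 0" and suppF: "F z = 0" if "(\<bar>R\<bar> + norm y) / s < norm z" for z
    using R[OF far[OF that]] partial_zero_outside_ball[OF R far[OF that]]
    by (auto simp: A_def B_def F_def)
  obtain CA where "\<And>z. \<bar>A z\<bar> \<le> CA" using bounded_of_bounded_support[OF contA suppA] by blast
  then have intA: "integrable lborel A"
    by (rule integrable_lborel_bounded_support[OF borel_measurable_continuous_onI[OF contA] _ suppA])
  obtain CB where "\<And>z. \<bar>B z\<bar> \<le> CB" using bounded_of_bounded_support[OF contB suppB] by blast
  then have intB: "integrable lborel B"
    by (rule integrable_lborel_bounded_support[OF borel_measurable_continuous_onI[OF contB] _ suppB])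
  have "(\<integral>z. partial i F z \<partial>lborel) = 0"
  proof (rule integral_partial_eq_0[OF _ _ suppF])
    show "F differentiable at z" for z
      using F'[of z] by (rule differentiableI)
    show "continuous_on UNIV (partial i F)"
      unfolding pF by (intro continuous_intros contA contB)
  qed
  then have eq: "(\<integral>z. A z \<partial>lborel) = (\<integral>z. B z \<partial>lborel)"
    using intA intB by (simp add: pF)
  have [measurable]: "g \<in> borel_measurable borel" "partial i g \<in> borel_measurable borel"
    using contg cont by (auto intro: borel_measurable_continuous_onI)
  have "(\<integral>z. (z \<bullet> i) * g (y + s *\<^sub>R z) \<partial>std_gaussian) = (\<integral>z. A z \<partial>lborel)"
    by (subst integral_density) (auto simp: A_def[abs_def])
  also have "\<dots> = (\<integral>z. s * partial i g (y + s *\<^sub>R z) \<partial>std_gaussian)"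
    unfolding eq by (subst integral_density) (auto simp: B_def[abs_def])
  finally show ?thesis by simp
qed

section \<open>Minkowski's inequality\<close>

text \<open>
  At the end point \<open>0\<close> convexity reduces to \<open>c\<^sup>p \<le> c\<close> for \<open>0 \<le> c \<le> 1\<close>.
\<close>

lemma powr_convex_combination:
  fixes p x y l :: real
  assumes p: "1 \<le> p" and xy: "0 \<le> x" "0 \<le> y" and l: "0 \<le> l" "l \<le> 1"
  shows "(l * x + (1 - l) * y) powr p \<le> l * x powr p + (1 - l) * y powr p"
proof -
  have le: "c powr p \<le> c" if "0 \<le> c" "c \<le> 1" for c :: real
    using powr_mono'[of 1 p c] that p by (cases "c = 0") auto
  consider "x = 0" | "y = 0" | "0 < x" "0 < y" using xy by force
  then show ?thesis
  proof cases
    case 1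
    then show ?thesis using le[of "1 - l"] l xy by (simp add: powr_mult mult_right_mono)
  next
    case 2
    then show ?thesis using le[of l] l xy by (simp add: powr_mult mult_right_mono)
  next
    case 3
    then show ?thesis
      using convex_onD[OF powr_convex[OF p], of "1 - l" x y] l by simp
  qed
qed

text \<open>
  Writing \<open>(f + g)/(A + B)\<close> as a convex combination of \<open>f/A\<close> and \<open>g/B\<close> reduces the claim to the
  convexity of \<open>s \<mapsto> s\<^sup>p\<close>.
\<close>

lemma nn_integral_Minkowski:
  fixes f g :: "'w \<Rightarrow> 'b::{second_countable_topology, real_normed_vector}"
  assumes [measurable]: "f \<in> borel_measurable M" "g \<in> borel_measurable M"
    and p: "1 \<le> p" and AB: "0 < A" "0 < B"
    and f: "(\<integral>\<^sup>+\<omega>. ennreal (norm (f \<omega>) powr p) \<partial>M) \<le> ennreal (A powr p)"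
    and g: "(\<integral>\<^sup>+\<omega>. ennreal (norm (g \<omega>) powr p) \<partial>M) \<le> ennreal (B powr p)"
  shows "(\<integral>\<^sup>+\<omega>. ennreal (norm (f \<omega> + g \<omega>) powr p) \<partial>M) \<le> ennreal ((A + B) powr p)"
proof -
  define l where "l = A / (A + B)"
  have l: "0 \<le> l" "l \<le> 1" "1 - l = B / (A + B)" using AB by (auto simp: l_def field_simps)
  define \<alpha> \<beta> where "\<alpha> = (A + B) powr p * l / A powr p" and "\<beta> = (A + B) powr p * (1 - l) / B powr p"
  have ab: "0 \<le> \<alpha>" "0 \<le> \<beta>" using l AB by (auto simp: \<alpha>_def \<beta>_def)
  have pw: "norm (x + y) powr p \<le> \<alpha> * norm x powr p + \<beta> * norm y powr p" for x y :: 'b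
  proof -
    have "norm (x + y) powr p \<le> (norm x + norm y) powr p"
      using p by (intro powr_mono2 norm_triangle_ineq) auto
    also have "norm x + norm y = (A + B) * (l * (norm x / A) + (1 - l) * (norm y / B))"
    proof -
      have 1: "(A + B) * l = A" "(A + B) * (1 - l) = B" using AB unfolding l(3) by (auto simp: l_def)
      have "(A + B) * (l * (norm x / A) + (1 - l) * (norm y / B)) =
          ((A + B) * l) * (norm x / A) + ((A + B) * (1 - l)) * (norm y / B)"
        by (simp only: distrib_left mult.assoc)
      then show ?thesis unfolding 1 using AB by simp
    qed
    also have "\<dots> powr p = (A + B) powr p * (l * (norm x / A) + (1 - l) * (norm y / B)) powr p"
      using AB l by (subst powr_mult) auto
    also have "\<dots> \<le> (A + B) powr p * (l * (norm x / A) powr p + (1 - l) * (norm y / B) powr p)"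
      using AB l by (intro mult_left_mono powr_convex_combination p) auto
    also have "\<dots> = \<alpha> * norm x powr p + \<beta> * norm y powr p"
      using AB by (simp add: powr_divide \<alpha>_def \<beta>_def algebra_simps)
    finally show ?thesis .
  qed
  have "(\<integral>\<^sup>+\<omega>. ennreal (norm (f \<omega> + g \<omega>) powr p) \<partial>M) \<le>
      (\<integral>\<^sup>+\<omega>. ennreal \<alpha> * ennreal (norm (f \<omega>) powr p) + ennreal \<beta> * ennreal (norm (g \<omega>) powr p) \<partial>M)"
    using ab by (intro nn_integral_mono) (simp add: pw ennreal_mult[symmetric] ennreal_plus[symmetric] del: ennreal_plus)
  also have "\<dots> = ennreal \<alpha> * (\<integral>\<^sup>+\<omega>. ennreal (norm (f \<omega>) powr p) \<partial>M) +
      ennreal \<beta> * (\<integral>\<^sup>+\<omega>. ennreal (norm (g \<omega>) powr p) \<partial>M)"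
    by (subst nn_integral_add) (auto simp: nn_integral_cmult)
  also have "\<dots> \<le> ennreal \<alpha> * ennreal (A powr p) + ennreal \<beta> * ennreal (B powr p)"
    by (intro add_mono mult_left_mono f g) auto
  also have "\<dots> = ennreal (\<alpha> * A powr p + \<beta> * B powr p)"
    using ab by (simp add: ennreal_mult[symmetric] ennreal_plus[symmetric] del: ennreal_plus)
  also have "\<alpha> * A powr p + \<beta> * B powr p = (A + B) powr p * (l + (1 - l))"
    using AB unfolding \<alpha>_def \<beta>_def distrib_left by simp
  finally show ?thesis by simp
qed

lemma Lp_norm_le_iff:
  assumes "0 < p" and "0 \<le> A"
  shows "Lp_norm M p f \<le> ennreal A \<longleftrightarrow> (\<integral>\<^sup>+\<omega>. ennreal (norm (f \<omega>) powr p) \<partial>M) \<le> ennreal (A powr p)"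
proof (cases "(\<integral>\<^sup>+\<omega>. ennreal (norm (f \<omega>) powr p) \<partial>M) = \<infinity>")
  case True
  then show ?thesis by (simp add: Lp_norm_def top_unique)
next
  case False
  then obtain m where m: "0 \<le> m" "(\<integral>\<^sup>+\<omega>. ennreal (norm (f \<omega>) powr p) \<partial>M) = ennreal m"
    by (cases "\<integral>\<^sup>+\<omega>. ennreal (norm (f \<omega>) powr p) \<partial>M") auto
  have "m powr (1 / p) \<le> A \<longleftrightarrow> m \<le> A powr p"
  proof
    assume "m powr (1 / p) \<le> A"
    then have "(m powr (1 / p)) powr p \<le> A powr p" using assms by (intro powr_mono2) auto
    then show "m \<le> A powr p" using assms m by (simp add: powr_powr)
  next
    assume "m \<le> A powr p"
    then have "m powr (1 / p) \<le> (A powr p) powr (1 / p)" using assms m by (intro powr_mono2) auto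
    then show "m powr (1 / p) \<le> A" using assms m by (simp add: powr_powr)
  qed
  then show ?thesis using assms m by (simp add: Lp_norm_def)
qed

lemma Lp_norm_triangle:
  fixes f g :: "'w \<Rightarrow> 'b::{second_countable_topology, real_normed_vector}"
  assumes [measurable]: "f \<in> borel_measurable M" "g \<in> borel_measurable M" and p: "1 \<le> p"
  shows "Lp_norm M p (\<lambda>\<omega>. f \<omega> + g \<omega>) \<le> Lp_norm M p f + Lp_norm M p g"
proof (cases "Lp_norm M p f = \<infinity> \<or> Lp_norm M p g = \<infinity>")
  case False
  then obtain A B where A: "0 \<le> A" "Lp_norm M p f = ennreal A" and B: "0 \<le> B" "Lp_norm M p g = ennreal B"
    by (cases "Lp_norm M p f"; cases "Lp_norm M p g") auto
  show ?thesis
  \<comment> \<open>The norms may vanish, whereas the normalization needs positive numbers: enlarge both by \<open>e/2\<close>.\<close>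
  proof (rule ennreal_le_epsilon)
    fix e :: real assume e: "0 < e"
    have "(\<integral>\<^sup>+\<omega>. ennreal (norm (f \<omega> + g \<omega>) powr p) \<partial>M) \<le> ennreal (((A + e / 2) + (B + e / 2)) powr p)"
    proof (rule nn_integral_Minkowski)
      show "(\<integral>\<^sup>+\<omega>. ennreal (norm (f \<omega>) powr p) \<partial>M) \<le> ennreal ((A + e / 2) powr p)"
        using A e p by (subst Lp_norm_le_iff[symmetric]) auto
      show "(\<integral>\<^sup>+\<omega>. ennreal (norm (g \<omega>) powr p) \<partial>M) \<le> ennreal ((B + e / 2) powr p)"
        using B e p by (subst Lp_norm_le_iff[symmetric]) auto
    qed (use A B e p in auto)
    then have "Lp_norm M p (\<lambda>\<omega>. f \<omega> + g \<omega>) \<le> ennreal ((A + e / 2) + (B + e / 2))"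
      using A B e p by (subst Lp_norm_le_iff) auto
    then show "Lp_norm M p (\<lambda>\<omega>. f \<omega> + g \<omega>) \<le> Lp_norm M p f + Lp_norm M p g + ennreal e"
      using A B e by (simp add: ennreal_plus[symmetric] add.assoc[symmetric] del: ennreal_plus) (simp add: add.commute add.left_commute)
  qed
qed auto

lemma Lp_norm_scaleR:
  assumes [measurable]: "f \<in> borel_measurable M" and p: "1 \<le> p" and c: "0 < c"
  shows "Lp_norm M p (\<lambda>\<omega>. c *\<^sub>R f \<omega>) = ennreal c * Lp_norm M p f"
proof -
  have eq: "(\<integral>\<^sup>+\<omega>. ennreal (norm (c *\<^sub>R f \<omega>) powr p) \<partial>M) =
      ennreal (c powr p) * (\<integral>\<^sup>+\<omega>. ennreal (norm (f \<omega>) powr p) \<partial>M)"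
    using c by (subst nn_integral_cmult[symmetric]) (auto simp: powr_mult ennreal_mult)
  show ?thesis
  proof (cases "(\<integral>\<^sup>+\<omega>. ennreal (norm (f \<omega>) powr p) \<partial>M) = \<infinity>")
    case True
    then show ?thesis unfolding Lp_norm_def eq using c by (simp add: ennreal_mult_top)
  next
    case False
    then obtain m where m: "0 \<le> m" "(\<integral>\<^sup>+\<omega>. ennreal (norm (f \<omega>) powr p) \<partial>M) = ennreal m"
      by (cases "\<integral>\<^sup>+\<omega>. ennreal (norm (f \<omega>) powr p) \<partial>M") auto
    show ?thesis unfolding Lp_norm_def eq m(2) using c m p
      by (simp add: ennreal_mult[symmetric] powr_mult powr_powr)
  qed
qed

lemma Lp_norm_cong_AE:
  assumes "AE \<omega> in M. f \<omega> = g \<omega>"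
  shows "Lp_norm M p f = Lp_norm M p g"
proof -
  have "(\<integral>\<^sup>+\<omega>. ennreal (norm (f \<omega>) powr p) \<partial>M) = (\<integral>\<^sup>+\<omega>. ennreal (norm (g \<omega>) powr p) \<partial>M)"
    by (rule nn_integral_cong_AE) (use assms in auto)
  then show ?thesis by (simp add: Lp_norm_def)
qed

lemma Lp_norm_distr:
  fixes f :: "'b \<Rightarrow> 'c::{second_countable_topology, real_normed_vector}"
  assumes [measurable]: "X \<in> measurable M N" "f \<in> borel_measurable N"
  shows "Lp_norm (distr M N X) p f = Lp_norm M p (\<lambda>\<omega>. f (X \<omega>))"
  unfolding Lp_norm_def by (simp add: nn_integral_distr)

lemma Lp_norm_2:
  assumes "(\<integral>\<^sup>+\<omega>. ennreal ((norm (f \<omega>))\<^sup>2) \<partial>M) = ennreal c" and "0 \<le> c"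
  shows "Lp_norm M 2 f = ennreal (sqrt c)"
  using assms by (simp add: Lp_norm_def powr_half_sqrt)

lemma Lp_norm_gaussian:
  assumes p: "1 \<le> p" and v: "0 \<le> v"
  shows "Lp_norm (gaussian v) p (\<lambda>x. x :: 'a::euclidean_space) = ennreal (gauss_Lp_const TYPE('a) p * sqrt v)"
proof -
  let ?K = "(2 * pi) powr (- real DIM('a) / 2)"
  let ?I = "\<integral>x. norm (x::'a) powr p * exp (- (norm x)\<^sup>2 / 2) \<partial>lborel"
  have int: "integrable lborel (\<lambda>x :: 'a. norm x powr p * exp (- (norm x)\<^sup>2 / 2))"
    using p by (intro integrable_gauss_moment) auto
  have I0: "0 \<le> ?I" by (intro integral_nonneg_AE) auto
  have "(\<integral>\<^sup>+x. ennreal (norm x powr p) \<partial>(std_gaussian :: 'a measure)) =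
      (\<integral>\<^sup>+x. ennreal ?K * ennreal (norm (x :: 'a) powr p * exp (- (norm x)\<^sup>2 / 2)) \<partial>lborel)"
    by (subst nn_integral_density) (auto simp: gauss_density_def ennreal_mult[symmetric] mult_ac intro!: nn_integral_cong)
  also have "\<dots> = ennreal ?K * ennreal ?I"
    using int by (simp add: nn_integral_cmult nn_integral_eq_integral)
  also have "\<dots> = ennreal (?K * ?I)" using I0 by (simp add: ennreal_mult)
  finally have "(\<integral>\<^sup>+x. ennreal (norm x powr p) \<partial>(std_gaussian :: 'a measure)) = ennreal (?K * ?I)" .
  moreover have "(\<integral>\<^sup>+x. ennreal (norm x powr p) \<partial>(gaussian v :: 'a measure)) =
      (\<integral>\<^sup>+x. ennreal (sqrt v powr p) * ennreal (norm x powr p) \<partial>(std_gaussian :: 'a measure))"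
    using v by (subst nn_integral_gaussian) (auto simp: powr_mult ennreal_mult)
  ultimately have "(\<integral>\<^sup>+x. ennreal (norm x powr p) \<partial>(gaussian v :: 'a measure)) = ennreal (sqrt v powr p * (?K * ?I))"
    using I0 by (simp add: nn_integral_cmult ennreal_mult)
  then have "Lp_norm (gaussian v) p (\<lambda>x. x :: 'a) = ennreal ((sqrt v powr p * (?K * ?I)) powr (1 / p))"
    using I0 by (simp add: Lp_norm_def)
  also have "(sqrt v powr p * (?K * ?I)) powr (1 / p) = (?K * ?I) powr (1 / p) * sqrt v"
    using I0 p v by (subst powr_mult) (auto simp: powr_powr mult.commute)
  finally show ?thesis by (simp add: gauss_Lp_const_def)
qed

section \<open>Joint laws\<close>

text \<open>
  Bounded Lipschitz functions separate laws: the indicator of a closed set \<open>C\<close> is the pointwise limit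
  of \<open>x \<mapsto> max 0 (1 - n * dist(x, C))\<close>.
\<close>

lemma measure_eqI_lipschitz:
  fixes N N' :: "'b::metric_space measure"
  assumes N: "prob_space N" "sets N = sets borel" and N': "prob_space N'" "sets N' = sets borel"
    and eq: "\<And>h L. 0 \<le> L \<Longrightarrow> (\<And>x. \<bar>h x\<bar> \<le> 1) \<Longrightarrow> (\<And>x y. \<bar>h x - h y\<bar> \<le> L * dist x y) \<Longrightarrow>
      (\<integral>x. h x \<partial>N) = (\<integral>x. h x \<partial>N' :: real)"
  shows "N = N'"
proof -
  interpret N: prob_space N by fact
  interpret N': prob_space N' by fact
  have spaces: "space N = UNIV" "space N' = UNIV"
    using sets_eq_imp_space_eq[OF N(2)] sets_eq_imp_space_eq[OF N'(2)] by auto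
  have closed_eq: "emeasure N C = emeasure N' C" if C: "closed C" for C
  proof (cases "C = {}")
    case False
    define h :: "nat \<Rightarrow> 'b \<Rightarrow> real" where "h n x = max 0 (1 - real n * infdist x C)" for n x
    have h_bound: "\<bar>h n x\<bar> \<le> 1" for n x
      by (simp add: h_def infdist_nonneg)
    have h_lip: "\<bar>h n x - h n y\<bar> \<le> real n * dist x y" for n x y
    proof -
      have "\<bar>h n x - h n y\<bar> \<le> \<bar>real n * infdist x C - real n * infdist y C\<bar>" by (simp add: h_def)
      also have "\<dots> = real n * \<bar>infdist x C - infdist y C\<bar>"
        by (simp add: abs_mult right_diff_distrib[symmetric])
      also have "\<dots> \<le> real n * dist x y"
        by (intro mult_left_mono infdist_triangle_abs) auto
      finally show ?thesis .
    qed
    have [measurable]: "h n \<in> borel_measurable borel" for n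
      unfolding h_def by (intro borel_measurable_continuous_onI continuous_intros)
    have h_lim: "(\<lambda>n. h n x) \<longlonglongrightarrow> indicator C x" for x
    proof (cases "x \<in> C")
      case True
      then show ?thesis by (simp add: h_def)
    next
      case x: False
      then have pos: "0 < infdist x C" using C False by (intro infdist_pos_not_in_closed)
      obtain m where m: "1 / infdist x C < real m" using reals_Archimedean2 by blast
      have "h n x = 0" if "m \<le> n" for n
      proof -
        have "1 / infdist x C < real n" using m that by linarith
        then show ?thesis using pos by (simp add: h_def field_simps)
      qed
      then have "eventually (\<lambda>n. h n x = 0) sequentially" by (auto simp: eventually_sequentially)
      then show ?thesis using x by (simp add: tendsto_eventually)
    qed
    have lim: "(\<lambda>n. \<integral>x. h n x \<partial>P) \<longlonglongrightarrow> measure P C" if "prob_space P" "sets P = sets borel" for P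
    proof -
      interpret P: prob_space P by fact
      have [measurable_cong]: "sets P = sets borel" by fact
      have [measurable]: "C \<in> sets borel" using C by simp
      have "(\<lambda>n. \<integral>x. h n x \<partial>P) \<longlonglongrightarrow> (\<integral>x. indicator C x \<partial>P)"
        by (rule integral_dominated_convergence[where w = "\<lambda>_. 1"]) (auto simp: h_bound h_lim)
      also have "(\<integral>x. indicator C x \<partial>P) = measure P C"
        using sets_eq_imp_space_eq[OF that(2)] by simp
      finally show ?thesis .
    qed
    have "(\<integral>x. h n x \<partial>N) = (\<integral>x. h n x \<partial>N')" for n
      by (rule eq[of "real n"]) (auto simp: h_bound h_lip)
    then have "measure N C = measure N' C"
      using lim[OF N] lim[OF N'] LIMSEQ_unique by auto
    then show ?thesis by (simp add: N.emeasure_eq_measure N'.emeasure_eq_measure)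
  qed simp
  show ?thesis
  proof (rule measure_eqI_generator_eq[where E = "Collect closed" and \<Omega> = UNIV and A = "\<lambda>_. UNIV"])
    show "Int_stable (Collect closed :: 'b set set)" by (auto simp: Int_stable_def)
    show "sets N = sigma_sets UNIV (Collect closed)" "sets N' = sigma_sets UNIV (Collect closed)"
      using N N' by (auto simp: borel_eq_closed)
  qed (use closed_eq in auto)
qed

text \<open>
  Independence in the form of a product law is what Fubini's theorem needs.
\<close>

lemma indep_rv_distr:
  assumes "prob_space M" and ind: "indep_rv M A X B Y"
  shows "distr M (A \<Otimes>\<^sub>M B) (\<lambda>\<omega>. (X \<omega>, Y \<omega>)) = distr M A X \<Otimes>\<^sub>M distr M B Y"
proof -
  interpret prob_space M by fact
  have [measurable]: "X \<in> measurable M A" "Y \<in> measurable M B" using ind by (auto simp: indep_rv_def)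
  interpret X: prob_space "distr M A X" by (rule prob_space_distr) simp
  interpret Y: prob_space "distr M B Y" by (rule prob_space_distr) simp
  show ?thesis
  proof (rule pair_measure_eqI[symmetric])
    fix S T assume "S \<in> sets (distr M A X)" "T \<in> sets (distr M B Y)"
    then have [measurable]: "S \<in> sets A" "T \<in> sets B" by auto
    have "prob ((X -` S \<inter> space M) \<inter> (Y -` T \<inter> space M)) = prob (X -` S \<inter> space M) * prob (Y -` T \<inter> space M)"
      by (rule indep_setD[OF ind[unfolded indep_rv_def, THEN conjunct2, THEN conjunct2]])
         (use \<open>S \<in> sets A\<close> \<open>T \<in> sets B\<close> in auto)
    moreover have "(X -` S \<inter> space M) \<inter> (Y -` T \<inter> space M) = (\<lambda>\<omega>. (X \<omega>, Y \<omega>)) -` (S \<times> T) \<inter> space M" by auto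
    ultimately show "emeasure (distr M A X) S * emeasure (distr M B Y) T =
        emeasure (distr M (A \<Otimes>\<^sub>M B) (\<lambda>\<omega>. (X \<omega>, Y \<omega>))) (S \<times> T)"
      by (simp add: emeasure_distr emeasure_eq_measure ennreal_mult)
  qed (auto intro: X.sigma_finite_measure_axioms Y.sigma_finite_measure_axioms)
qed

lemma nn_integral_joint_law:
  assumes "prob_space M" and [measurable]: "X \<in> measurable M A" "Y \<in> measurable M B"
    and law: "distr M (A \<Otimes>\<^sub>M B) (\<lambda>\<omega>. (X \<omega>, Y \<omega>)) = distr M A X \<Otimes>\<^sub>M distr M B Y"
    and F[measurable]: "F \<in> borel_measurable (A \<Otimes>\<^sub>M B)"
  shows "(\<integral>\<^sup>+\<omega>. F (X \<omega>, Y \<omega>) \<partial>M) = (\<integral>\<^sup>+\<omega>. \<integral>\<^sup>+\<omega>'. F (X \<omega>, Y \<omega>') \<partial>M \<partial>M)"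
proof -
  interpret prob_space M by fact
  interpret Y: prob_space "distr M B Y" by (rule prob_space_distr) simp
  have "(\<integral>\<^sup>+\<omega>. F (X \<omega>, Y \<omega>) \<partial>M) = (\<integral>\<^sup>+z. F z \<partial>distr M (A \<Otimes>\<^sub>M B) (\<lambda>\<omega>. (X \<omega>, Y \<omega>)))"
    by (subst nn_integral_distr) auto
  also have "\<dots> = (\<integral>\<^sup>+x. \<integral>\<^sup>+y. F (x, y) \<partial>distr M B Y \<partial>distr M A X)"
    unfolding law by (subst Y.nn_integral_fst[symmetric]) auto
  also have "\<dots> = (\<integral>\<^sup>+\<omega>. \<integral>\<^sup>+y. F (X \<omega>, y) \<partial>distr M B Y \<partial>M)"
    by (subst nn_integral_distr) auto
  also have "\<dots> = (\<integral>\<^sup>+\<omega>. \<integral>\<^sup>+\<omega>'. F (X \<omega>, Y \<omega>') \<partial>M \<partial>M)"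
    by (intro nn_integral_cong nn_integral_distr) (auto dest: measurable_space)
  finally show ?thesis .
qed

lemma joint_law_compose:
  assumes "prob_space M" and [measurable]: "X \<in> measurable M A" "Y \<in> measurable M B"
    and law: "distr M (A \<Otimes>\<^sub>M B) (\<lambda>\<omega>. (X \<omega>, Y \<omega>)) = distr M A X \<Otimes>\<^sub>M distr M B Y"
    and [measurable]: "f \<in> measurable A C" "g \<in> measurable B D"
  shows "distr M (C \<Otimes>\<^sub>M D) (\<lambda>\<omega>. (f (X \<omega>), g (Y \<omega>))) = distr M C (\<lambda>\<omega>. f (X \<omega>)) \<Otimes>\<^sub>M distr M D (\<lambda>\<omega>. g (Y \<omega>))"
proof -
  interpret prob_space M by fact
  interpret X: prob_space "distr M C (\<lambda>\<omega>. f (X \<omega>))" by (rule prob_space_distr) simp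
  interpret Y: prob_space "distr M D (\<lambda>\<omega>. g (Y \<omega>))" by (rule prob_space_distr) simp
  interpret X': prob_space "distr M A X" by (rule prob_space_distr) simp
  interpret Y': prob_space "distr M B Y" by (rule prob_space_distr) simp
  show ?thesis
  proof (rule pair_measure_eqI[symmetric])
    fix S T assume "S \<in> sets (distr M C (\<lambda>\<omega>. f (X \<omega>)))" "T \<in> sets (distr M D (\<lambda>\<omega>. g (Y \<omega>)))"
    then have [measurable]: "S \<in> sets C" "T \<in> sets D" by auto
    let ?S = "f -` S \<inter> space A" and ?T = "g -` T \<inter> space B"
    have sp: "\<omega> \<in> space M \<Longrightarrow> X \<omega> \<in> space A" "\<omega> \<in> space M \<Longrightarrow> Y \<omega> \<in> space B" for \<omega>
      by (auto dest: measurable_space[OF assms(2)] measurable_space[OF assms(3)])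
    have "emeasure (distr M (C \<Otimes>\<^sub>M D) (\<lambda>\<omega>. (f (X \<omega>), g (Y \<omega>)))) (S \<times> T) =
        emeasure M ((\<lambda>\<omega>. (X \<omega>, Y \<omega>)) -` (?S \<times> ?T) \<inter> space M)"
      by (subst emeasure_distr) (auto intro!: arg_cong[where f = "emeasure M"] dest: sp)
    also have "\<dots> = emeasure (distr M (A \<Otimes>\<^sub>M B) (\<lambda>\<omega>. (X \<omega>, Y \<omega>))) (?S \<times> ?T)"
      by (subst emeasure_distr) auto
    also have "\<dots> = emeasure (distr M A X) ?S * emeasure (distr M B Y) ?T"
      unfolding law by (rule Y'.emeasure_pair_measure_Times) auto
    also have "emeasure (distr M A X) ?S = emeasure (distr M C (\<lambda>\<omega>. f (X \<omega>))) S"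
      by (simp add: emeasure_distr) (auto intro!: arg_cong[where f = "emeasure M"] dest: sp)
    also have "emeasure (distr M B Y) ?T = emeasure (distr M D (\<lambda>\<omega>. g (Y \<omega>))) T"
      by (simp add: emeasure_distr) (auto intro!: arg_cong[where f = "emeasure M"] dest: sp)
    finally show "emeasure (distr M C (\<lambda>\<omega>. f (X \<omega>))) S * emeasure (distr M D (\<lambda>\<omega>. g (Y \<omega>))) T =
        emeasure (distr M (C \<Otimes>\<^sub>M D) (\<lambda>\<omega>. (f (X \<omega>), g (Y \<omega>)))) (S \<times> T)" ..
  qed (auto intro: X.sigma_finite_measure_axioms Y.sigma_finite_measure_axioms)
qed

text \<open>
  Expanding twice by Fubini, first for \<open>X\<close> against \<open>(Y, Z)\<close> and then for \<open>Y\<close> against \<open>Z\<close>, turns the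
  probability of a rectangle into a triple integral in which \<open>Z\<close> separates from \<open>(X, Y)\<close>.
\<close>

lemma joint_law_combine:
  assumes "prob_space M" and [measurable]: "X \<in> measurable M A" "Y \<in> measurable M B" "Z \<in> measurable M C"
    and lawX: "distr M (A \<Otimes>\<^sub>M (B \<Otimes>\<^sub>M C)) (\<lambda>\<omega>. (X \<omega>, (Y \<omega>, Z \<omega>))) =
      distr M A X \<Otimes>\<^sub>M distr M (B \<Otimes>\<^sub>M C) (\<lambda>\<omega>. (Y \<omega>, Z \<omega>))"
    and lawY: "distr M (B \<Otimes>\<^sub>M C) (\<lambda>\<omega>. (Y \<omega>, Z \<omega>)) = distr M B Y \<Otimes>\<^sub>M distr M C Z"
    and g[measurable]: "g \<in> measurable (A \<Otimes>\<^sub>M B) D"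
  shows "distr M (D \<Otimes>\<^sub>M C) (\<lambda>\<omega>. (g (X \<omega>, Y \<omega>), Z \<omega>)) = distr M D (\<lambda>\<omega>. g (X \<omega>, Y \<omega>)) \<Otimes>\<^sub>M distr M C Z"
proof -
  interpret prob_space M by fact
  interpret G: prob_space "distr M D (\<lambda>\<omega>. g (X \<omega>, Y \<omega>))" by (rule prob_space_distr) simp
  interpret Z: prob_space "distr M C Z" by (rule prob_space_distr) simp
  have lawXY: "distr M (A \<Otimes>\<^sub>M B) (\<lambda>\<omega>. (X \<omega>, Y \<omega>)) = distr M A X \<Otimes>\<^sub>M distr M B Y"
    using joint_law_compose[OF \<open>prob_space M\<close> _ _ lawX, where f = "\<lambda>x. x" and C = A and g = fst and D = B]
    by (simp only: fst_conv measurable_ident_sets[OF refl] measurable_fst measurable_Pair assms(2-4))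
  show ?thesis
  proof (rule pair_measure_eqI[symmetric])
    fix S T assume "S \<in> sets (distr M D (\<lambda>\<omega>. g (X \<omega>, Y \<omega>)))" "T \<in> sets (distr M C Z)"
    then have [measurable]: "S \<in> sets D" "T \<in> sets C" by auto
    have "emeasure (distr M (D \<Otimes>\<^sub>M C) (\<lambda>\<omega>. (g (X \<omega>, Y \<omega>), Z \<omega>))) (S \<times> T) =
        (\<integral>\<^sup>+z. indicator (S \<times> T) z \<partial>distr M (D \<Otimes>\<^sub>M C) (\<lambda>\<omega>. (g (X \<omega>, Y \<omega>), Z \<omega>)))"
      by (subst nn_integral_indicator) auto
    also have "\<dots> = (\<integral>\<^sup>+\<omega>. indicator S (g (X \<omega>, Y \<omega>)) * indicator T (Z \<omega>) \<partial>M)"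
      by (subst nn_integral_distr) (auto intro!: nn_integral_cong simp: indicator_def)
    also have "\<dots> = (\<integral>\<^sup>+\<omega>. \<integral>\<^sup>+\<omega>'. indicator S (g (X \<omega>, Y \<omega>')) * indicator T (Z \<omega>') \<partial>M \<partial>M)"
      by (rule nn_integral_joint_law[OF \<open>prob_space M\<close> _ _ lawX,
            of "\<lambda>(x, y, z). indicator S (g (x, y)) * indicator T z", unfolded split_beta fst_conv snd_conv]) measurable
    also have "\<dots> = (\<integral>\<^sup>+\<omega>. \<integral>\<^sup>+\<omega>'. \<integral>\<^sup>+\<omega>''. indicator S (g (X \<omega>, Y \<omega>')) * indicator T (Z \<omega>'') \<partial>M \<partial>M \<partial>M)"
    proof (rule nn_integral_cong)
      fix \<omega> assume "\<omega> \<in> space M"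
      then have [measurable]: "X \<omega> \<in> space A" by (rule measurable_space[OF assms(2)])
      show "(\<integral>\<^sup>+\<omega>'. indicator S (g (X \<omega>, Y \<omega>')) * indicator T (Z \<omega>') \<partial>M) =
        (\<integral>\<^sup>+\<omega>'. \<integral>\<^sup>+\<omega>''. indicator S (g (X \<omega>, Y \<omega>')) * indicator T (Z \<omega>'') \<partial>M \<partial>M)"
        by (rule nn_integral_joint_law[OF \<open>prob_space M\<close> _ _ lawY,
            of "\<lambda>(y, z). indicator S (g (X \<omega>, y)) * indicator T z", unfolded split_beta fst_conv snd_conv]) measurable
    qed
    also have "\<dots> = (\<integral>\<^sup>+\<omega>. (\<integral>\<^sup>+\<omega>'. indicator S (g (X \<omega>, Y \<omega>')) \<partial>M) * (\<integral>\<^sup>+\<omega>''. indicator T (Z \<omega>'') \<partial>M) \<partial>M)"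
    proof (rule nn_integral_cong)
      fix \<omega> assume "\<omega> \<in> space M"
      then have [measurable]: "X \<omega> \<in> space A" by (rule measurable_space[OF assms(2)])
      show "(\<integral>\<^sup>+\<omega>'. \<integral>\<^sup>+\<omega>''. indicator S (g (X \<omega>, Y \<omega>')) * indicator T (Z \<omega>'') \<partial>M \<partial>M) =
          (\<integral>\<^sup>+\<omega>'. indicator S (g (X \<omega>, Y \<omega>')) \<partial>M) * (\<integral>\<^sup>+\<omega>''. indicator T (Z \<omega>'') \<partial>M)"
        by (subst nn_integral_cmult, measurable) (rule nn_integral_multc, measurable)
    qed
    also have "\<dots> = (\<integral>\<^sup>+\<omega>. \<integral>\<^sup>+\<omega>'. indicator S (g (X \<omega>, Y \<omega>')) \<partial>M \<partial>M) * (\<integral>\<^sup>+\<omega>''. indicator T (Z \<omega>'') \<partial>M)"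
    proof (rule nn_integral_multc)
      have "(\<lambda>p. indicator S (g (X (fst p), Y (snd p))) :: ennreal) \<in> borel_measurable (M \<Otimes>\<^sub>M M)"
        by measurable
      then show "(\<lambda>\<omega>. \<integral>\<^sup>+\<omega>'. indicator S (g (X \<omega>, Y \<omega>')) \<partial>M) \<in> borel_measurable M"
        by (intro borel_measurable_nn_integral) (simp add: split_beta)
    qed
    also have "(\<integral>\<^sup>+\<omega>. \<integral>\<^sup>+\<omega>'. indicator S (g (X \<omega>, Y \<omega>')) \<partial>M \<partial>M) = (\<integral>\<^sup>+\<omega>. indicator S (g (X \<omega>, Y \<omega>)) \<partial>M)"
      by (rule nn_integral_joint_law[OF \<open>prob_space M\<close> _ _ lawXY,
            of "\<lambda>(x, y). indicator S (g (x, y))", unfolded split_beta fst_conv snd_conv, symmetric]) measurable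
    also have "\<dots> = emeasure (distr M D (\<lambda>\<omega>. g (X \<omega>, Y \<omega>))) S"
      by (subst nn_integral_distr[symmetric, where f = "indicator S" and M' = D]) (auto simp: nn_integral_indicator)
    also have "(\<integral>\<^sup>+\<omega>''. indicator T (Z \<omega>'') \<partial>M) = emeasure (distr M C Z) T"
      by (subst nn_integral_distr[symmetric, where f = "indicator T" and M' = C]) (auto simp: nn_integral_indicator)
    finally show "emeasure (distr M D (\<lambda>\<omega>. g (X \<omega>, Y \<omega>))) S * emeasure (distr M C Z) T =
        emeasure (distr M (D \<Otimes>\<^sub>M C) (\<lambda>\<omega>. (g (X \<omega>, Y \<omega>), Z \<omega>))) (S \<times> T)" ..
  qed (auto intro: G.sigma_finite_measure_axioms Z.sigma_finite_measure_axioms)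
qed

section \<open>The law of a Wiener integral\<close>

lemma gaussian_add:
  assumes "0 \<le> v" "0 \<le> w"
  shows "distr (gaussian v \<Otimes>\<^sub>M gaussian w) borel (\<lambda>(x, y). x + y) = (gaussian (v + w) :: 'a::euclidean_space measure)"
proof (rule measure_eqI)
  interpret W: prob_space "gaussian w :: 'a measure" by (rule prob_space_gaussian)
  fix A :: "'a set" assume "A \<in> sets (distr (gaussian v \<Otimes>\<^sub>M gaussian w) borel (\<lambda>(x, y). x + y))"
  then have [measurable]: "A \<in> sets borel" by simp
  have "emeasure (distr (gaussian v \<Otimes>\<^sub>M gaussian w) borel (\<lambda>(x, y). x + y)) A =
      (\<integral>\<^sup>+z. indicator A z \<partial>distr (gaussian v \<Otimes>\<^sub>M gaussian w) borel (\<lambda>(x, y). x + y))"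
    by (subst nn_integral_indicator) auto
  also have "\<dots> = (\<integral>\<^sup>+z. indicator A (fst z + snd z) \<partial>(gaussian v \<Otimes>\<^sub>M gaussian w))"
    by (subst nn_integral_distr) (auto simp: split_beta)
  also have "\<dots> = (\<integral>\<^sup>+x. \<integral>\<^sup>+y. indicator A (x + y) \<partial>gaussian w \<partial>gaussian v)"
    by (subst W.nn_integral_fst[symmetric]) auto
  also have "\<dots> = (\<integral>\<^sup>+x. indicator A x \<partial>gaussian (v + w))"
    by (rule nn_integral_gaussian_add) (use assms in auto)
  finally show "emeasure (distr (gaussian v \<Otimes>\<^sub>M gaussian w) borel (\<lambda>(x, y). x + y)) A = emeasure (gaussian (v + w)) A"
    by simp
qed simp

lemma distr_brownian_increment:
  assumes "brownian_motion M W" and "0 \<le> s" "s < t"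
  shows "distr M borel (\<lambda>\<omega>. W t \<omega> - W s \<omega>) = gaussian (t - s)"
proof -
  have "distributed M lborel (\<lambda>\<omega>. W t \<omega> - W s \<omega>) (\<lambda>x. ennreal (gauss_density (t - s) x))"
    using assms by (auto simp: brownian_motion_def)
  then have "distr M lborel (\<lambda>\<omega>. W t \<omega> - W s \<omega>) = density lborel (\<lambda>x. ennreal (gauss_density (t - s) x))"
    by (rule distributed_distr_eq_density)
  then show ?thesis
    using assms by (simp add: gaussian_eq_density cong: distr_cong)
qed

abbreviation step_variance :: "nat \<Rightarrow> (nat \<Rightarrow> real) \<Rightarrow> (nat \<Rightarrow> real) \<Rightarrow> real" where
  "step_variance n \<tau> c \<equiv> \<Sum>i<n. (c i)\<^sup>2 * (\<tau> (Suc i) - \<tau> i)"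

lemma step_integral_Suc:
  "step_integral W (Suc n) \<tau> c = (\<lambda>\<omega>. step_integral W n \<tau> c \<omega> + c n *\<^sub>R (W (\<tau> (Suc n)) \<omega> - W (\<tau> n) \<omega>))"
  by (simp add: step_integral_def fun_eq_iff)

lemma partition_mono:
  fixes \<tau> :: "nat \<Rightarrow> real"
  assumes "\<And>i. i < n \<Longrightarrow> \<tau> i \<le> \<tau> (Suc i)" and "i \<le> j" "j \<le> n"
  shows "\<tau> i \<le> \<tau> j"
  using assms(2,3)
proof (induction j rule: dec_induct)
  case (step j)
  then show ?case using assms(1)[of j] by linarith
qed simp

text \<open>
  The increment over the last interval is independent of the sum over the earlier ones, so the
  Gaussian variances add up along the partition.
\<close>

lemma distr_step_integral_strict:
  fixes W :: "real \<Rightarrow> 'w \<Rightarrow> 'a::euclidean_space"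
  assumes BM: "brownian_motion M W" and \<tau>: "0 \<le> \<tau> 0" "\<And>i. i < n \<Longrightarrow> \<tau> i < \<tau> (Suc i)" and "j \<le> n"
  shows "distr M borel (step_integral W j \<tau> c) = gaussian (step_variance j \<tau> c)"
  using \<open>j \<le> n\<close>
proof (induction j)
  interpret prob_space M using BM by (auto simp: brownian_motion_def)
  case 0
  have "step_integral W 0 \<tau> c = (\<lambda>\<omega>. 0)" by (simp add: step_integral_def fun_eq_iff)
  then show ?case by (simp add: gaussian_0 distr_const)
next
  interpret prob_space M using BM by (auto simp: brownian_motion_def)
  case (Suc j)
  have \<tau>0: "0 \<le> \<tau> i" if "i \<le> n" for i
    using partition_mono[of n \<tau> 0 i] \<tau> that by (auto intro: less_imp_le order.trans)
  have W[measurable]: "W (\<tau> i) \<in> borel_measurable M" if "i \<le> n" for i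
    using BM \<tau>0[OF that] by (auto simp: brownian_motion_def)
  define D where "D i \<omega> = W (\<tau> (Suc i)) \<omega> - W (\<tau> i) \<omega>" for i \<omega>
  have D[measurable]: "D i \<in> borel_measurable M" if "i < n" for i
    using W[of i] W[of "Suc i"] that unfolding D_def by auto
  have ind: "indep_vars (\<lambda>_. borel) D {..<n}"
    using BM \<tau> by (auto simp: brownian_motion_def D_def[abs_def])
  have "indep_var (PiM {..<j} (\<lambda>_. borel)) (\<lambda>\<omega>. restrict (\<lambda>i. D i \<omega>) {..<j})
      (PiM {j} (\<lambda>_. borel)) (\<lambda>\<omega>. restrict (\<lambda>i. D i \<omega>) {j})"
    using Suc by (intro indep_var_restrict[OF ind]) auto
  then have "indep_var borel ((\<lambda>f. \<Sum>i<j. c i *\<^sub>R f i) \<circ> (\<lambda>\<omega>. restrict (\<lambda>i. D i \<omega>) {..<j}))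
      borel ((\<lambda>f. c j *\<^sub>R f j) \<circ> (\<lambda>\<omega>. restrict (\<lambda>i. D i \<omega>) {j}))"
    by (rule indep_var_compose) measurable
  moreover have "(\<lambda>f. \<Sum>i<j. c i *\<^sub>R f i) \<circ> (\<lambda>\<omega>. restrict (\<lambda>i. D i \<omega>) {..<j}) = step_integral W j \<tau> c"
    by (auto simp: step_integral_def D_def fun_eq_iff intro!: sum.cong)
  moreover have "(\<lambda>f. c j *\<^sub>R f j) \<circ> (\<lambda>\<omega>. restrict (\<lambda>i. D i \<omega>) {j}) = (\<lambda>\<omega>. c j *\<^sub>R D j \<omega>)"
    by (auto simp: fun_eq_iff)
  ultimately have iv: "indep_var borel (step_integral W j \<tau> c) borel (\<lambda>\<omega>. c j *\<^sub>R D j \<omega>)" by simp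
  have [measurable]: "step_integral W j \<tau> c \<in> borel_measurable M" "(\<lambda>\<omega>. c j *\<^sub>R D j \<omega>) \<in> borel_measurable M"
    using indep_var_rv1[OF iv] indep_var_rv2[OF iv] by auto
  have [measurable]: "D j \<in> borel_measurable M" using D[of j] Suc by simp
  define V where "V = (step_variance j \<tau> c)"
  have V0: "0 \<le> V"
    unfolding V_def using \<tau>(2) Suc by (intro sum_nonneg mult_nonneg_nonneg) (auto simp: less_imp_le)
  have lt: "\<tau> j < \<tau> (Suc j)" "0 \<le> \<tau> j" using \<tau>(2)[of j] \<tau>0[of j] Suc by auto
  have lawD: "distr M borel (\<lambda>\<omega>. c j *\<^sub>R D j \<omega>) = gaussian ((c j)\<^sup>2 * (\<tau> (Suc j) - \<tau> j))"
  proof -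
    have "distr M borel (\<lambda>\<omega>. c j *\<^sub>R D j \<omega>) = distr (distr M borel (D j)) borel (\<lambda>x. c j *\<^sub>R x)"
      by (subst distr_distr) (auto simp: o_def)
    also have "distr M borel (D j) = gaussian (\<tau> (Suc j) - \<tau> j)"
      unfolding D_def[abs_def] by (rule distr_brownian_increment[OF BM lt(2,1)])
    finally show ?thesis using lt by (simp add: gaussian_scaleR)
  qed
  have "distr M borel (step_integral W (Suc j) \<tau> c) =
      distr (distr M (borel \<Otimes>\<^sub>M borel) (\<lambda>\<omega>. (step_integral W j \<tau> c \<omega>, c j *\<^sub>R D j \<omega>))) borel (\<lambda>(x, y). x + y)"
  proof -
    have "step_integral W (Suc j) \<tau> c =
        (\<lambda>(x, y). x + y) \<circ> (\<lambda>\<omega>. (step_integral W j \<tau> c \<omega>, c j *\<^sub>R D j \<omega>))"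
      by (simp add: step_integral_Suc D_def fun_eq_iff)
    then show ?thesis by (simp only:) (rule distr_distr[symmetric], measurable)
  qed
  also have "distr M (borel \<Otimes>\<^sub>M borel) (\<lambda>\<omega>. (step_integral W j \<tau> c \<omega>, c j *\<^sub>R D j \<omega>)) =
      gaussian V \<Otimes>\<^sub>M gaussian ((c j)\<^sup>2 * (\<tau> (Suc j) - \<tau> j))"
    using iv Suc by (simp add: indep_var_distribution_eq lawD V_def)
  also have "distr \<dots> borel (\<lambda>(x, y). x + y) = gaussian (V + (c j)\<^sup>2 * (\<tau> (Suc j) - \<tau> j))"
    using V0 lt by (intro gaussian_add) auto
  finally show ?case by (simp add: V_def)
qed

text \<open>
  Independence of increments is only known along strictly increasing times, so intervals of length
  zero have to be removed from a partition.
\<close>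

lemma partition_strict:
  fixes W :: "real \<Rightarrow> 'w \<Rightarrow> 'a::euclidean_space"
  assumes "\<And>i. i < n \<Longrightarrow> \<tau> i \<le> \<tau> (Suc i)"
  shows "\<exists>m \<tau>' c'. \<tau>' 0 = \<tau> 0 \<and> \<tau>' m = \<tau> n \<and> (\<forall>i<m. \<tau>' i < \<tau>' (Suc i)) \<and>
    step_integral W m \<tau>' c' = step_integral W n \<tau> c \<and>
    (step_variance m \<tau>' c') = (step_variance n \<tau> c)"
  using assms
proof (induction n)
  case 0
  then show ?case by (intro exI[of _ 0] exI[of _ \<tau>]) (auto simp: step_integral_def fun_eq_iff)
next
  case (Suc n)
  have "\<tau> i \<le> \<tau> (Suc i)" if "i < n" for i using Suc.prems that by simp
  from Suc.IH[OF this] obtain m \<tau>' c' where IH: "\<tau>' 0 = \<tau> 0" "\<tau>' m = \<tau> n" "\<forall>i<m. \<tau>' i < \<tau>' (Suc i)"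
    "step_integral W m \<tau>' c' = step_integral W n \<tau> c"
    "(step_variance m \<tau>' c') = (step_variance n \<tau> c)"
    by blast
  show ?case
  proof (cases "\<tau> n = \<tau> (Suc n)")
    case True
    then show ?thesis using IH
      by (intro exI[of _ m] exI[of _ \<tau>'] exI[of _ c']) (auto simp: step_integral_Suc)
  next
    case False
    then have lt: "\<tau> n < \<tau> (Suc n)" using Suc.prems[of n] by simp
    let ?\<tau> = "\<tau>'(Suc m := \<tau> (Suc n))" and ?c = "c'(m := c n)"
    have 1: "step_integral W m ?\<tau> ?c = step_integral W m \<tau>' c'"
      by (auto simp: step_integral_def fun_eq_iff intro!: sum.cong)
    have 2: "(step_variance m ?\<tau> ?c) = (step_variance m \<tau>' c')"
      by (intro sum.cong) auto
    have 3: "step_integral W (Suc m) ?\<tau> ?c = step_integral W (Suc n) \<tau> c"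
      unfolding step_integral_Suc 1 IH(4) using IH(2) by simp
    have 4: "(step_variance (Suc m) ?\<tau> ?c) = (step_variance (Suc n) \<tau> c)"
      unfolding sum.lessThan_Suc 2 IH(5) using IH(2) by simp
    have 5: "?\<tau> 0 = \<tau> 0" "?\<tau> (Suc m) = \<tau> (Suc n)" "\<forall>i<Suc m. ?\<tau> i < ?\<tau> (Suc i)"
      using IH(1-3) lt by (auto simp: less_Suc_eq)
    show ?thesis using 3 4 5 by blast
  qed
qed

lemma distr_step_integral:
  fixes W :: "real \<Rightarrow> 'w \<Rightarrow> 'a::euclidean_space"
  assumes "brownian_motion M W" and "0 \<le> \<tau> 0" "\<And>i. i < n \<Longrightarrow> \<tau> i \<le> \<tau> (Suc i)"
  shows "distr M borel (step_integral W n \<tau> c) = gaussian (step_variance n \<tau> c)"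
proof -
  obtain m \<tau>' c' where *: "\<tau>' 0 = \<tau> 0" "\<forall>i<m. \<tau>' i < \<tau>' (Suc i)"
    "step_integral W m \<tau>' c' = step_integral W n \<tau> c"
    "(step_variance m \<tau>' c') = (step_variance n \<tau> c)"
    using partition_strict[of n \<tau> W c, OF assms(3)] by metis
  have "distr M borel (step_integral W m \<tau>' c') = gaussian (step_variance m \<tau>' c')"
    by (rule distr_step_integral_strict[OF assms(1), of _ m]) (use *(1,2) assms(2) in auto)
  then show ?thesis by (simp only: *(3,4))
qed

lemma step_fun_eq_0:
  assumes "\<And>i. i < n \<Longrightarrow> \<tau> i \<le> \<tau> (Suc i)" and "\<tau> n < s"
  shows "step_fun n \<tau> c s = 0"
  unfolding step_fun_def
proof (rule sum.neutral, rule ballI)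
  fix i assume "i \<in> {..<n}"
  then have "\<tau> (Suc i) \<le> \<tau> n" by (intro partition_mono[of n \<tau> "Suc i" n] assms(1)) auto
  with assms(2) have "s \<notin> {\<tau> i<..\<tau> (Suc i)}" by auto
  then show "c i * indicator {\<tau> i<..\<tau> (Suc i)} s = 0" by simp
qed

text \<open>
  The intervals of a partition are disjoint, so no mixed products occur.
\<close>

lemma step_fun_square:
  assumes "\<And>i. i < n \<Longrightarrow> \<tau> i \<le> \<tau> (Suc i)"
  shows "(step_fun n \<tau> c s)\<^sup>2 = (\<Sum>i<n. (c i)\<^sup>2 * indicator {\<tau> i<..\<tau> (Suc i)} s)"
  using assms
proof (induction n)
  case (Suc n)
  have S: "step_fun (Suc n) \<tau> c s = step_fun n \<tau> c s + c n * indicator {\<tau> n<..\<tau> (Suc n)} s"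
    by (simp add: step_fun_def)
  have "step_fun n \<tau> c s = 0" if "\<tau> n < s" using step_fun_eq_0[of n \<tau> s c, OF _ that] Suc.prems by simp
  then have "(step_fun (Suc n) \<tau> c s)\<^sup>2 = (step_fun n \<tau> c s)\<^sup>2 + (c n)\<^sup>2 * indicator {\<tau> n<..\<tau> (Suc n)} s"
    unfolding S by (auto simp: indicator_def)
  then show ?case using Suc by simp
qed (simp add: step_fun_def)

lemma nn_integral_step_fun_square:
  assumes \<tau>: "\<And>i. i < n \<Longrightarrow> \<tau> i \<le> \<tau> (Suc i)" "\<tau> 0 = 0" "\<tau> n = t"
  shows "(\<integral>\<^sup>+s\<in>{0..t}. ennreal ((step_fun n \<tau> c s)\<^sup>2) \<partial>lborel) = ennreal (step_variance n \<tau> c)"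
proof -
  have sub: "{\<tau> i<..\<tau> (Suc i)} \<subseteq> {0..t}" if "i < n" for i
  proof -
    have "\<tau> 0 \<le> \<tau> i" "\<tau> (Suc i) \<le> \<tau> n"
      using that by (auto intro!: partition_mono[of n \<tau>] \<tau>(1))
    then show ?thesis using \<tau>(2,3) by auto
  qed
  have "ennreal ((step_fun n \<tau> c s)\<^sup>2) * indicator {0..t} s =
      (\<Sum>i<n. ennreal ((c i)\<^sup>2) * indicator {\<tau> i<..\<tau> (Suc i)} s)" for s
  proof -
    have "ennreal ((step_fun n \<tau> c s)\<^sup>2) * indicator {0..t} s =
        (\<Sum>i<n. ennreal ((c i)\<^sup>2 * indicator {\<tau> i<..\<tau> (Suc i)} s)) * indicator {0..t} s"
      using step_fun_square[of n \<tau> c s, OF \<tau>(1)] by (simp add: sum_ennreal)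
    also have "\<dots> = (\<Sum>i<n. ennreal ((c i)\<^sup>2) * indicator {\<tau> i<..\<tau> (Suc i)} s)"
      unfolding sum_distrib_right
    proof (rule sum.cong[OF refl])
      fix i assume "i \<in> {..<n}"
      then show "ennreal ((c i)\<^sup>2 * indicator {\<tau> i<..\<tau> (Suc i)} s) * indicator {0..t} s =
          ennreal ((c i)\<^sup>2) * indicator {\<tau> i<..\<tau> (Suc i)} s"
        using sub[of i] by (cases "s \<in> {\<tau> i<..\<tau> (Suc i)}") (auto simp: indicator_def)
    qed
    finally show ?thesis .
  qed
  then have "(\<integral>\<^sup>+s\<in>{0..t}. ennreal ((step_fun n \<tau> c s)\<^sup>2) \<partial>lborel) =
      (\<integral>\<^sup>+s. (\<Sum>i<n. ennreal ((c i)\<^sup>2) * indicator {\<tau> i<..\<tau> (Suc i)} s) \<partial>lborel)"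
    by (simp only:)
  also have "\<dots> = (\<Sum>i<n. \<integral>\<^sup>+s. ennreal ((c i)\<^sup>2) * indicator {\<tau> i<..\<tau> (Suc i)} s \<partial>lborel)"
    by (rule nn_integral_sum) measurable
  also have "\<dots> = (\<Sum>i<n. ennreal ((c i)\<^sup>2 * (\<tau> (Suc i) - \<tau> i)))"
  proof (rule sum.cong[OF refl])
    fix i assume "i \<in> {..<n}"
    then have "\<tau> i \<le> \<tau> (Suc i)" using \<tau>(1) by simp
    then show "(\<integral>\<^sup>+s. ennreal ((c i)\<^sup>2) * indicator {\<tau> i<..\<tau> (Suc i)} s \<partial>lborel) =
        ennreal ((c i)\<^sup>2 * (\<tau> (Suc i) - \<tau> i))"
      by (subst nn_integral_cmult_indicator) (auto simp: ennreal_mult)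
  qed
  also have "\<dots> = ennreal (step_variance n \<tau> c)"
    by (rule sum_ennreal) (use \<tau>(1) in auto)
  finally show ?thesis .
qed

lemma borel_measurable_step_fun [measurable]: "step_fun n \<tau> c \<in> borel_measurable borel"
  unfolding step_fun_def[abs_def] by measurable

lemma ennreal_null_sequence:
  assumes "E \<longlonglongrightarrow> (0 :: ennreal)"
  shows "\<forall>\<^sub>F k in sequentially. E k = ennreal (enn2real (E k))"
    and "(\<lambda>k. sqrt (enn2real (E k))) \<longlonglongrightarrow> 0"
proof -
  have "\<forall>\<^sub>F k in sequentially. E k < 1" by (rule order_tendstoD(2)[OF assms]) simp
  then show ev: "\<forall>\<^sub>F k in sequentially. E k = ennreal (enn2real (E k))"
  proof eventually_elim
    case (elim k)
    then have "E k < top" using less_trans ennreal_one_less_top by blast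
    then show ?case by simp
  qed
  have "(\<lambda>k. ennreal (enn2real (E k))) \<longlonglongrightarrow> 0"
    by (rule Lim_transform_eventually[OF assms ev])
  then have "(\<lambda>k. enn2real (E k)) \<longlonglongrightarrow> 0"
    by (subst (asm) ennreal_tendsto_0_iff) auto
  then show "(\<lambda>k. sqrt (enn2real (E k))) \<longlonglongrightarrow> 0"
    using tendsto_real_sqrt[of _ 0] by simp
qed

text \<open>
  The square root of the variance of a step integral is the \<open>L\<^sup>2\<close> norm of its integrand, and norms are
  continuous by the triangle inequality.
\<close>

lemma step_fun_variance_tendsto:
  assumes [measurable]: "(\<lambda>s. indicator {0..t} s * f s) \<in> borel_measurable borel"
    and v: "(\<integral>\<^sup>+s\<in>{0..t}. ennreal ((f s)\<^sup>2) \<partial>lborel) = ennreal v" "0 \<le> v"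
    and \<tau>: "\<And>k::nat. \<tau> k 0 = 0" "\<And>k. \<tau> k (n k) = t" "\<And>k i. i < n k \<Longrightarrow> \<tau> k i \<le> \<tau> k (Suc i)"
    and lim: "(\<lambda>k. \<integral>\<^sup>+s\<in>{0..t}. ennreal ((step_fun (n k) (\<tau> k) (c k) s - f s)\<^sup>2) \<partial>lborel) \<longlonglongrightarrow> 0"
  shows "(\<lambda>k. sqrt (step_variance (n k) (\<tau> k) (c k))) \<longlonglongrightarrow> sqrt v"
proof -
  define V where "V k = (step_variance (n k) (\<tau> k) (c k))" for k
  define E where "E k = (\<integral>\<^sup>+s\<in>{0..t}. ennreal ((step_fun (n k) (\<tau> k) (c k) s - f s)\<^sup>2) \<partial>lborel)" for k
  define F where "F s = indicator {0..t} s * f s" for s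
  define G where "G k s = indicator {0..t} s * step_fun (n k) (\<tau> k) (c k) s" for k s
  have [measurable]: "F \<in> borel_measurable borel" "G k \<in> borel_measurable borel" for k
    unfolding F_def G_def by measurable
  have V0: "0 \<le> V k" for k unfolding V_def using \<tau>(3) by (intro sum_nonneg mult_nonneg_nonneg) auto
  have ind: "ennreal ((norm (indicator {0..t} s * r))\<^sup>2) = ennreal (r\<^sup>2) * indicator {0..t} s" for s r :: real
    by (simp add: indicator_def)
  have nG: "Lp_norm lborel 2 (G k) = ennreal (sqrt (V k))" for k
  proof (rule Lp_norm_2)
    show "(\<integral>\<^sup>+s. ennreal ((norm (G k s))\<^sup>2) \<partial>lborel) = ennreal (V k)"
      unfolding G_def ind V_def by (rule nn_integral_step_fun_square) (use \<tau> in auto)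
  qed (rule V0)
  have nF: "Lp_norm lborel 2 F = ennreal (sqrt v)"
    by (rule Lp_norm_2) (simp_all only: F_def ind v)
  have nD: "Lp_norm lborel 2 (\<lambda>s. G k s - F s) = ennreal (sqrt (enn2real (E k)))"
    if "E k = ennreal (enn2real (E k))" for k
  proof (rule Lp_norm_2)
    have "G k s - F s = indicator {0..t} s * (step_fun (n k) (\<tau> k) (c k) s - f s)" for s
      by (simp add: G_def F_def algebra_simps)
    then show "(\<integral>\<^sup>+s. ennreal ((norm (G k s - F s))\<^sup>2) \<partial>lborel) = ennreal (enn2real (E k))"
      using that by (simp only: ind E_def)
  qed simp
  have bound: "norm (sqrt (V k) - sqrt v) \<le> sqrt (enn2real (E k))" if Ek: "E k = ennreal (enn2real (E k))" for k
  proof -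
    have "Lp_norm lborel 2 (\<lambda>s. F s + (G k s - F s)) \<le> Lp_norm lborel 2 F + Lp_norm lborel 2 (\<lambda>s. G k s - F s)"
      by (rule Lp_norm_triangle) auto
    then have "ennreal (sqrt (V k)) \<le> ennreal (sqrt v + sqrt (enn2real (E k)))"
      by (simp add: nG nF nD[OF Ek] v)
    then have 1: "sqrt (V k) \<le> sqrt v + sqrt (enn2real (E k))"
      using v by (subst (asm) ennreal_le_iff) auto
    have "Lp_norm lborel 2 (\<lambda>s. G k s + (F s - G k s)) \<le> Lp_norm lborel 2 (G k) + Lp_norm lborel 2 (\<lambda>s. F s - G k s)"
      by (rule Lp_norm_triangle) auto
    moreover have "Lp_norm lborel 2 (\<lambda>s. F s - G k s) = Lp_norm lborel 2 (\<lambda>s. G k s - F s)"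
      by (simp only: Lp_norm_def norm_minus_commute[of "F _" "G k _"])
    ultimately have "ennreal (sqrt v) \<le> ennreal (sqrt (V k) + sqrt (enn2real (E k)))"
      by (simp add: nG nF nD[OF Ek] V0)
    then have "sqrt v \<le> sqrt (V k) + sqrt (enn2real (E k))"
      using V0 by (subst (asm) ennreal_le_iff) auto
    with 1 show ?thesis by simp
  qed
  have "(\<lambda>k. sqrt (V k) - sqrt v) \<longlonglongrightarrow> 0"
    by (rule Lim_null_comparison[OF _ ennreal_null_sequence(2)[OF lim[folded E_def]]])
       (rule eventually_mono[OF ennreal_null_sequence(1)[OF lim[folded E_def]] bound])
  then show ?thesis unfolding V_def by (rule LIM_zero_cancel)
qed

text \<open>
  This is nonnegativity of the variance of \<open>norm U\<close>.
\<close>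

lemma (in prob_space) expectation_norm_le_sqrt:
  assumes [measurable]: "U \<in> borel_measurable M"
    and e: "(\<integral>\<^sup>+\<omega>. ennreal ((norm (U \<omega>))\<^sup>2) \<partial>M) = ennreal e" "0 \<le> e"
  shows "integrable M (\<lambda>\<omega>. norm (U \<omega>))" and "expectation (\<lambda>\<omega>. norm (U \<omega>)) \<le> sqrt e"
proof -
  have sq: "integrable M (\<lambda>\<omega>. (norm (U \<omega>))\<^sup>2)"
    by (rule integrableI_nonneg) (auto simp: e)
  then show int: "integrable M (\<lambda>\<omega>. norm (U \<omega>))"
    by (rule square_integrable_imp_integrable[rotated]) simp
  have "expectation (\<lambda>\<omega>. (norm (U \<omega>))\<^sup>2) = e"
    using e by (subst integral_eq_nn_integral) auto
  then have "(expectation (\<lambda>\<omega>. norm (U \<omega>)))\<^sup>2 \<le> e"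
    using variance_eq[OF int sq] variance_positive[of "\<lambda>\<omega>. norm (U \<omega>)"] by simp
  then show "expectation (\<lambda>\<omega>. norm (U \<omega>)) \<le> sqrt e" by (rule real_le_rsqrt)
qed

text \<open>
  A Wiener integral is an \<open>L\<^sup>2\<close> limit of Gaussian step integrals that are functions of the path of
  \<open>W\<close> alone, hence independent of \<open>Y\<close>; both the law of \<open>Y + c J\<close> and the claimed law are the
  limits of the laws of \<open>Y\<close> plus \<open>c\<close> times these step integrals.
\<close>

lemma distr_add_wiener_integral:
  fixes W :: "real \<Rightarrow> 'w \<Rightarrow> 'a::euclidean_space" and Y J :: "'w \<Rightarrow> 'a"
  assumes BM: "brownian_motion M W" and J: "wiener_integral M W f t J"
    and f: "(\<lambda>s. indicator {0..t} s * f s) \<in> borel_measurable borel"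
    and v: "(\<integral>\<^sup>+s\<in>{0..t}. ennreal ((f s)\<^sup>2) \<partial>lborel) = ennreal v" "0 \<le> v"
    and [measurable]: "Y \<in> borel_measurable M"
    and path[measurable]: "sample_path {0..} W \<in> measurable M (path_space {0..})"
    and ind: "distr M (borel \<Otimes>\<^sub>M path_space {0..}) (\<lambda>\<omega>. (Y \<omega>, sample_path {0..} W \<omega>)) =
      distr M borel Y \<Otimes>\<^sub>M distr M (path_space {0..}) (sample_path {0..} W)"
  shows "distr M borel (\<lambda>\<omega>. Y \<omega> + c *\<^sub>R J \<omega>) =
    distr (distr M borel Y \<Otimes>\<^sub>M std_gaussian) borel (\<lambda>(y, z). y + (c * sqrt v) *\<^sub>R z)"
proof -
  interpret prob_space M using BM by (simp add: brownian_motion_def)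
  interpret PY: prob_space "distr M borel Y" by (rule prob_space_distr) simp
  interpret G: prob_space "std_gaussian :: 'a measure" by (rule prob_space_std_gaussian)
  let ?YG = "distr M borel Y \<Otimes>\<^sub>M (std_gaussian :: 'a measure)"
  interpret P: prob_space ?YG
    by (rule prob_space_pair) (rule PY.prob_space_axioms G.prob_space_axioms)+
  have [measurable]: "J \<in> borel_measurable M" using J by (simp add: wiener_integral_def)
  obtain n \<tau> cc where part: "\<And>k::nat. \<tau> k 0 = 0" "\<And>k. \<tau> k (n k) = t" "\<And>k i. i < n k \<Longrightarrow> \<tau> k i \<le> \<tau> k (Suc i)"
    and flim: "(\<lambda>k. \<integral>\<^sup>+s\<in>{0..t}. ennreal ((step_fun (n k) (\<tau> k) (cc k) s - f s)\<^sup>2) \<partial>lborel) \<longlonglongrightarrow> 0"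
    and Jlim: "(\<lambda>k. \<integral>\<^sup>+\<omega>. ennreal ((norm (step_integral W (n k) (\<tau> k) (cc k) \<omega> - J \<omega>))\<^sup>2) \<partial>M) \<longlonglongrightarrow> 0"
    using J unfolding wiener_integral_def by blast
  define V where "V k = (step_variance (n k) (\<tau> k) (cc k))" for k
  have Vlim: "(\<lambda>k. sqrt (V k)) \<longlonglongrightarrow> sqrt v"
    unfolding V_def by (rule step_fun_variance_tendsto[OF f v part flim])
  define S where "S k = step_integral W (n k) (\<tau> k) (cc k)" for k
  define H where "H k p = (\<Sum>i<n k. cc k i *\<^sub>R (p (\<tau> k (Suc i)) - p (\<tau> k i)))" for k and p :: "real \<Rightarrow> 'a"
  have \<tau>0: "\<tau> k i \<in> {0..}" if "i \<le> n k" for k i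
    using partition_mono[of "n k" "\<tau> k" 0 i, OF part(3)] part(1) that by simp
  have H[measurable]: "H k \<in> borel_measurable (path_space {0..})" for k
    unfolding H_def
    by (intro borel_measurable_sum borel_measurable_scaleR borel_measurable_const borel_measurable_diff
        measurable_component_singleton \<tau>0) auto
  have SH: "S k \<omega> = H k (sample_path {0..} W \<omega>)" for k \<omega>
    unfolding S_def H_def step_integral_def sample_path_def
    using \<tau>0[of _ k] by (intro sum.cong) auto
  have S_fun: "S k = (\<lambda>\<omega>. H k (sample_path {0..} W \<omega>))" for k using SH by auto
  have [measurable]: "S k \<in> borel_measurable M" for k unfolding S_fun by measurable
  have lawS: "distr M (borel \<Otimes>\<^sub>M borel) (\<lambda>\<omega>. (Y \<omega>, S k \<omega>)) = distr M borel Y \<Otimes>\<^sub>M gaussian (V k)" for k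
  proof -
    have "distr M (borel \<Otimes>\<^sub>M borel) (\<lambda>\<omega>. (Y \<omega>, S k \<omega>)) = distr M borel Y \<Otimes>\<^sub>M distr M borel (S k)"
      unfolding SH S_fun
      by (rule joint_law_compose[OF prob_space_axioms _ path ind, of "\<lambda>y. y" borel "H k" borel]) measurable
    also have "distr M borel (S k) = gaussian (V k)"
      unfolding S_def V_def by (rule distr_step_integral[OF BM]) (use part in auto)
    finally show ?thesis .
  qed
  show ?thesis
  proof (rule measure_eqI_lipschitz)
    fix h :: "'a \<Rightarrow> real" and L :: real
    assume L: "0 \<le> L" and h1: "\<And>x. \<bar>h x\<bar> \<le> 1" and hL: "\<And>x y. \<bar>h x - h y\<bar> \<le> L * dist x y"
    have conth: "continuous_on UNIV h"
      by (rule lipschitz_on_continuous_on[of L]) (use L hL in \<open>auto intro!: lipschitz_onI simp: dist_real_def\<close>)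
    have [measurable]: "h \<in> borel_measurable borel"
      by (rule borel_measurable_continuous_onI[OF conth])
    have inth: "integrable M (\<lambda>\<omega>. h (Z \<omega>))" if [measurable]: "Z \<in> borel_measurable M" for Z
      by (rule integrable_const_bound[where B = 1]) (auto simp: h1)
    let ?S = "\<lambda>k. expectation (\<lambda>\<omega>. h (Y \<omega> + c *\<^sub>R S k \<omega>))"
    let ?J = "expectation (\<lambda>\<omega>. h (Y \<omega> + c *\<^sub>R J \<omega>))"
    have step: "?S k =
        (\<integral>p. h (fst p + (c * sqrt (V k)) *\<^sub>R snd p) \<partial>?YG)" for k
    proof -
      interpret Gk: prob_space "gaussian (V k) :: 'a measure" by (rule prob_space_gaussian)
      have "?S k =
          (\<integral>p. h (fst p + c *\<^sub>R snd p) \<partial>distr M (borel \<Otimes>\<^sub>M borel) (\<lambda>\<omega>. (Y \<omega>, S k \<omega>)))"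
        by (subst integral_distr) auto
      also have "distr M (borel \<Otimes>\<^sub>M borel) (\<lambda>\<omega>. (Y \<omega>, S k \<omega>)) =
          distr (distr M borel Y) borel (\<lambda>y. y) \<Otimes>\<^sub>M distr std_gaussian borel (\<lambda>z. sqrt (V k) *\<^sub>R z)"
        by (simp add: lawS gaussian_def distr_distr o_def)
      also have "\<dots> = distr ?YG (borel \<Otimes>\<^sub>M borel) (\<lambda>(y, z). (y, sqrt (V k) *\<^sub>R z))"
        by (rule pair_measure_distr)
           (auto intro: Gk.sigma_finite_measure_axioms simp: gaussian_def[symmetric])
      also have "(\<integral>p. h (fst p + c *\<^sub>R snd p) \<partial>\<dots>) =
          (\<integral>p. h (fst p + (c * sqrt (V k)) *\<^sub>R snd p) \<partial>?YG)"
        by (subst integral_distr) (auto simp: split_beta)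
      finally show ?thesis .
    qed
    define E where "E k = (\<integral>\<^sup>+\<omega>. ennreal ((norm (S k \<omega> - J \<omega>))\<^sup>2) \<partial>M)" for k
    have Elim: "E \<longlonglongrightarrow> 0" using Jlim unfolding E_def S_def .
    have bound: "norm (?S k - ?J)
        \<le> L * \<bar>c\<bar> * sqrt (enn2real (E k))" if "E k = ennreal (enn2real (E k))" for k
    proof -
      have U: "integrable M (\<lambda>\<omega>. norm (S k \<omega> - J \<omega>))" "expectation (\<lambda>\<omega>. norm (S k \<omega> - J \<omega>)) \<le> sqrt (enn2real (E k))"
        using expectation_norm_le_sqrt[of "\<lambda>\<omega>. S k \<omega> - J \<omega>" "enn2real (E k)"] that
        by (auto simp: E_def[symmetric])
      have "?S k - ?J =
          expectation (\<lambda>\<omega>. h (Y \<omega> + c *\<^sub>R S k \<omega>) - h (Y \<omega> + c *\<^sub>R J \<omega>))"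
        by (rule Bochner_Integration.integral_diff[symmetric]) (auto intro!: inth)
      also have "norm \<dots> \<le> expectation (\<lambda>\<omega>. L * \<bar>c\<bar> * norm (S k \<omega> - J \<omega>))"
      proof (rule order.trans[OF integral_norm_bound integral_mono])
        fix \<omega> assume "\<omega> \<in> space M"
        have "\<bar>h (Y \<omega> + c *\<^sub>R S k \<omega>) - h (Y \<omega> + c *\<^sub>R J \<omega>)\<bar> \<le> L * dist (Y \<omega> + c *\<^sub>R S k \<omega>) (Y \<omega> + c *\<^sub>R J \<omega>)"
          by (rule hL)
        also have "dist (Y \<omega> + c *\<^sub>R S k \<omega>) (Y \<omega> + c *\<^sub>R J \<omega>) = \<bar>c\<bar> * norm (S k \<omega> - J \<omega>)"
          by (simp add: dist_norm scaleR_diff_right[symmetric])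
        finally show "norm (h (Y \<omega> + c *\<^sub>R S k \<omega>) - h (Y \<omega> + c *\<^sub>R J \<omega>)) \<le> L * \<bar>c\<bar> * norm (S k \<omega> - J \<omega>)"
          by (simp add: mult.assoc)
      qed (auto intro!: inth U integrable_abs)
      also have "\<dots> = L * \<bar>c\<bar> * expectation (\<lambda>\<omega>. norm (S k \<omega> - J \<omega>))" by simp
      also have "\<dots> \<le> L * \<bar>c\<bar> * sqrt (enn2real (E k))"
        by (intro mult_left_mono U) (use L in auto)
      finally show ?thesis .
    qed
    have "(\<lambda>k. ?S k - ?J) \<longlonglongrightarrow> 0"
    proof (rule Lim_null_comparison)
      show "\<forall>\<^sub>F k in sequentially. norm (?S k - ?J)
          \<le> L * \<bar>c\<bar> * sqrt (enn2real (E k))"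
        by (rule eventually_mono[OF ennreal_null_sequence(1)[OF Elim] bound])
      show "(\<lambda>k. L * \<bar>c\<bar> * sqrt (enn2real (E k))) \<longlonglongrightarrow> 0"
        by (rule tendsto_mult_right_zero[OF ennreal_null_sequence(2)[OF Elim]])
    qed
    then have lim1: "(\<lambda>k. ?S k) \<longlonglongrightarrow> ?J"
      by (rule LIM_zero_cancel)
    have lim2: "(\<lambda>k. \<integral>p. h (fst p + (c * sqrt (V k)) *\<^sub>R snd p) \<partial>?YG) \<longlonglongrightarrow>
        (\<integral>p. h (fst p + (c * sqrt v) *\<^sub>R snd p) \<partial>?YG)"
    proof (rule integral_dominated_convergence[where w = "\<lambda>_. 1"])
      show "AE p in ?YG.
          (\<lambda>k. h (fst p + (c * sqrt (V k)) *\<^sub>R snd p)) \<longlonglongrightarrow> h (fst p + (c * sqrt v) *\<^sub>R snd p)"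
        by (intro AE_I2 continuous_on_tendsto_compose[OF conth] tendsto_intros Vlim) auto
    qed (auto simp: h1)
    have "(\<integral>x. h x \<partial>distr M borel (\<lambda>\<omega>. Y \<omega> + c *\<^sub>R J \<omega>)) = ?J"
      by (subst integral_distr) auto
    also have "\<dots> = (\<integral>p. h (fst p + (c * sqrt v) *\<^sub>R snd p) \<partial>?YG)"
      using LIMSEQ_unique[OF lim1[unfolded step] lim2] .
    also have "\<dots> = (\<integral>x. h x \<partial>distr ?YG borel (\<lambda>(y, z). y + (c * sqrt v) *\<^sub>R z))"
      by (subst integral_distr) (auto simp: split_beta)
    finally show "(\<integral>x. h x \<partial>distr M borel (\<lambda>\<omega>. Y \<omega> + c *\<^sub>R J \<omega>)) =
        (\<integral>x. h x \<partial>distr ?YG borel (\<lambda>(y, z). y + (c * sqrt v) *\<^sub>R z))" .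
  qed (auto intro!: prob_space_distr P.prob_space_distr)
qed

section \<open>Measurability in time and derivatives of the coefficients\<close>

abbreviation unit_time :: "real measure" where
  "unit_time \<equiv> restrict_space lborel {0<..<1}"

lemma space_unit_time [simp]: "space unit_time = {0<..<1}"
  by (simp add: space_restrict_space)

lemma prob_space_unit_time: "prob_space unit_time"
  by (rule prob_spaceI) (simp add: emeasure_restrict_space space_restrict_space)

lemma borel_measurable_unit_time:
  "continuous_on {0<..<1} f \<Longrightarrow> f \<in> borel_measurable unit_time"
  using borel_measurable_continuous_on_restrict[of "{0<..<1}" f]
  by (simp add: measurable_def space_restrict_space sets_restrict_space)

text \<open>
  Freezing the time at grid points that stay inside \<open>(0,1)\<close> gives jointly measurable approximations.
\<close>

lemma measurable_Caratheodory:
  fixes f :: "real \<Rightarrow> 'w \<Rightarrow> 'b::{second_countable_topology, real_normed_vector}"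
  assumes meas: "\<And>t. t \<in> {0<..<1} \<Longrightarrow> f t \<in> borel_measurable M"
    and cont: "\<And>\<omega>. \<omega> \<in> space M \<Longrightarrow> continuous_on {0<..<1} (\<lambda>t. f t \<omega>)"
  shows "(\<lambda>p. f (fst p) (snd p)) \<in> borel_measurable (unit_time \<Otimes>\<^sub>M M)"
proof -
  \<comment> \<open>Adding one in numerator and denominator keeps \<open>r n \<lfloor>n t\<rfloor>\<close> strictly between 0 and 1.\<close>
  define r :: "nat \<Rightarrow> int \<Rightarrow> real" where "r n k = (of_int k + 1) / (real n + 1)" for n k
  define F where "F n k p = (if r n k \<in> {0<..<1} then f (r n k) (snd p) else 0)" for n k and p :: "real \<times> 'w"
  have F[measurable]: "F n k \<in> borel_measurable (unit_time \<Otimes>\<^sub>M M)" for n k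
  proof (cases "r n k \<in> {0<..<1}")
    case True
    have "(\<lambda>p. f (r n k) (snd p)) \<in> borel_measurable (unit_time \<Otimes>\<^sub>M M)"
      by (rule measurable_compose[OF measurable_snd meas[OF True]])
    moreover have "F n k = (\<lambda>p. f (r n k) (snd p))"
      using True unfolding F_def by (simp only: if_True)
    ultimately show ?thesis by simp
  next
    case False
    then have "F n k = (\<lambda>p. 0)" unfolding F_def by (simp only: if_False)
    then show ?thesis by simp
  qed
  have "(\<lambda>p. F n \<lfloor>real n * fst p\<rfloor> p) \<in> borel_measurable (unit_time \<Otimes>\<^sub>M M)" for n
  proof (rule measurable_compose_countable[OF F])
    have "(\<lambda>t. \<lfloor>real n * t\<rfloor>) \<in> measurable unit_time (count_space UNIV)"
      by (intro measurable_restrict_space1) measurable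
    then show "(\<lambda>p. \<lfloor>real n * fst p\<rfloor>) \<in> measurable (unit_time \<Otimes>\<^sub>M M) (count_space UNIV)"
      by (rule measurable_compose[OF measurable_fst])
  qed
  then show ?thesis
  proof (rule borel_measurable_LIMSEQ_metric)
    fix p assume "p \<in> space (unit_time \<Otimes>\<^sub>M M)"
    then obtain t \<omega> where p: "p = (t, \<omega>)" and t: "0 < t" "t < 1" and \<omega>: "\<omega> \<in> space M"
      by (auto simp: space_pair_measure)
    define q where "q n = r n \<lfloor>real n * t\<rfloor>" for n
    have q_near: "norm (q n - t) \<le> 1 / (real n + 1)" and q_in: "0 < n \<Longrightarrow> q n \<in> {0<..<1}" for n
    proof -
      have fl: "of_int \<lfloor>real n * t\<rfloor> \<le> real n * t" "real n * t < of_int \<lfloor>real n * t\<rfloor> + 1"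
        by linarith+
      have "(real n + 1) * (q n - t) = of_int \<lfloor>real n * t\<rfloor> + 1 - real n * t - t"
      proof -
        have "real n + 1 \<noteq> 0" by linarith
        then have "(real n + 1) * q n = of_int \<lfloor>real n * t\<rfloor> + 1" by (simp add: q_def r_def)
        then show ?thesis unfolding right_diff_distrib by (simp add: algebra_simps)
      qed
      then have "\<bar>(real n + 1) * (q n - t)\<bar> \<le> 1" unfolding abs_le_iff using fl t by linarith
      then show "norm (q n - t) \<le> 1 / (real n + 1)" by (simp add: abs_mult pos_le_divide_eq mult.commute)
      assume n: "0 < n"
      have "0 \<le> \<lfloor>real n * t\<rfloor>" "\<lfloor>real n * t\<rfloor> < int n"
        using n t by (auto simp: floor_less_iff)
      then have "0 \<le> (of_int \<lfloor>real n * t\<rfloor> :: real)" "(of_int \<lfloor>real n * t\<rfloor> :: real) < real n"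
        by (simp, metis of_int_less_iff of_int_of_nat_eq)
      then have "0 < of_int \<lfloor>real n * t\<rfloor> + (1 :: real)" "of_int \<lfloor>real n * t\<rfloor> + 1 < real n + 1" "0 < real n + 1"
        by linarith+
      then have "0 < r n \<lfloor>real n * t\<rfloor>" "r n \<lfloor>real n * t\<rfloor> < 1"
        unfolding r_def by - (rule divide_pos_pos, assumption+, simp only: divide_less_eq_1_pos)
      then show "q n \<in> {0<..<1}" by (simp add: q_def)
    qed
    have "(\<lambda>n. 1 / (real n + 1)) \<longlonglongrightarrow> 0"
      using LIMSEQ_inverse_real_of_nat by (simp add: inverse_eq_divide add.commute)
    then have "(\<lambda>n. q n - t) \<longlonglongrightarrow> 0"
      by (rule Lim_null_comparison[rotated]) (rule always_eventually, rule allI, rule q_near)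
    then have qt: "q \<longlonglongrightarrow> t" by (rule LIM_zero_cancel)
    have "(\<lambda>n. f (q n) \<omega>) \<longlonglongrightarrow> f t \<omega>"
      by (rule continuous_on_tendsto_compose[OF cont[OF \<omega>] qt])
         (use t q_in in \<open>auto simp: eventually_sequentially intro!: exI[of _ "Suc 0"]\<close>)
    moreover have "\<forall>\<^sub>F n in sequentially. f (q n) \<omega> = F n \<lfloor>real n * fst p\<rfloor> p"
      using q_in by (auto simp: eventually_sequentially F_def p q_def intro!: exI[of _ "Suc 0"])
    ultimately show "(\<lambda>n. F n \<lfloor>real n * fst p\<rfloor> p) \<longlonglongrightarrow> f (fst p) (snd p)"
      unfolding p fst_conv snd_conv by (rule Lim_transform_eventually)
  qed
qed

lemma C1_on_interior:
  fixes f :: "real \<Rightarrow> 'b::real_normed_vector"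
  assumes "C1_on S f" and "{0<..<1} \<subseteq> S"
  shows "\<And>t. t \<in> {0<..<1} \<Longrightarrow> (f has_vector_derivative deriv_on S f t) (at t)"
    and "continuous_on {0<..<1} (deriv_on S f)"
    and "continuous_on {0<..<1} f"
proof -
  show *: "(f has_vector_derivative deriv_on S f t) (at t)" if t: "t \<in> {0<..<1}" for t
  proof -
    have "t \<in> S" using t assms(2) by auto
    then have "f differentiable (at t within S)" using assms(1) by (auto simp: C1_on_def)
    then have "(f has_vector_derivative deriv_on S f t) (at t within S)"
      unfolding deriv_on_def by (simp add: vector_derivative_works)
    then have "(f has_vector_derivative deriv_on S f t) (at t within {0<..<1})"
      by (rule has_vector_derivative_within_subset) (rule assms(2))
    then show ?thesis by (simp only: at_within_open[OF t open_greaterThanLessThan])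
  qed
  show "continuous_on {0<..<1} (deriv_on S f)"
    using assms by (auto simp: C1_on_def deriv_on_def[abs_def] intro: continuous_on_subset)
  show "continuous_on {0<..<1} f"
    using * by (meson continuous_at_imp_continuous_on has_vector_derivative_continuous)
qed

lemma vector_derivative_difference_quotient:
  fixes f :: "real \<Rightarrow> 'b::real_normed_vector"
  assumes f: "(f has_vector_derivative f') (at t)" and h: "h \<longlonglongrightarrow> 0" "\<And>n. h n \<noteq> 0"
  shows "(\<lambda>n. (f (t + h n) - f t) /\<^sub>R h n) \<longlonglongrightarrow> f'"
proof -
  have "((\<lambda>y. norm (f (t + y) - f t - y *\<^sub>R f') / norm y) \<longlongrightarrow> 0) (at 0)"
    using f by (simp add: has_vector_derivative_def has_derivative_at)
  moreover have "filterlim h (at 0) sequentially"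
    unfolding filterlim_at using h by auto
  ultimately have "(\<lambda>n. norm (f (t + h n) - f t - h n *\<^sub>R f') / norm (h n)) \<longlonglongrightarrow> 0"
    by (rule filterlim_compose)
  moreover have "norm (f (t + h n) - f t - h n *\<^sub>R f') / norm (h n) = norm ((f (t + h n) - f t) /\<^sub>R h n - f')" for n
  proof -
    have "(f (t + h n) - f t) /\<^sub>R h n - f' = (f (t + h n) - f t - h n *\<^sub>R f') /\<^sub>R h n"
      using h(2)[of n] by (simp add: scaleR_diff_right)
    then show ?thesis by (simp add: divide_inverse mult.commute)
  qed
  ultimately have "(\<lambda>n. norm ((f (t + h n) - f t) /\<^sub>R h n - f')) \<longlonglongrightarrow> 0" by simp
  then show ?thesis by (rule LIM_zero_cancel[OF tendsto_norm_zero_cancel])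
qed

lemma log_deriv_properties:
  assumes C1: "C1_on {0..<1} \<sigma>" and pos: "\<And>t. t \<in> {0..<1} \<Longrightarrow> \<sigma> t > 0"
  shows "\<And>t. t \<in> {0<..<1} \<Longrightarrow> (\<sigma> has_real_derivative log_deriv \<sigma> t * \<sigma> t) (at t)"
    and "continuous_on {0<..<1} (log_deriv \<sigma>)"
proof -
  have sub: "{0<..<1} \<subseteq> {0..<1::real}" by auto
  note \<sigma> = C1_on_interior[OF C1 sub]
  have ld: "log_deriv \<sigma> t = deriv_on {0..<1} \<sigma> t / \<sigma> t" if t: "t \<in> {0<..<1}" for t
  proof -
    have "\<sigma> t > 0" using pos t by auto
    have "(\<sigma> has_real_derivative deriv_on {0..<1} \<sigma> t) (at t within {0..<1})"
      using \<sigma>(1)[OF t] by (simp add: has_real_derivative_iff_has_vector_derivative has_vector_derivative_at_within)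
    then have "((\<lambda>s. ln (\<sigma> s)) has_real_derivative deriv_on {0..<1} \<sigma> t / \<sigma> t) (at t within {0..<1})"
      using \<open>\<sigma> t > 0\<close> by (auto intro!: derivative_eq_intros)
    moreover have "at t within {0..<1} \<noteq> bot"
      using at_within_interior[of t "{0..<1}"] t by (simp add: interior_atLeastLessThan)
    ultimately show ?thesis
      unfolding log_deriv_def deriv_on_def has_real_derivative_iff_has_vector_derivative
      by (simp add: vector_derivative_within)
  qed
  show "(\<sigma> has_real_derivative log_deriv \<sigma> t * \<sigma> t) (at t)" if t: "t \<in> {0<..<1}" for t
    using \<sigma>(1)[OF t] pos[of t] t by (simp add: ld has_real_derivative_iff_has_vector_derivative)
  have "continuous_on {0<..<1} (\<lambda>t. deriv_on {0..<1} \<sigma> t / \<sigma> t)"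
    using pos by (intro continuous_on_divide \<sigma>) (auto simp: less_imp_neq[symmetric])
  then show "continuous_on {0<..<1} (log_deriv \<sigma>)"
    by (rule continuous_on_eq) (simp add: ld)
qed

section \<open>Test functions\<close>

text \<open>
  The strict inequalities leave room at both ends: a function supported in \<open>K\<close> vanishes at the times
  \<open>\<delta>\<close> and \<open>T\<close>.
\<close>

lemma compact_time_box:
  fixes K :: "(real \<times> 'a::euclidean_space) set"
  assumes "compact K" "K \<subseteq> {0<..<1} \<times> UNIV"
  obtains \<delta> T R where "0 < \<delta>" "\<delta> < T" "T < 1" "0 \<le> R"
    "\<And>t x. (t, x) \<in> K \<Longrightarrow> \<delta> < t \<and> t < T \<and> norm x \<le> R"
proof (cases "K = {}")
  case True
  show ?thesis by (rule that[of "1/3" "1/2" 0]) (auto simp: True)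
next
  case False
  have c1: "compact (fst ` K)" "compact (snd ` K)"
    by (intro compact_continuous_image continuous_intros assms)+
  have ne: "fst ` K \<noteq> {}" using False by simp
  obtain l where l: "l \<in> fst ` K" "\<And>t. t \<in> fst ` K \<Longrightarrow> l \<le> t"
    using compact_attains_inf[OF c1(1) ne] by auto
  obtain u where u: "u \<in> fst ` K" "\<And>t. t \<in> fst ` K \<Longrightarrow> t \<le> u"
    using compact_attains_sup[OF c1(1) ne] by auto
  obtain R where R: "\<And>x. x \<in> snd ` K \<Longrightarrow> norm x \<le> R"
    using compact_imp_bounded[OF c1(2)] by (auto simp: bounded_iff)
  have lu: "0 < l" "u < 1" "l \<le> u" using l u assms(2) by auto
  show ?thesis
  proof (rule that[of "l / 2" "(u + 1) / 2" "max R 0"])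
    fix t x assume tx: "(t, x) \<in> K"
    then have "t \<in> fst ` K" "x \<in> snd ` K" by force+
    then show "l / 2 < t \<and> t < (u + 1) / 2 \<and> norm x \<le> max R 0"
      using l(2)[of t] u(2)[of t] R[of x] lu by auto
  qed (use lu in auto)
qed

lemma test_function_smooth:
  assumes "test_function \<psi>"
  shows "\<psi> differentiable (at z)" and "partial v \<psi> differentiable (at z)"
    and "continuous_on UNIV \<psi>" and "continuous_on UNIV (partial v \<psi>)"
    and "continuous_on UNIV (partial w (partial v \<psi>))"
proof -
  have C: "C_k k \<psi>" for k using assms by (simp add: test_function_def)
  have C2: "(\<forall>x. \<psi> differentiable (at x)) \<and>
      (\<forall>v. (\<forall>x. partial v \<psi> differentiable (at x)) \<and> (\<forall>w. continuous_on UNIV (partial w (partial v \<psi>))))"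
    using C[of "Suc (Suc 0)"] unfolding C_k.simps .
  show "\<psi> differentiable (at z)" "partial v \<psi> differentiable (at z)"
    "continuous_on UNIV (partial w (partial v \<psi>))" using C2 by blast+
  show "continuous_on UNIV \<psi>" using C[of 0] unfolding C_k.simps .
  show "continuous_on UNIV (partial v \<psi>)" using C[of "Suc 0"] unfolding C_k.simps by blast
qed

text \<open>Slicing a function of \<open>(t, x)\<close> turns derivatives in \<open>x\<close> into derivatives in directions \<open>(0, v)\<close>.\<close>

lemma partial_slice:
  fixes f :: "real \<times> 'a::euclidean_space \<Rightarrow> real"
  assumes "f differentiable (at (t, x))"
  shows "partial v (\<lambda>y. f (t, y)) x = partial (0, v) f (t, x)"
    and "(\<lambda>y. f (t, y)) differentiable (at x)"
proof -
  have 1: "(f has_derivative frechet_derivative f (at (t, x))) (at (t, x))"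
    using assms by (simp add: frechet_derivative_works)
  have 2: "((\<lambda>y. (t, y)) has_derivative (\<lambda>h. (0, h))) (at x)"
    by (auto intro!: derivative_eq_intros)
  have 3: "((\<lambda>y. f (t, y)) has_derivative (\<lambda>h. frechet_derivative f (at (t, x)) (0, h))) (at x)"
    using diff_chain_at[OF 2 1] by (simp add: o_def)
  show "partial v (\<lambda>y. f (t, y)) x = partial (0, v) f (t, x)"
    unfolding has_derivative_partial[OF 3] by (simp add: partial_def)
  show "(\<lambda>y. f (t, y)) differentiable (at x)" using 3 by (rule differentiableI)
qed

definition space_grad :: "(real \<times> 'a::euclidean_space \<Rightarrow> real) \<Rightarrow> real \<times> 'a \<Rightarrow> 'a" where
  "space_grad \<psi> z = (\<Sum>i\<in>Basis. partial (0, i) \<psi> z *\<^sub>R i)"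

definition space_laplacian :: "(real \<times> 'a::euclidean_space \<Rightarrow> real) \<Rightarrow> real \<times> 'a \<Rightarrow> real" where
  "space_laplacian \<psi> z = (\<Sum>i\<in>Basis. partial (0, i) (partial (0, i) \<psi>) z)"

lemma test_function_slice:
  assumes \<psi>: "test_function \<psi>"
  shows "vector_derivative (\<lambda>s. \<psi> (s, x)) (at t) = partial (1, 0) \<psi> (t, x)"
    and "grad (\<lambda>y. \<psi> (t, y)) x = space_grad \<psi> (t, x)"
    and "laplacian (\<lambda>y. \<psi> (t, y)) x = space_laplacian \<psi> (t, x)"
proof -
  have "((\<lambda>s. \<psi> (s, x)) has_real_derivative partial (1, 0) \<psi> (t, x)) (at t)"
    by (rule has_real_derivative_along_path[OF test_function_smooth(1)[OF \<psi>]])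
       (auto simp: has_vector_derivative_def intro!: derivative_eq_intros)
  then show "vector_derivative (\<lambda>s. \<psi> (s, x)) (at t) = partial (1, 0) \<psi> (t, x)"
    by (intro vector_derivative_at) (simp add: has_real_derivative_iff_has_vector_derivative)
  have p: "partial i (\<lambda>y. \<psi> (t, y)) = (\<lambda>x. partial (0, i) \<psi> (t, x))" for i
    using partial_slice(1)[OF test_function_smooth(1)[OF \<psi>]] by auto
  show "grad (\<lambda>y. \<psi> (t, y)) x = space_grad \<psi> (t, x)"
    by (simp add: grad_def space_grad_def p)
  show "laplacian (\<lambda>y. \<psi> (t, y)) x = space_laplacian \<psi> (t, x)"
    by (simp add: laplacian_def space_laplacian_def p partial_slice(1)[OF test_function_smooth(2)[OF \<psi>]])
qed

lemma inner_space_grad: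
  fixes \<psi> :: "real \<times> 'a::euclidean_space \<Rightarrow> real"
  assumes \<psi>: "test_function \<psi>"
  shows "v \<bullet> space_grad \<psi> z = partial (0, v) \<psi> z"
proof -
  have v: "(0, v) = (\<Sum>i\<in>Basis. (v \<bullet> i) *\<^sub>R (0 :: real, i :: 'a))"
    by (simp add: prod_eq_iff fst_sum snd_sum euclidean_representation)
  have "partial (0, v) \<psi> z = (\<Sum>i\<in>Basis. (v \<bullet> i) * partial (0, i) \<psi> z)"
    unfolding v using test_function_smooth(1)[OF \<psi>, of z]
    by (subst partial_sum) (simp_all del: scaleR_Pair add: partial_scaleR)
  also have "\<dots> = v \<bullet> space_grad \<psi> z"
    by (simp add: space_grad_def inner_sum_right mult.commute)
  finally show ?thesis ..
qed

section \<open>The explicit Gaussian interpolation\<close>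

text \<open>
  Every term of the Fokker--Planck equation depends only on the laws at single times. At a fixed time
  the Wiener integral is a Gaussian variable of variance \<open>a t\<close>, so the process may be replaced by an
  explicit one, built from an initial value with law \<open>P0\<close>, the curve \<open>\<eta>\<close> and one standard
  Gaussian variable, all independent and realized on a product space.
\<close>

locale gaussian_interpolation = M: prob_space M + P0: prob_space P0
  for M :: "'w measure" and P0 :: "'a::euclidean_space measure" +
  fixes \<sigma> a :: "real \<Rightarrow> real" and \<eta> :: "real \<Rightarrow> 'w \<Rightarrow> 'a"
  assumes sets_P0 [measurable_cong]: "sets P0 = sets borel"
    and C1_\<sigma>: "C1_on {0..<1} \<sigma>" and \<sigma>_pos: "\<And>t. t \<in> {0..<1} \<Longrightarrow> \<sigma> t > 0"
    and C1_a: "C1_on {0..<1} a" and a_nonneg: "\<And>t. t \<in> {0..<1} \<Longrightarrow> a t \<ge> 0"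
    and \<eta>_measurable: "\<And>t. t \<in> {0..1} \<Longrightarrow> \<eta> t \<in> borel_measurable M"
    and C1_\<eta>: "\<And>\<omega>. \<omega> \<in> space M \<Longrightarrow> C1_on {0..1} (\<lambda>t. \<eta> t \<omega>)"
    and drift_bound: "\<And>T. T \<in> {0<..<1} \<Longrightarrow>
      (\<integral>\<^sup>+t\<in>{0..T}. (\<integral>\<^sup>+\<omega>. ennreal (norm (eta_drift \<sigma> \<eta> t \<omega>)) \<partial>M) \<partial>lborel) < \<infinity>"
begin

abbreviation V :: "real \<Rightarrow> 'w \<Rightarrow> 'a" where "V \<equiv> eta_drift \<sigma> \<eta>"

abbreviation "da \<equiv> deriv_on {0..<1} a"

text \<open>
  The diffusion coefficient of the Fokker--Planck equation.
\<close>

definition D :: "real \<Rightarrow> real" where "D t = da t * (\<sigma> t)\<^sup>2 / 2"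

abbreviation base :: "('w \<times> 'a) measure" where "base \<equiv> M \<Otimes>\<^sub>M P0"

abbreviation sample :: "(('w \<times> 'a) \<times> 'a) measure" where "sample \<equiv> base \<Otimes>\<^sub>M std_gaussian"

abbreviation time_sample :: "(real \<times> ('w \<times> 'a) \<times> 'a) measure" where
  "time_sample \<equiv> unit_time \<Otimes>\<^sub>M sample"

abbreviation drift_mean :: "real \<Rightarrow> ennreal" where
  "drift_mean t \<equiv> \<integral>\<^sup>+\<omega>. ennreal (norm (V t \<omega>)) \<partial>M"

text \<open>
  For \<open>e = 0\<close> this is the explicit process. For \<open>e > 0\<close> the square root stays away from its
  singularity, so all paths are continuously differentiable on \<open>(0,1)\<close> even where \<open>a\<close> vanishes.
\<close>

definition Y :: "real \<Rightarrow> real \<Rightarrow> ('w \<times> 'a) \<times> 'a \<Rightarrow> 'a" where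
  "Y e t q = \<sigma> t *\<^sub>R snd (fst q) + \<eta> t (fst (fst q)) + (\<sigma> t * sqrt (a t + e)) *\<^sub>R snd q"

text \<open>
  The part of the derivative of \<open>\<sigma> t * sqrt (a t + e)\<close> in which the square root is differentiated.
\<close>

definition \<kappa> :: "real \<Rightarrow> real \<Rightarrow> real" where
  "\<kappa> e t = \<sigma> t * da t / (2 * sqrt (a t + e))"

sublocale G: prob_space "std_gaussian :: 'a measure"
  by (rule prob_space_std_gaussian)

sublocale base: pair_prob_space M P0 ..

sublocale sample: pair_prob_space base "std_gaussian :: 'a measure" ..

sublocale L: prob_space unit_time
  by (rule prob_space_unit_time)

sublocale LN: pair_prob_space unit_time sample ..

lemma interior_subsets: "{0<..<1} \<subseteq> {0..<1::real}" "{0<..<1} \<subseteq> {0..1::real}"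
  by auto

lemma coefficients_pos: "t \<in> {0<..<1} \<Longrightarrow> 0 < \<sigma> t" "t \<in> {0<..<1} \<Longrightarrow> 0 \<le> a t"
  using \<sigma>_pos a_nonneg by auto

lemmas cont_\<sigma> = C1_on_interior(3)[OF C1_\<sigma> interior_subsets(1)]
lemmas cont_a = C1_on_interior(3)[OF C1_a interior_subsets(1)]
lemmas cont_da = C1_on_interior(2)[OF C1_a interior_subsets(1)]
lemmas cont_\<eta> = C1_on_interior(3)[OF C1_\<eta> interior_subsets(2)]

lemma cont_ld: "continuous_on {0<..<1} (log_deriv \<sigma>)"
  by (rule log_deriv_properties(2)[OF C1_\<sigma>]) (rule \<sigma>_pos)

lemma deriv_\<sigma>: "t \<in> {0<..<1} \<Longrightarrow> (\<sigma> has_real_derivative log_deriv \<sigma> t * \<sigma> t) (at t)"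
  by (rule log_deriv_properties(1)[OF C1_\<sigma>]) (rule \<sigma>_pos)

lemma deriv_a: "t \<in> {0<..<1} \<Longrightarrow> (a has_real_derivative da t) (at t)"
  using C1_on_interior(1)[OF C1_a interior_subsets(1)] by (simp add: has_real_derivative_iff_has_vector_derivative)

lemma deriv_\<eta>:
  "\<omega> \<in> space M \<Longrightarrow> t \<in> {0<..<1} \<Longrightarrow>
    ((\<lambda>t. \<eta> t \<omega>) has_vector_derivative V t \<omega> + log_deriv \<sigma> t *\<^sub>R \<eta> t \<omega>) (at t)"
  using C1_on_interior(1)[OF C1_\<eta> interior_subsets(2)] by (simp add: eta_drift_def)

lemma cont_V: "\<omega> \<in> space M \<Longrightarrow> continuous_on {0<..<1} (\<lambda>t. V t \<omega>)"
  unfolding eta_drift_def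
  by (intro continuous_intros C1_on_interior(2)[OF C1_\<eta> interior_subsets(2)] cont_ld cont_\<eta>)

lemma cont_D: "continuous_on {0<..<1} D"
  unfolding D_def[abs_def] by (intro continuous_intros cont_\<sigma> cont_da) auto

lemma cont_\<kappa>: "0 < e \<Longrightarrow> continuous_on {0<..<1} (\<kappa> e)"
  unfolding \<kappa>_def[abs_def]
  by (intro continuous_intros cont_\<sigma> cont_da cont_a) (use coefficients_pos in \<open>auto simp: add_nonneg_eq_0_iff\<close>)

text \<open>
  The derivative of \<open>\<eta>\<close> is a limit of difference quotients whose steps \<open>h n\<close> keep \<open>t + h n\<close> inside the
  time interval.
\<close>

lemma V_measurable:
  assumes t: "t \<in> {0<..<1}"
  shows "V t \<in> borel_measurable M"
proof -
  define h where "h n = (1 - t) / (real n + 2)" for n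
  have h: "0 < h n" "t + h n \<in> {0..1}" for n
  proof -
    show "0 < h n" using t by (simp add: h_def)
    have "h n \<le> (1 - t) / 1" unfolding h_def using t by (intro divide_left_mono) auto
    with \<open>0 < h n\<close> show "t + h n \<in> {0..1}" using t by auto
  qed
  have h0: "h \<longlonglongrightarrow> 0"
    unfolding h_def[abs_def] by real_asymp
  have [measurable]: "\<eta> t \<in> borel_measurable M" "\<eta> (t + h n) \<in> borel_measurable M" for n
    using \<eta>_measurable[of t] \<eta>_measurable[OF h(2)] t by auto
  have "(\<lambda>\<omega>. V t \<omega> + log_deriv \<sigma> t *\<^sub>R \<eta> t \<omega>) \<in> borel_measurable M"
  proof (rule borel_measurable_LIMSEQ_metric)
    show "(\<lambda>\<omega>. (\<eta> (t + h n) \<omega> - \<eta> t \<omega>) /\<^sub>R h n) \<in> borel_measurable M" for n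
      by measurable
    show "(\<lambda>n. (\<eta> (t + h n) \<omega> - \<eta> t \<omega>) /\<^sub>R h n) \<longlonglongrightarrow> V t \<omega> + log_deriv \<sigma> t *\<^sub>R \<eta> t \<omega>" if "\<omega> \<in> space M" for \<omega>
      by (rule vector_derivative_difference_quotient[OF deriv_\<eta>[OF that t] h0]) (use h(1) in \<open>simp add: less_imp_neq[symmetric]\<close>)
  qed
  then have "(\<lambda>\<omega>. (V t \<omega> + log_deriv \<sigma> t *\<^sub>R \<eta> t \<omega>) - log_deriv \<sigma> t *\<^sub>R \<eta> t \<omega>) \<in> borel_measurable M"
    by measurable
  then show ?thesis by simp
qed

lemma V_joint: "(\<lambda>p. V (fst p) (snd p)) \<in> borel_measurable (unit_time \<Otimes>\<^sub>M M)"
  by (rule measurable_Caratheodory[OF V_measurable cont_V])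

lemma \<eta>_joint: "(\<lambda>p. \<eta> (fst p) (snd p)) \<in> borel_measurable (unit_time \<Otimes>\<^sub>M M)"
  by (rule measurable_Caratheodory[OF _ cont_\<eta>]) (simp add: \<eta>_measurable)

lemma V_sample [measurable]: "(\<lambda>p. V (fst p) (fst (fst (snd p)))) \<in> borel_measurable time_sample"
  using measurable_compose[OF _ V_joint, of "\<lambda>p. (fst p, fst (fst (snd p)))" time_sample] by simp

lemma \<eta>_sample [measurable]: "(\<lambda>p. \<eta> (fst p) (fst (fst (snd p)))) \<in> borel_measurable time_sample"
  using measurable_compose[OF _ \<eta>_joint, of "\<lambda>p. (fst p, fst (fst (snd p)))" time_sample] by simp

lemma coefficients_measurable [measurable]:
  "\<sigma> \<in> borel_measurable unit_time" "a \<in> borel_measurable unit_time" "da \<in> borel_measurable unit_time"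
  "log_deriv \<sigma> \<in> borel_measurable unit_time" "D \<in> borel_measurable unit_time"
  "(\<lambda>t. t) \<in> borel_measurable unit_time"
proof -
  show "D \<in> borel_measurable unit_time"
    by (rule borel_measurable_unit_time) (rule cont_D)
  show "(\<lambda>t. t) \<in> borel_measurable unit_time"
    by (rule borel_measurable_unit_time) (rule continuous_on_id)
qed (rule borel_measurable_unit_time, rule cont_\<sigma> cont_a cont_da cont_ld)+

lemma \<kappa>_measurable [measurable]: "\<kappa> e \<in> borel_measurable unit_time"
  unfolding \<kappa>_def[abs_def] by measurable

lemma snd_base_measurable [measurable]: "(\<lambda>p. snd (fst (snd p))) \<in> borel_measurable time_sample"
  using measurable_compose[OF _ measurable_snd[of M P0], of "\<lambda>p. fst (snd p)" time_sample]
  by (simp add: measurable_cong_sets[OF refl sets_P0])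

lemma Y_measurable [measurable]: "(\<lambda>p. Y e (fst p) (snd p)) \<in> borel_measurable time_sample"
  unfolding Y_def by measurable

lemma compose_Y_measurable:
  fixes f :: "real \<times> 'a \<Rightarrow> 'b::topological_space"
  assumes "continuous_on UNIV f"
  shows "(\<lambda>p. f (fst p, Y e (fst p) (snd p))) \<in> borel_measurable time_sample"
proof -
  have [measurable]: "(\<lambda>p. fst p) \<in> borel_measurable time_sample"
    using measurable_compose[OF measurable_fst coefficients_measurable(6)] by simp
  have "(\<lambda>p. (fst p, Y e (fst p) (snd p))) \<in> borel_measurable time_sample"
    unfolding borel_prod[symmetric] by measurable
  then show ?thesis
    by (rule measurable_compose) (rule borel_measurable_continuous_onI[OF assms])
qed

lemma nn_integral_sample_fst:
  assumes [measurable]: "f \<in> borel_measurable M"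
  shows "(\<integral>\<^sup>+q. f (fst (fst q)) \<partial>sample) = (\<integral>\<^sup>+\<omega>. f \<omega> \<partial>M)"
proof -
  have "(\<integral>\<^sup>+q. f (fst (fst q)) \<partial>sample) = (\<integral>\<^sup>+r. f (fst r) \<partial>base)"
    by (subst G.nn_integral_fst[symmetric]) (auto simp: G.emeasure_space_1[simplified])
  also have "\<dots> = (\<integral>\<^sup>+\<omega>. f \<omega> \<partial>M)"
    by (subst P0.nn_integral_fst[symmetric]) (auto simp: P0.emeasure_space_1)
  finally show ?thesis .
qed

text \<open>
  The derivative of \<open>Y\<close> is grouped so that the initial value, which need not be integrable, only
  enters through \<open>Y\<close> itself, and \<open>Y\<close> is bounded wherever a test function does not vanish.
\<close>

lemma Y_deriv:
  assumes e: "0 < e" and t: "t \<in> {0<..<1}" and q: "fst (fst q) \<in> space M"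
  shows "((\<lambda>t. Y e t q) has_vector_derivative
    log_deriv \<sigma> t *\<^sub>R Y e t q + V t (fst (fst q)) + \<kappa> e t *\<^sub>R snd q) (at t)"
proof -
  have scale: "((\<lambda>t. f t *\<^sub>R v) has_vector_derivative f' *\<^sub>R v) (at t)"
    if "(f has_real_derivative f') (at t)" for f :: "real \<Rightarrow> real" and f' and v :: 'a
    using has_derivative_scaleR_left[OF that[unfolded has_field_derivative_def], of v]
    by (simp add: has_vector_derivative_def mult.commute)
  have ap: "0 < a t + e" using coefficients_pos(2)[OF t] e by simp
  have "((\<lambda>t. sqrt (a t + e)) has_real_derivative da t / (2 * sqrt (a t + e))) (at t)"
    using ap by (auto intro!: derivative_eq_intros deriv_a[OF t] simp: field_simps)
  from DERIV_mult[OF deriv_\<sigma>[OF t] this]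
  have s: "((\<lambda>t. \<sigma> t * sqrt (a t + e)) has_real_derivative
      log_deriv \<sigma> t * (\<sigma> t * sqrt (a t + e)) + \<kappa> e t) (at t)"
    by (simp add: \<kappa>_def mult_ac)
  have "((\<lambda>t. Y e t q) has_vector_derivative
      (log_deriv \<sigma> t * \<sigma> t) *\<^sub>R snd (fst q) + (V t (fst (fst q)) + log_deriv \<sigma> t *\<^sub>R \<eta> t (fst (fst q))) +
      (log_deriv \<sigma> t * (\<sigma> t * sqrt (a t + e)) + \<kappa> e t) *\<^sub>R snd q) (at t)"
    unfolding Y_def
    by (intro has_vector_derivative_add deriv_\<eta>[OF q t] scale deriv_\<sigma>[OF t] s)
  then show ?thesis
    by (rule has_vector_derivative_eq_rhs) (simp add: Y_def scaleR_add_left scaleR_add_right)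
qed

end

section \<open>The weak equation for the explicit interpolation\<close>

lemma bounded_of_compact_support:
  fixes f :: "'b::topological_space \<Rightarrow> 'c::real_normed_vector"
  assumes "continuous_on UNIV f" "compact K" "\<And>z. z \<notin> K \<Longrightarrow> f z = 0"
  obtains B where "0 \<le> B" "\<And>z. norm (f z) \<le> B"
proof -
  have "bounded (f ` K)"
    by (intro compact_imp_bounded compact_continuous_image continuous_on_subset[OF assms(1)] assms(2)) auto
  then obtain B where B: "\<And>z. z \<in> K \<Longrightarrow> norm (f z) \<le> B" unfolding bounded_iff by blast
  have "norm (f z) \<le> max B 0" for z
    using B[of z] assms(3)[of z] by (cases "z \<in> K") auto
  then show thesis by (intro that[of "max B 0"]) auto
qed

locale tested_interpolation = gaussian_interpolation M P0 \<sigma> a \<eta>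
  for M :: "'w measure" and P0 :: "'a::euclidean_space measure" and \<sigma> a \<eta> +
  fixes \<psi> :: "real \<times> 'a \<Rightarrow> real" and \<delta> T R :: real
  assumes \<psi>: "test_function \<psi>"
    and times: "0 < \<delta>" "\<delta> < T" "T < 1" and R: "0 \<le> R"
    and support: "\<And>t x. (t, x) \<in> closure {z. \<psi> z \<noteq> 0} \<Longrightarrow> \<delta> < t \<and> t < T \<and> norm x \<le> R"
begin

abbreviation "K \<equiv> closure {z. \<psi> z \<noteq> 0}"
abbreviation "pt \<equiv> partial (1, 0) \<psi>"
abbreviation "gr \<equiv> space_grad \<psi>"
abbreviation "lap \<equiv> space_laplacian \<psi>"

abbreviation transport :: "real \<Rightarrow> real \<Rightarrow> ('w \<times> 'a) \<times> 'a \<Rightarrow> real" where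
  "transport e t q \<equiv> (log_deriv \<sigma> t *\<^sub>R Y e t q + V t (fst (fst q))) \<bullet> gr (t, Y e t q)"

abbreviation noise :: "real \<Rightarrow> real \<Rightarrow> ('w \<times> 'a) \<times> 'a \<Rightarrow> real" where
  "noise e t q \<equiv> \<kappa> e t * (snd q \<bullet> gr (t, Y e t q))"

abbreviation diffusion :: "real \<Rightarrow> real \<Rightarrow> ('w \<times> 'a) \<times> 'a \<Rightarrow> real" where
  "diffusion e t q \<equiv> D t * lap (t, Y e t q)"

lemma compact_K: "compact K"
  using \<psi> by (simp add: test_function_def)

lemma off_support:
  assumes "z \<notin> K"
  shows "\<psi> z = 0" "partial v \<psi> z = 0" "partial w (partial v \<psi>) z = 0" "gr z = 0" "lap z = 0"
proof -
  show "\<psi> z = 0" using assms closure_subset[of "{z. \<psi> z \<noteq> 0}"] by auto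
  have 1: "partial v \<psi> z = 0" if "z \<notin> K" for z v
  proof (rule partial_zero_outside[of "- K"])
    show "\<psi> y = 0" if "y \<in> - K" for y using that closure_subset[of "{z. \<psi> z \<noteq> 0}"] by auto
  qed (use that in auto)
  have 2: "partial w (partial v \<psi>) z = 0" for v w
    by (rule partial_zero_outside[of "- K"]) (use assms 1 in auto)
  show "partial v \<psi> z = 0" "partial w (partial v \<psi>) z = 0" using 1[OF assms] 2 by auto
  show "gr z = 0" "lap z = 0"
    by (simp_all add: space_grad_def space_laplacian_def 1[OF assms] 2)
qed

lemma cont_test:
  "continuous_on UNIV pt" "continuous_on UNIV gr" "continuous_on UNIV lap"
  unfolding space_grad_def[abs_def] space_laplacian_def[abs_def]
  by (intro continuous_intros test_function_smooth[OF \<psi>])+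

lemma test_bound:
  obtains B where "0 \<le> B" "\<And>z. \<bar>pt z\<bar> \<le> B" "\<And>z. norm (gr z) \<le> B" "\<And>z. \<bar>lap z\<bar> \<le> B"
proof -
  obtain B1 where B1: "0 \<le> B1" "\<And>z. norm (pt z) \<le> B1"
    using bounded_of_compact_support[OF cont_test(1) compact_K off_support(2)] by blast
  obtain B2 where B2: "0 \<le> B2" "\<And>z. norm (gr z) \<le> B2"
    using bounded_of_compact_support[OF cont_test(2) compact_K off_support(4)] by blast
  obtain B3 where B3: "0 \<le> B3" "\<And>z. norm (lap z) \<le> B3"
    using bounded_of_compact_support[OF cont_test(3) compact_K off_support(5)] by blast
  have "\<bar>pt z\<bar> \<le> B1 + B2 + B3" "norm (gr z) \<le> B1 + B2 + B3" "\<bar>lap z\<bar> \<le> B1 + B2 + B3" for z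
    using B1(2)[of z] B2(2)[of z] B3(2)[of z] B1(1) B2(1) B3(1) by auto
  then show thesis by (intro that[of "B1 + B2 + B3"]) (use B1 B2 B3 in auto)
qed

lemma coefficient_bound:
  assumes "continuous_on {0<..<1} (f :: real \<Rightarrow> real)"
  obtains C where "0 \<le> C" "\<And>t. t \<in> {\<delta>..T} \<Longrightarrow> \<bar>f t\<bar> \<le> C"
proof -
  have "bounded (f ` {\<delta>..T})"
    by (intro compact_imp_bounded compact_continuous_image continuous_on_subset[OF assms]) (use times in auto)
  then obtain C where C: "\<And>t. t \<in> {\<delta>..T} \<Longrightarrow> \<bar>f t\<bar> \<le> C"
    unfolding bounded_iff by (metis imageI real_norm_def)
  then have "\<bar>f t\<bar> \<le> max C 0" if "t \<in> {\<delta>..T}" for t using that by fastforce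
  then show thesis by (intro that[of "max C 0"]) auto
qed

definition A :: "real \<Rightarrow> real \<Rightarrow> ('w \<times> 'a) \<times> 'a \<Rightarrow> real" where
  "A e t q = pt (t, Y e t q) + transport e t q"

text \<open>
  The constant does not depend on \<open>e\<close>: the term is nonzero only where \<open>Y\<close> lies in the bounded support
  of the test function, whatever the size of the initial value.
\<close>

lemma drift_part_bound:
  obtains C where "0 \<le> C"
    "\<And>e t q. \<bar>transport e t q\<bar>
      \<le> C * (1 + indicator {0..T} t * norm (V t (fst (fst q))))"
proof -
  obtain B where B: "0 \<le> B" "\<And>z. norm (gr z) \<le> B" using test_bound by metis
  obtain C where C: "0 \<le> C" "\<And>t. t \<in> {\<delta>..T} \<Longrightarrow> \<bar>log_deriv \<sigma> t\<bar> \<le> C"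
    using coefficient_bound[OF cont_ld] by blast
  have "\<bar>transport e t q\<bar>
      \<le> (C * R * B + B) * (1 + indicator {0..T} t * norm (V t (fst (fst q))))" for e t q
  proof (cases "(t, Y e t q) \<in> K")
    case True
    then have t: "\<delta> < t" "t < T" "norm (Y e t q) \<le> R" using support by auto
    have "\<bar>transport e t q\<bar>
        \<le> norm (log_deriv \<sigma> t *\<^sub>R Y e t q + V t (fst (fst q))) * norm (gr (t, Y e t q))"
      by (rule Cauchy_Schwarz_ineq2)
    also have "\<dots> \<le> (C * R + norm (V t (fst (fst q)))) * B"
    proof (rule mult_mono)
      have "norm (log_deriv \<sigma> t *\<^sub>R Y e t q + V t (fst (fst q))) \<le> \<bar>log_deriv \<sigma> t\<bar> * norm (Y e t q) + norm (V t (fst (fst q)))"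
        by (rule norm_triangle_le) simp
      also have "\<bar>log_deriv \<sigma> t\<bar> * norm (Y e t q) \<le> C * R"
        by (rule mult_mono) (use C t in auto)
      finally show "norm (log_deriv \<sigma> t *\<^sub>R Y e t q + V t (fst (fst q))) \<le> C * R + norm (V t (fst (fst q)))" by simp
    qed (use B C R in auto)
    also have "\<dots> \<le> (C * R * B + B) * (1 + norm (V t (fst (fst q))))"
      using B(1) C(1) R by (simp add: algebra_simps)
    also have "\<dots> = (C * R * B + B) * (1 + indicator {0..T} t * norm (V t (fst (fst q))))"
      using t times by simp
    finally show ?thesis .
  next
    case False
    then show ?thesis unfolding off_support(4)[OF False] using B(1) C(1) R by simp
  qed
  then show thesis
    by (rule that[of "C * R * B + B", rotated]) (intro add_nonneg_nonneg mult_nonneg_nonneg B(1) C(1) R)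
qed

lemma diffusion_part_bound:
  obtains C where "0 \<le> C" "\<And>e t q. \<bar>diffusion e t q\<bar> \<le> C"
proof -
  obtain B where B: "0 \<le> B" "\<And>z. \<bar>lap z\<bar> \<le> B" using test_bound by metis
  obtain C where C: "0 \<le> C" "\<And>t. t \<in> {\<delta>..T} \<Longrightarrow> \<bar>D t\<bar> \<le> C"
    using coefficient_bound[OF cont_D] by blast
  have "\<bar>diffusion e t q\<bar> \<le> C * B" for e t q
  proof (cases "(t, Y e t q) \<in> K")
    case True
    then have "t \<in> {\<delta>..T}" using support by force
    then show ?thesis unfolding abs_mult by (intro mult_mono) (use B C in auto)
  next
    case False
    then show ?thesis unfolding off_support(4,5)[OF False] using B(1) C(1) by simp
  qed
  then show thesis
    by (rule that[of "C * B", rotated]) (intro mult_nonneg_nonneg B(1) C(1))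
qed

text \<open>
  Here \<open>C\<close> depends on \<open>e\<close>, and may blow up as \<open>e\<close> tends to zero; the bound only serves to integrate
  for fixed \<open>e\<close>.
\<close>

lemma noise_part_bound:
  assumes "0 < e"
  obtains C where "0 \<le> C" "\<And>t q. \<bar>noise e t q\<bar> \<le> C * norm (snd q)"
proof -
  obtain B where B: "0 \<le> B" "\<And>z. norm (gr z) \<le> B" using test_bound by metis
  obtain C where C: "0 \<le> C" "\<And>t. t \<in> {\<delta>..T} \<Longrightarrow> \<bar>\<kappa> e t\<bar> \<le> C"
    using coefficient_bound[OF cont_\<kappa>[OF assms]] by blast
  have "\<bar>noise e t q\<bar> \<le> (C * B) * norm (snd q)" for t q
  proof (cases "(t, Y e t q) \<in> K")
    case True
    then have "t \<in> {\<delta>..T}" using support by force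
    then have "\<bar>\<kappa> e t\<bar> * \<bar>snd q \<bullet> gr (t, Y e t q)\<bar> \<le> C * (norm (snd q) * B)"
      by (intro mult_mono order.trans[OF Cauchy_Schwarz_ineq2]) (use B C in auto)
    then show ?thesis by (simp add: abs_mult mult_ac)
  next
    case False
    then show ?thesis unfolding off_support(4,5)[OF False] using B(1) C(1) by simp
  qed
  then show thesis
    by (rule that[of "C * B", rotated]) (intro mult_nonneg_nonneg B(1) C(1))
qed

lemma integrable_drift_norm:
  "integrable time_sample (\<lambda>p. indicator {0..T} (fst p) * norm (V (fst p) (fst (fst (snd p)))))"
proof (rule integrableI_nonneg)
  have [measurable]: "(\<lambda>t. indicator {0..T} t :: real) \<in> borel_measurable unit_time"
    by (intro measurable_restrict_space1) simp
  show m: "(\<lambda>p. indicator {0..T} (fst p) * norm (V (fst p) (fst (fst (snd p))))) \<in> borel_measurable time_sample"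
    by measurable
  have "(\<integral>\<^sup>+p. ennreal (indicator {0..T} (fst p) * norm (V (fst p) (fst (fst (snd p))))) \<partial>time_sample) =
      (\<integral>\<^sup>+t. \<integral>\<^sup>+q. ennreal (indicator {0..T} t * norm (V t (fst (fst q)))) \<partial>sample \<partial>unit_time)"
    by (subst sample.P.nn_integral_fst[symmetric]) (use m in auto)
  also have "\<dots> = (\<integral>\<^sup>+t. \<integral>\<^sup>+\<omega>. ennreal (indicator {0..T} t * norm (V t \<omega>)) \<partial>M \<partial>unit_time)"
  proof (rule nn_integral_cong)
    fix t assume "t \<in> space unit_time"
    then have [measurable]: "V t \<in> borel_measurable M" by (simp add: V_measurable)
    show "(\<integral>\<^sup>+q. ennreal (indicator {0..T} t * norm (V t (fst (fst q)))) \<partial>sample) =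
        (\<integral>\<^sup>+\<omega>. ennreal (indicator {0..T} t * norm (V t \<omega>)) \<partial>M)"
      by (rule nn_integral_sample_fst) measurable
  qed
  also have "\<dots> = (\<integral>\<^sup>+t. (\<integral>\<^sup>+\<omega>. ennreal (indicator {0..T} t * norm (V t \<omega>)) \<partial>M) * indicator {0<..<1} t \<partial>lborel)"
    by (subst nn_integral_restrict_space) auto
  also have "\<dots> \<le> (\<integral>\<^sup>+t\<in>{0..T}. drift_mean t \<partial>lborel)"
    by (intro nn_integral_mono) (auto simp: indicator_def)
  also have "\<dots> < \<infinity>" using drift_bound[of T] times by auto
  finally show "(\<integral>\<^sup>+p. ennreal (indicator {0..T} (fst p) * norm (V (fst p) (fst (fst (snd p))))) \<partial>time_sample) < \<infinity>" .
qed simp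

lemma integrable_drift_part:
  "integrable time_sample (\<lambda>p. transport e (fst p) (snd p))"
proof -
  obtain C where C: "0 \<le> C"
    "\<And>e t q. \<bar>transport e t q\<bar>
      \<le> C * (1 + indicator {0..T} t * norm (V t (fst (fst q))))"
    using drift_part_bound by blast
  note [measurable] = compose_Y_measurable[OF cont_test(2)]
  show ?thesis
  proof (rule Bochner_Integration.integrable_bound)
    show "integrable time_sample (\<lambda>p. C * (1 + indicator {0..T} (fst p) * norm (V (fst p) (fst (fst (snd p))))))"
      by (intro integrable_mult_right Bochner_Integration.integrable_add LN.integrable_const integrable_drift_norm)
  qed (measurable, rule AE_I2, rule order.trans[OF C(2)[folded real_norm_def]], simp)
qed

lemma integrable_time_part: "integrable time_sample (\<lambda>p. pt (fst p, Y e (fst p) (snd p)))"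
proof -
  obtain B where B: "\<And>z. \<bar>pt z\<bar> \<le> B" using test_bound by metis
  show ?thesis
    by (rule LN.integrable_const_bound[where B = B]) (auto simp: B compose_Y_measurable[OF cont_test(1)])
qed

lemma integrable_diffusion_part:
  "integrable time_sample (\<lambda>p. diffusion e (fst p) (snd p))"
proof -
  obtain C where "0 \<le> C" and C: "\<And>e t q. \<bar>diffusion e t q\<bar> \<le> C"
    by (rule diffusion_part_bound; rule that; assumption)
  note [measurable] = compose_Y_measurable[OF cont_test(3)]
  show ?thesis by (rule LN.integrable_const_bound[where B = C]) (auto simp: C)
qed

lemma integrable_gaussian_norm: "integrable std_gaussian (\<lambda>z :: 'a. norm z)"
proof -
  have "integrable lborel (\<lambda>z :: 'a. ((2 * pi) powr (- real DIM('a) / 2)) * (norm z powr 1 * exp (- (norm z)\<^sup>2 / 2)))"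
    by (intro integrable_mult_right integrable_gauss_moment) simp
  then show ?thesis
    by (subst integrable_density) (auto simp: gauss_density_def mult_ac)
qed

lemma integrable_noise_part:
  assumes "0 < e"
  shows "integrable time_sample (\<lambda>p. noise e (fst p) (snd p))"
proof -
  obtain C where "0 \<le> C" and C: "\<And>t q. \<bar>noise e t q\<bar> \<le> C * norm (snd q)"
    by (rule noise_part_bound[OF assms]; rule that; assumption)
  note [measurable] = compose_Y_measurable[OF cont_test(2)]
  have "integrable time_sample (\<lambda>p. norm (snd (snd p)))"
  proof (rule integrableI_nonneg)
    have "(\<integral>\<^sup>+p. ennreal (norm (snd (snd p))) \<partial>time_sample) = (\<integral>\<^sup>+z. ennreal (norm z) \<partial>(std_gaussian :: 'a measure))"
      by (subst sample.P.nn_integral_fst[symmetric], measurable)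
         (subst G.nn_integral_fst[symmetric], auto simp: L.emeasure_space_1[simplified] base.P.emeasure_space_1)
    also have "\<dots> < \<infinity>"
      using integrable_gaussian_norm by (simp add: integrable_iff_bounded)
    finally show "(\<integral>\<^sup>+p. ennreal (norm (snd (snd p))) \<partial>time_sample) < \<infinity>" .
  qed auto
  then have "integrable time_sample (\<lambda>p. C * norm (snd (snd p)))"
    by (rule integrable_mult_right)
  then show ?thesis
    by (rule Bochner_Integration.integrable_bound)
       (measurable, rule AE_I2, rule order.trans[OF C[folded real_norm_def]], simp)
qed

end

context tested_interpolation
begin

lemma test_along_path:
  assumes e: "0 < e" and t: "t \<in> {0<..<1}" and q: "fst (fst q) \<in> space M"
  shows "((\<lambda>t. \<psi> (t, Y e t q)) has_real_derivative A e t q + noise e t q) (at t)"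
proof -
  let ?Y' = "log_deriv \<sigma> t *\<^sub>R Y e t q + V t (fst (fst q)) + \<kappa> e t *\<^sub>R snd q"
  have "((\<lambda>t. (t, Y e t q)) has_vector_derivative (1, ?Y')) (at t)"
    by (rule has_vector_derivative_Pair[OF has_vector_derivative_id Y_deriv[OF e t q]])
  then have "((\<lambda>t. \<psi> (t, Y e t q)) has_real_derivative partial (1, ?Y') \<psi> (t, Y e t q)) (at t)"
    by (rule has_real_derivative_along_path[OF test_function_smooth(1)[OF \<psi>]])
  moreover have "partial (1, ?Y') \<psi> (t, Y e t q) = pt (t, Y e t q) + partial (0, ?Y') \<psi> (t, Y e t q)"
    using partial_add[OF test_function_smooth(1)[OF \<psi>], of "(1, 0)" "(0, ?Y')" "(t, Y e t q)"] by simp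
  moreover have "partial (0, ?Y') \<psi> (t, Y e t q) = ?Y' \<bullet> gr (t, Y e t q)"
    by (rule inner_space_grad[OF \<psi>, symmetric])
  ultimately show ?thesis
    by (simp add: A_def inner_add_left add.assoc)
qed

lemma cont_Y:
  assumes "0 < e" "fst (fst q) \<in> space M"
  shows "continuous_on {0<..<1} (\<lambda>t. Y e t q)"
  using Y_deriv[OF assms(1) _ assms(2)]
  by (meson continuous_at_imp_continuous_on has_vector_derivative_continuous)

text \<open>The test function vanishes at both ends of the time interval.\<close>

lemma integral_along_path:
  assumes e: "0 < e" and q: "fst (fst q) \<in> space M"
  shows "(\<integral>t. A e t q + noise e t q \<partial>unit_time) = 0"
proof -
  define f where "f t = A e t q + noise e t q" for t
  have sub: "{\<delta>..T} \<subseteq> {0<..<1}" using times by auto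
  have cY: "continuous_on {0<..<1} (\<lambda>t. (t, Y e t q))"
    by (intro continuous_intros cont_Y[OF e q])
  have "continuous_on {0<..<1} f"
    unfolding f_def A_def
    by (intro continuous_intros cont_Y[OF e q] cont_V[OF q] cont_ld cont_\<kappa>[OF e]
        continuous_on_compose2[OF cont_test(1) cY] continuous_on_compose2[OF cont_test(2) cY]) auto
  then have cf: "continuous_on {\<delta>..T} f" by (rule continuous_on_subset[OF _ sub])
  have ends: "\<psi> (\<delta>, x) = 0" "\<psi> (T, x) = 0" for x
    using support[of \<delta> x] support[of T x] off_support(1)[of "(\<delta>, x)"] off_support(1)[of "(T, x)"] by blast+
  have f0: "f t = 0" if "t \<notin> {\<delta>..T}" for t
  proof -
    have nK: "(t, Y e t q) \<notin> K" using support[of t "Y e t q"] that by auto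
    show ?thesis unfolding f_def A_def off_support(2,4)[OF nK] by simp
  qed
  have "(\<integral>t. f t \<partial>unit_time) = (\<integral>t. indicator {0<..<1} t *\<^sub>R f t \<partial>lborel)"
    by (rule integral_restrict_space) simp
  also have "\<dots> = (\<integral>t. indicator {\<delta>..T} t *\<^sub>R f t \<partial>lborel)"
  proof (rule Bochner_Integration.integral_cong[OF refl])
    fix t show "indicator {0<..<1} t *\<^sub>R f t = indicator {\<delta>..T} t *\<^sub>R f t"
      using f0[of t] sub by (cases "t \<in> {\<delta>..T}") (auto simp: indicator_def)
  qed
  also have "\<dots> = \<psi> (T, Y e T q) - \<psi> (\<delta>, Y e \<delta> q)"
  proof (rule integral_FTC_Icc[OF _ _ cf])
    fix t assume "\<delta> \<le> t" "t \<le> T"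
    then have "t \<in> {0<..<1}" using sub by auto
    from test_along_path[OF e this q]
    show "((\<lambda>t. \<psi> (t, Y e t q)) has_vector_derivative f t) (at t within {\<delta>..T})"
      unfolding f_def has_real_derivative_iff_has_vector_derivative
      by (rule has_vector_derivative_at_within)
  qed (use times in simp)
  finally show ?thesis unfolding f_def[symmetric] by (simp add: ends)
qed

text \<open>
  Gaussian integration by parts in each coordinate trades the Gaussian factor for a second derivative.
\<close>

lemma integral_noise_part_slice:
  assumes e: "0 < e" and t: "t \<in> {0<..<1}"
  shows "(\<integral>z. z \<bullet> gr (t, Y e t (r, z)) \<partial>std_gaussian) =
    \<sigma> t * sqrt (a t + e) * (\<integral>z. lap (t, Y e t (r, z)) \<partial>std_gaussian)"
proof -
  define s where "s = \<sigma> t * sqrt (a t + e)"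
  have s: "0 < s" using coefficients_pos[OF t] e by (simp add: s_def)
  define y where "y = \<sigma> t *\<^sub>R snd r + \<eta> t (fst r)"
  have Ys: "Y e t (r, z) = y + s *\<^sub>R z" for z by (simp add: Y_def y_def s_def)
  define g where "g i x = partial (0, i) \<psi> (t, x)" for i x
  have g_diff: "g i differentiable (at x)" for i x
    unfolding g_def[abs_def] by (rule partial_slice(2)[OF test_function_smooth(2)[OF \<psi>]])
  have g_part: "partial i (g i) x = partial (0, i) (partial (0, i) \<psi>) (t, x)" for i x
    unfolding g_def[abs_def] by (rule partial_slice(1)[OF test_function_smooth(2)[OF \<psi>]])
  have pair_cont: "continuous_on UNIV (\<lambda>x. (t, x))" by (intro continuous_intros)
  have g_cont: "continuous_on UNIV (g i)" for i
    unfolding g_def[abs_def] by (rule continuous_on_compose2[OF test_function_smooth(4)[OF \<psi>] pair_cont]) simp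
  have gp_cont: "continuous_on UNIV (partial i (g i))" for i
    unfolding g_part[abs_def] by (rule continuous_on_compose2[OF test_function_smooth(5)[OF \<psi>] pair_cont]) simp
  have nK: "(t, x) \<notin> K" if "R < norm x" for x using support[of t x] that by auto
  have g0: "g i x = 0" if "R < norm x" for i x
    unfolding g_def by (rule off_support(2)[OF nK[OF that]])
  have gp0: "partial i (g i) x = 0" if "R < norm x" for i x
    by (rule partial_zero_outside_ball[OF g0 that])
  have [measurable]: "g i \<in> borel_measurable borel" "partial i (g i) \<in> borel_measurable borel" for i
    using g_cont gp_cont by (auto intro: borel_measurable_continuous_onI)
  have int1: "integrable std_gaussian (\<lambda>z. (z \<bullet> i) * g i (y + s *\<^sub>R z))" if i: "i \<in> Basis" for i
  proof -
    obtain B where B: "\<And>x. \<bar>g i x\<bar> \<le> B" using bounded_of_bounded_support[OF g_cont g0] by blast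
    show ?thesis
    proof (rule Bochner_Integration.integrable_bound[OF integrable_mult_right[OF integrable_gaussian_norm, of B]])
      show "AE z in std_gaussian. norm ((z \<bullet> i) * g i (y + s *\<^sub>R z)) \<le> norm (B * norm z)"
      proof (rule AE_I2)
        fix z :: 'a
        have "\<bar>z \<bullet> i\<bar> * \<bar>g i (y + s *\<^sub>R z)\<bar> \<le> norm z * B"
          by (intro mult_mono Basis_le_norm[OF i] B) auto
        then show "norm ((z \<bullet> i) * g i (y + s *\<^sub>R z)) \<le> norm (B * norm z)"
          using abs_ge_zero[of "g i 0"] B[of 0] by (simp add: abs_mult mult.commute)
      qed
    qed measurable
  qed
  have int2: "integrable std_gaussian (\<lambda>z. partial i (g i) (y + s *\<^sub>R z))" for i
  proof -
    obtain B where B: "\<And>x. \<bar>partial i (g i) x\<bar> \<le> B" using bounded_of_bounded_support[OF gp_cont gp0] by blast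
    show ?thesis by (rule G.integrable_const_bound[where B = B]) (auto simp: B)
  qed
  have "(\<integral>z. z \<bullet> gr (t, Y e t (r, z)) \<partial>std_gaussian) =
      (\<integral>z. (\<Sum>i\<in>Basis. (z \<bullet> i) * g i (y + s *\<^sub>R z)) \<partial>std_gaussian)"
    unfolding Ys space_grad_def g_def by (simp add: inner_sum_right mult.commute)
  also have "\<dots> = (\<Sum>i\<in>Basis. \<integral>z. (z \<bullet> i) * g i (y + s *\<^sub>R z) \<partial>std_gaussian)"
    by (rule Bochner_Integration.integral_sum) (rule int1)
  also have "\<dots> = (\<Sum>i\<in>Basis. s * (\<integral>z. partial i (g i) (y + s *\<^sub>R z) \<partial>std_gaussian))"
    by (intro sum.cong refl gaussian_integration_by_parts[OF g_diff gp_cont g0 s])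
  also have "\<dots> = s * (\<integral>z. (\<Sum>i\<in>Basis. partial i (g i) (y + s *\<^sub>R z)) \<partial>std_gaussian)"
    unfolding sum_distrib_left[symmetric] by (subst Bochner_Integration.integral_sum) (auto intro: int2)
  also have "(\<lambda>z. \<Sum>i\<in>Basis. partial i (g i) (y + s *\<^sub>R z)) = (\<lambda>z. lap (t, Y e t (r, z)))"
    unfolding Ys space_laplacian_def g_part ..
  finally show ?thesis unfolding s_def .
qed

text \<open>
  The factor \<open>\<sigma> t * sqrt (a t + e)\<close> produced by the integration by parts cancels the singular
  denominator of \<open>\<kappa> e t\<close> and leaves exactly the diffusion coefficient.
\<close>

lemma integral_noise_part:
  assumes e: "0 < e"
  shows "(\<integral>p. noise e (fst p) (snd p) \<partial>time_sample) =
    (\<integral>p. diffusion e (fst p) (snd p) \<partial>time_sample)"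
proof -
  note n = integrable_noise_part[OF e] and d = integrable_diffusion_part[of e]
  have slice: "(\<integral>q. noise e t q \<partial>sample) = (\<integral>q. diffusion e t q \<partial>sample)"
    if t: "t \<in> {0<..<1}"
      and n: "integrable sample (\<lambda>q. noise e t q)"
      and d: "integrable sample (\<lambda>q. diffusion e t q)" for t
  proof -
    have ap: "0 < a t + e" using coefficients_pos[OF t] e by simp
    have \<kappa>D: "\<kappa> e t * (\<sigma> t * sqrt (a t + e)) = D t"
      using ap by (simp add: \<kappa>_def D_def power2_eq_square)
    have "(\<integral>q. noise e t q \<partial>sample) =
        (\<integral>r. \<integral>z. \<kappa> e t * (z \<bullet> gr (t, Y e t (r, z))) \<partial>std_gaussian \<partial>base)"
      using sample.integral_fst'[OF n, symmetric] by (simp only: snd_conv fst_conv)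
    also have "\<dots> = (\<integral>r. \<integral>z. D t * lap (t, Y e t (r, z)) \<partial>std_gaussian \<partial>base)"
      by (simp add: integral_noise_part_slice[OF e t] mult.assoc[symmetric] \<kappa>D)
         (simp add: mult.assoc \<kappa>D[symmetric])
    also have "\<dots> = (\<integral>q. diffusion e t q \<partial>sample)"
      using sample.integral_fst'[OF d] by (simp only: snd_conv fst_conv)
    finally show ?thesis .
  qed
  have "(\<integral>p. noise e (fst p) (snd p) \<partial>time_sample) =
      (\<integral>t. \<integral>q. noise e t q \<partial>sample \<partial>unit_time)"
    using LN.integral_fst'[OF n, symmetric] by (simp only: snd_conv fst_conv)
  also have "\<dots> = (\<integral>t. \<integral>q. diffusion e t q \<partial>sample \<partial>unit_time)"
  proof (rule integral_cong_AE)
    show "AE t in unit_time. (\<integral>q. noise e t q \<partial>sample) = (\<integral>q. diffusion e t q \<partial>sample)"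
      using AE_space LN.AE_integrable_fst'[OF n] LN.AE_integrable_fst'[OF d]
      by eventually_elim (rule slice, simp_all)
  qed (use LN.integrable_fst'[OF n] LN.integrable_fst'[OF d] in \<open>simp_all add: borel_measurable_integrable\<close>)
  also have "\<dots> = (\<integral>p. diffusion e (fst p) (snd p) \<partial>time_sample)"
    using LN.integral_fst'[OF d] by (simp only: snd_conv fst_conv)
  finally show ?thesis .
qed

lemma integrable_A: "integrable time_sample (\<lambda>p. A e (fst p) (snd p))"
  unfolding A_def
  by (rule Bochner_Integration.integrable_add[OF integrable_time_part integrable_drift_part])

text \<open>
  Average the identity along paths over the sample space, exchange the integrals, and replace the
  noise term by the diffusion term.
\<close>

lemma weak_equation_regularized:
  assumes e: "0 < e"
  shows "(\<integral>p. A e (fst p) (snd p) + diffusion e (fst p) (snd p) \<partial>time_sample) = 0"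
proof -
  let ?n = "\<lambda>p. noise e (fst p) (snd p)"
  note n = integrable_noise_part[OF e] and d = integrable_diffusion_part[of e] and A = integrable_A[of e]
  have An: "integrable time_sample (\<lambda>p. A e (fst p) (snd p) + ?n p)"
    by (rule Bochner_Integration.integrable_add[OF A n])
  have "(\<integral>p. A e (fst p) (snd p) + ?n p \<partial>time_sample) =
      (\<integral>q. \<integral>t. A e t q + noise e t q \<partial>unit_time \<partial>sample)"
    by (rule LN.integral_snd[of "\<lambda>t q. A e t q + noise e t q",
          unfolded case_prod_unfold, OF An, symmetric])
  also have "\<dots> = (\<integral>q. 0 \<partial>sample)"
    by (rule Bochner_Integration.integral_cong[OF refl])
       (rule integral_along_path[OF e], auto simp: space_pair_measure)
  finally have "(\<integral>p. A e (fst p) (snd p) + ?n p \<partial>time_sample) = 0" by simp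
  then show ?thesis
    by (simp add: Bochner_Integration.integral_add[OF A n] Bochner_Integration.integral_add[OF A d]
        integral_noise_part[OF e])
qed

text \<open>
  Once the noise term is gone all remaining bounds are uniform in \<open>e\<close>, so \<open>e\<close> can be sent to zero by
  dominated convergence.
\<close>

lemma weak_equation:
  "(\<integral>p. A 0 (fst p) (snd p) + diffusion 0 (fst p) (snd p) \<partial>time_sample) = 0"
proof -
  define e where "e n = 1 / (real n + 1)" for n
  have e: "0 < e n" for n by (simp add: e_def)
  have e0: "e \<longlonglongrightarrow> 0" unfolding e_def[abs_def] by real_asymp
  obtain C1 where C1: "0 \<le> C1"
    "\<And>e t q. \<bar>transport e t q\<bar>
      \<le> C1 * (1 + indicator {0..T} t * norm (V t (fst (fst q))))"
    using drift_part_bound by blast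
  obtain C2 where "0 \<le> C2" and C2: "\<And>e t q. \<bar>diffusion e t q\<bar> \<le> C2"
    by (rule diffusion_part_bound; rule that; assumption)
  obtain B where B: "\<And>z. \<bar>pt z\<bar> \<le> B" using test_bound by metis
  define w where "w p = (B + C2) + C1 * (1 + indicator {0..T} (fst p) * norm (V (fst p) (fst (fst (snd p)))))"
    for p :: "real \<times> ('w \<times> 'a) \<times> 'a"
  define F where "F e p = A e (fst p) (snd p) + diffusion e (fst p) (snd p)"
    for e and p :: "real \<times> ('w \<times> 'a) \<times> 'a"
  have F: "integrable time_sample (F e)" for e
    unfolding F_def by (rule Bochner_Integration.integrable_add[OF integrable_A integrable_diffusion_part])
  have "(\<lambda>n. \<integral>p. F (e n) p \<partial>time_sample) \<longlonglongrightarrow> (\<integral>p. F 0 p \<partial>time_sample)"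
  proof (rule integral_dominated_convergence[where w = w])
    show "integrable time_sample w"
      unfolding w_def
      by (intro integrable_mult_right Bochner_Integration.integrable_add LN.integrable_const integrable_drift_norm)
    show "AE p in time_sample. norm (F (e n) p) \<le> w p" for n
    proof (rule AE_I2)
      fix p :: "real \<times> ('w \<times> 'a) \<times> 'a"
      show "norm (F (e n) p) \<le> w p"
        using C1(2)[of "fst p" "e n" "snd p"] C2[of "fst p" "e n" "snd p"] B[of "(fst p, Y (e n) (fst p) (snd p))"]
        unfolding F_def A_def w_def real_norm_def by linarith
    qed
    show "AE p in time_sample. (\<lambda>n. F (e n) p) \<longlonglongrightarrow> F 0 p"
    proof (rule AE_I2)
      fix p :: "real \<times> ('w \<times> 'a) \<times> 'a"
      have Ylim: "(\<lambda>n. Y (e n) (fst p) (snd p)) \<longlonglongrightarrow> Y 0 (fst p) (snd p)"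
        unfolding Y_def by (intro tendsto_intros e0)
      have comp: "(\<lambda>n. f (fst p, Y (e n) (fst p) (snd p))) \<longlonglongrightarrow> f (fst p, Y 0 (fst p) (snd p))"
        if "continuous_on UNIV f" for f :: "real \<times> 'a \<Rightarrow> 'b::topological_space"
        by (rule continuous_on_tendsto_compose[OF that tendsto_Pair[OF tendsto_const Ylim]]) auto
      show "(\<lambda>n. F (e n) p) \<longlonglongrightarrow> F 0 p"
        unfolding F_def A_def by (intro tendsto_intros Ylim comp cont_test)
    qed
  qed (rule borel_measurable_integrable[OF F])+
  moreover have "(\<integral>p. F (e n) p \<partial>time_sample) = 0" for n
    unfolding F_def by (rule weak_equation_regularized[OF e])
  ultimately show ?thesis unfolding F_def[symmetric] by (simp add: LIMSEQ_const_iff)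
qed

end

section \<open>The interpolated density\<close>

lemma borel_measurable_completion_AE:
  fixes f g :: "'b \<Rightarrow> 'c::topological_space"
  assumes [measurable]: "g \<in> borel_measurable N" and eq: "AE x in N. f x = g x"
  shows "f \<in> borel_measurable (completion N)"
proof (rule measurableI)
  fix S :: "'c set" assume [measurable]: "S \<in> sets borel"
  have g[measurable]: "Measurable.pred (completion N) (\<lambda>x. g x \<in> S)"
    by (intro measurable_completion) measurable
  have [measurable]: "Measurable.pred (completion N) (\<lambda>x. g x \<in> S \<and> f x \<notin> S)"
    "Measurable.pred (completion N) (\<lambda>x. g x \<notin> S \<and> f x \<in> S)"
    by (intro sets_completion_AE; use eq in \<open>eventually_elim; simp\<close>)+
  have "Measurable.pred (completion N) (\<lambda>x. (g x \<in> S \<and> \<not> (g x \<in> S \<and> f x \<notin> S)) \<or> (g x \<notin> S \<and> f x \<in> S))"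
    by measurable
  moreover have "(\<lambda>x. (g x \<in> S \<and> \<not> (g x \<in> S \<and> f x \<notin> S)) \<or> (g x \<notin> S \<and> f x \<in> S)) = (\<lambda>x. f x \<in> S)"
    by auto
  ultimately have "Measurable.pred (completion N) (\<lambda>x. f x \<in> S)" by simp
  then show "f -` S \<inter> space (completion N) \<in> sets (completion N)"
    by (simp add: pred_def vimage_def Int_def conj_commute)
qed simp

text \<open>
  The completed measure allows \<open>I\<close> to be arbitrary on a null set of times, such as the set of times
  at which the drift of \<open>\<eta>\<close> has no finite mean.
\<close>

lemma set_integral_unit_time:
  fixes I j :: "real \<Rightarrow> real"
  assumes j: "integrable unit_time j" and eq: "AE t in unit_time. I t = j t"
  shows "set_integrable lebesgue {0<..<1} I"
    and "(LINT t:{0<..<1}|lebesgue. I t) = (\<integral>t. j t \<partial>unit_time)"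
proof -
  let ?j = "\<lambda>t. indicator {0<..<1} t *\<^sub>R j t" and ?I = "\<lambda>t. indicator {0<..<1} t *\<^sub>R I t"
  have int: "integrable lborel ?j" using j by (subst (asm) integrable_restrict_space) auto
  have AE: "AE t in lborel. ?I t = ?j t"
    using eq by (subst (asm) AE_restrict_space_iff) (auto simp: indicator_def elim!: eventually_mono)
  have mI: "?I \<in> borel_measurable lebesgue"
    by (rule borel_measurable_completion_AE[OF borel_measurable_integrable[OF int] AE])
  have int': "integrable lebesgue ?j"
    using int by (subst integrable_completion) auto
  show "set_integrable lebesgue {0<..<1} I"
    unfolding set_integrable_def
    using integrable_cong_AE[OF mI borel_measurable_integrable[OF int'] AE_completion[OF AE]] int' by simp
  have "(LINT t:{0<..<1}|lebesgue. I t) = (\<integral>t. ?j t \<partial>lebesgue)"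
    unfolding set_lebesgue_integral_def
    by (rule integral_cong_AE[OF mI borel_measurable_integrable[OF int'] AE_completion[OF AE]])
  also have "\<dots> = (\<integral>t. ?j t \<partial>lborel)"
    using int by (intro integral_completion) auto
  also have "\<dots> = (\<integral>t. j t \<partial>unit_time)"
    by (subst integral_restrict_space) auto
  finally show "(LINT t:{0<..<1}|lebesgue. I t) = (\<integral>t. j t \<partial>unit_time)" .
qed

locale interpolation_density = gaussian_interpolation M P0 \<sigma> a \<eta>
  for M :: "'w measure" and P0 :: "'a::euclidean_space measure" and \<sigma> a \<eta> +
  fixes \<rho> :: "real \<Rightarrow> 'a \<Rightarrow> real"
  assumes \<rho>_nonneg: "\<And>t x. t \<in> {0<..<1} \<Longrightarrow> 0 \<le> \<rho> t x"
    and \<rho>_measurable: "\<And>t. t \<in> {0<..<1} \<Longrightarrow> \<rho> t \<in> borel_measurable borel"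
    and \<rho>_law: "\<And>t. t \<in> {0<..<1} \<Longrightarrow> density lborel (\<lambda>x. ennreal (\<rho> t x)) =
      distr (P0 \<Otimes>\<^sub>M std_gaussian) borel (\<lambda>(x, z). \<sigma> t *\<^sub>R x + (\<sigma> t * sqrt (a t)) *\<^sub>R z)"
begin

abbreviation \<phi> :: "real \<Rightarrow> 'a \<Rightarrow> real" where "\<phi> \<equiv> interp_density M \<eta> \<rho>"
abbreviation b :: "real \<Rightarrow> 'a \<Rightarrow> 'a" where "b \<equiv> drift M \<sigma> \<eta> \<rho>"

sublocale XM: pair_sigma_finite "lborel :: 'a measure" M ..

lemma slice_measurable:
  assumes t: "t \<in> {0<..<1}"
  shows "\<eta> t \<in> borel_measurable M" "V t \<in> borel_measurable M"
    "\<rho> t \<in> borel_measurable borel" "Y 0 t \<in> borel_measurable sample"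
proof -
  show *[measurable]: "\<eta> t \<in> borel_measurable M" "V t \<in> borel_measurable M" "\<rho> t \<in> borel_measurable borel"
    using t \<eta>_measurable V_measurable \<rho>_measurable by auto
  have [measurable]: "(\<lambda>q. snd (fst q)) \<in> borel_measurable sample"
    using measurable_compose[OF measurable_fst measurable_snd[of M P0], of "std_gaussian :: 'a measure"]
    by (simp add: measurable_cong_sets[OF refl sets_P0])
  show "Y 0 t \<in> borel_measurable sample" unfolding Y_def[abs_def] by measurable
qed

text \<open>
  Conditionally on \<open>\<eta>\<close>, the variable \<open>Y\<close> is the sum of a variable with density \<open>\<rho>\<close> and
  the fixed value of \<open>\<eta>\<close>; this determines the joint law of \<open>Y\<close> and the sample point \<open>\<omega>\<close>.
\<close>

lemma joint_density:
  assumes t: "t \<in> {0<..<1}"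
  shows "distr sample (lborel \<Otimes>\<^sub>M M) (\<lambda>q. (Y 0 t q, fst (fst q))) =
    density (lborel \<Otimes>\<^sub>M M) (\<lambda>p. ennreal (\<rho> t (fst p - \<eta> t (snd p))))"
proof (rule measure_eqI)
  note [measurable] = slice_measurable[OF t]
  fix S assume "S \<in> sets (distr sample (lborel \<Otimes>\<^sub>M M) (\<lambda>q. (Y 0 t q, fst (fst q))))"
  then have [measurable]: "S \<in> sets (lborel \<Otimes>\<^sub>M M)" by simp
  have [measurable]: "S \<in> sets (borel \<Otimes>\<^sub>M M)"
    using \<open>S \<in> sets (lborel \<Otimes>\<^sub>M M)\<close> by (simp cong: sets_pair_measure_cong)
  have shift: "(\<integral>\<^sup>+x. ennreal (\<rho> t (x - y)) * indicator S (x, \<omega>) \<partial>lborel) =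
      (\<integral>\<^sup>+p. indicator S (\<sigma> t *\<^sub>R fst p + (\<sigma> t * sqrt (a t)) *\<^sub>R snd p + y, \<omega>) \<partial>(P0 \<Otimes>\<^sub>M std_gaussian))"
    if [measurable]: "\<omega> \<in> space M" for y \<omega>
  proof -
    have "(\<integral>\<^sup>+x. ennreal (\<rho> t (x - y)) * indicator S (x, \<omega>) \<partial>lborel) =
        (\<integral>\<^sup>+x. ennreal (\<rho> t x) * indicator S (x + y, \<omega>) \<partial>lborel)"
      by (subst nn_integral_lborel_affine[of _ 1 y]) (auto simp: add.commute)
    also have "\<dots> = (\<integral>\<^sup>+x. indicator S (x + y, \<omega>) \<partial>density lborel (\<lambda>x. ennreal (\<rho> t x)))"
      by (subst nn_integral_density) auto
    also have "\<dots> = (\<integral>\<^sup>+p. indicator S (\<sigma> t *\<^sub>R fst p + (\<sigma> t * sqrt (a t)) *\<^sub>R snd p + y, \<omega>) \<partial>(P0 \<Otimes>\<^sub>M std_gaussian))"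
      unfolding \<rho>_law[OF t] by (subst nn_integral_distr) (auto simp: split_beta)
    finally show ?thesis .
  qed
  have "emeasure (density (lborel \<Otimes>\<^sub>M M) (\<lambda>p. ennreal (\<rho> t (fst p - \<eta> t (snd p))))) S =
      (\<integral>\<^sup>+p. ennreal (\<rho> t (fst p - \<eta> t (snd p))) * indicator S p \<partial>(lborel \<Otimes>\<^sub>M M))"
    by (rule emeasure_density) auto
  also have "\<dots> = (\<integral>\<^sup>+\<omega>. \<integral>\<^sup>+x. ennreal (\<rho> t (x - \<eta> t \<omega>)) * indicator S (x, \<omega>) \<partial>lborel \<partial>M)"
    by (subst XM.nn_integral_snd[symmetric]) auto
  also have "\<dots> = (\<integral>\<^sup>+\<omega>. \<integral>\<^sup>+p. indicator S (\<sigma> t *\<^sub>R fst p + (\<sigma> t * sqrt (a t)) *\<^sub>R snd p + \<eta> t \<omega>, \<omega>) \<partial>(P0 \<Otimes>\<^sub>M std_gaussian) \<partial>M)"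
    by (rule nn_integral_cong) (rule shift)
  also have "\<dots> = (\<integral>\<^sup>+\<omega>. \<integral>\<^sup>+x. \<integral>\<^sup>+z. indicator S (Y 0 t ((\<omega>, x), z), \<omega>) \<partial>std_gaussian \<partial>P0 \<partial>M)"
  proof (rule nn_integral_cong)
    fix \<omega> assume [measurable]: "\<omega> \<in> space M"
    show "(\<integral>\<^sup>+p. indicator S (\<sigma> t *\<^sub>R fst p + (\<sigma> t * sqrt (a t)) *\<^sub>R snd p + \<eta> t \<omega>, \<omega>) \<partial>(P0 \<Otimes>\<^sub>M std_gaussian)) =
        (\<integral>\<^sup>+x. \<integral>\<^sup>+z. indicator S (Y 0 t ((\<omega>, x), z), \<omega>) \<partial>std_gaussian \<partial>P0)"
      by (subst G.nn_integral_fst[symmetric]) (auto simp: Y_def add_ac)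
  qed
  also have "\<dots> = (\<integral>\<^sup>+r. \<integral>\<^sup>+z. indicator S (Y 0 t (r, z), fst r) \<partial>std_gaussian \<partial>base)"
    by (subst P0.nn_integral_fst[symmetric]) auto
  also have "\<dots> = (\<integral>\<^sup>+q. indicator S (Y 0 t q, fst (fst q)) \<partial>sample)"
    by (subst G.nn_integral_fst[symmetric]) auto
  also have "\<dots> = (\<integral>\<^sup>+s. indicator S s \<partial>distr sample (lborel \<Otimes>\<^sub>M M) (\<lambda>q. (Y 0 t q, fst (fst q))))"
    by (subst nn_integral_distr) auto
  finally show "emeasure (distr sample (lborel \<Otimes>\<^sub>M M) (\<lambda>q. (Y 0 t q, fst (fst q)))) S =
      emeasure (density (lborel \<Otimes>\<^sub>M M) (\<lambda>p. ennreal (\<rho> t (fst p - \<eta> t (snd p))))) S"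
    by simp
qed simp

lemma integral_joint_density:
  fixes H :: "'a \<times> 'w \<Rightarrow> 'c::{banach, second_countable_topology}"
  assumes t: "t \<in> {0<..<1}" and H[measurable]: "H \<in> borel_measurable (borel \<Otimes>\<^sub>M M)"
  shows "integrable (lborel \<Otimes>\<^sub>M M) (\<lambda>p. \<rho> t (fst p - \<eta> t (snd p)) *\<^sub>R H p) \<longleftrightarrow>
      integrable sample (\<lambda>q. H (Y 0 t q, fst (fst q)))"
    and "(\<integral>p. \<rho> t (fst p - \<eta> t (snd p)) *\<^sub>R H p \<partial>(lborel \<Otimes>\<^sub>M M)) = (\<integral>q. H (Y 0 t q, fst (fst q)) \<partial>sample)"
proof -
  note [measurable] = slice_measurable[OF t]
  have [measurable]: "H \<in> borel_measurable (lborel \<Otimes>\<^sub>M M)"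
    using H by (simp cong: measurable_cong_sets sets_pair_measure_cong)
  have m: "(\<lambda>q. (Y 0 t q, fst (fst q))) \<in> measurable sample (lborel \<Otimes>\<^sub>M M)" by measurable
  have "integrable (lborel \<Otimes>\<^sub>M M) (\<lambda>p. \<rho> t (fst p - \<eta> t (snd p)) *\<^sub>R H p) \<longleftrightarrow>
      integrable (density (lborel \<Otimes>\<^sub>M M) (\<lambda>p. ennreal (\<rho> t (fst p - \<eta> t (snd p))))) H"
    using \<rho>_nonneg[OF t] by (subst integrable_density) auto
  then show "integrable (lborel \<Otimes>\<^sub>M M) (\<lambda>p. \<rho> t (fst p - \<eta> t (snd p)) *\<^sub>R H p) \<longleftrightarrow>
      integrable sample (\<lambda>q. H (Y 0 t q, fst (fst q)))"
    unfolding joint_density[OF t, symmetric] by (subst (asm) integrable_distr_eq[OF m]) auto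
  have "(\<integral>p. \<rho> t (fst p - \<eta> t (snd p)) *\<^sub>R H p \<partial>(lborel \<Otimes>\<^sub>M M)) =
      (\<integral>p. H p \<partial>density (lborel \<Otimes>\<^sub>M M) (\<lambda>p. ennreal (\<rho> t (fst p - \<eta> t (snd p)))))"
    using \<rho>_nonneg[OF t] by (subst integral_density) auto
  also have "\<dots> = (\<integral>q. H (Y 0 t q, fst (fst q)) \<partial>sample)"
    unfolding joint_density[OF t, symmetric] by (subst integral_distr[OF m]) auto
  finally show "(\<integral>p. \<rho> t (fst p - \<eta> t (snd p)) *\<^sub>R H p \<partial>(lborel \<Otimes>\<^sub>M M)) = (\<integral>q. H (Y 0 t q, fst (fst q)) \<partial>sample)" .
qed

lemma integrable_joint_density:
  assumes t: "t \<in> {0<..<1}"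
  shows "integrable (lborel \<Otimes>\<^sub>M M) (\<lambda>p. \<rho> t (fst p - \<eta> t (snd p)))"
  using integral_joint_density(1)[OF t, of "\<lambda>_. 1 :: real"] by simp

lemma AE_integrable_\<rho>:
  assumes t: "t \<in> {0<..<1}"
  shows "AE x in lborel. integrable M (\<lambda>\<omega>. \<rho> t (x - \<eta> t \<omega>))"
  using XM.AE_integrable_fst'[OF integrable_joint_density[OF t]] by simp

lemma \<phi>_nonneg: "t \<in> {0<..<1} \<Longrightarrow> 0 \<le> \<phi> t x"
  unfolding interp_density_def by (intro integral_nonneg_AE) (simp add: \<rho>_nonneg)

lemma \<phi>_measurable [measurable]:
  assumes t: "t \<in> {0<..<1}"
  shows "\<phi> t \<in> borel_measurable borel"
proof -
  note [measurable] = slice_measurable[OF t]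
  show ?thesis unfolding interp_density_def by measurable
qed

lemma density_\<phi>:
  assumes t: "t \<in> {0<..<1}"
  shows "density lborel (\<lambda>x. ennreal (\<phi> t x)) = distr sample lborel (Y 0 t)"
proof (rule measure_eqI)
  note [measurable] = slice_measurable[OF t] \<phi>_measurable[OF t]
  fix S assume "S \<in> sets (density lborel (\<lambda>x. ennreal (\<phi> t x)))"
  then have [measurable]: "S \<in> sets borel" by simp
  have "emeasure (density lborel (\<lambda>x. ennreal (\<phi> t x))) S = (\<integral>\<^sup>+x. ennreal (\<phi> t x) * indicator S x \<partial>lborel)"
    by (rule emeasure_density) auto
  also have "\<dots> = (\<integral>\<^sup>+x. (\<integral>\<^sup>+\<omega>. ennreal (\<rho> t (x - \<eta> t \<omega>)) \<partial>M) * indicator S x \<partial>lborel)"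
  proof (rule nn_integral_cong_AE)
    show "AE x in lborel. ennreal (\<phi> t x) * indicator S x = (\<integral>\<^sup>+\<omega>. ennreal (\<rho> t (x - \<eta> t \<omega>)) \<partial>M) * indicator S x"
      using AE_integrable_\<rho>[OF t]
      by eventually_elim (simp add: interp_density_def nn_integral_eq_integral \<rho>_nonneg[OF t])
  qed
  also have "\<dots> = (\<integral>\<^sup>+x. \<integral>\<^sup>+\<omega>. ennreal (\<rho> t (x - \<eta> t \<omega>)) * indicator (S \<times> space M) (x, \<omega>) \<partial>M \<partial>lborel)"
  proof (rule nn_integral_cong)
    fix x :: 'a
    have "(\<integral>\<^sup>+\<omega>. ennreal (\<rho> t (x - \<eta> t \<omega>)) * indicator (S \<times> space M) (x, \<omega>) \<partial>M) =
        (\<integral>\<^sup>+\<omega>. ennreal (\<rho> t (x - \<eta> t \<omega>)) * indicator S x \<partial>M)"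
      by (rule nn_integral_cong) (simp add: indicator_def)
    also have "\<dots> = (\<integral>\<^sup>+\<omega>. ennreal (\<rho> t (x - \<eta> t \<omega>)) \<partial>M) * indicator S x"
      by (rule nn_integral_multc) measurable
    finally show "(\<integral>\<^sup>+\<omega>. ennreal (\<rho> t (x - \<eta> t \<omega>)) \<partial>M) * indicator S x =
        (\<integral>\<^sup>+\<omega>. ennreal (\<rho> t (x - \<eta> t \<omega>)) * indicator (S \<times> space M) (x, \<omega>) \<partial>M)" ..
  qed
  also have "\<dots> = (\<integral>\<^sup>+p. ennreal (\<rho> t (fst p - \<eta> t (snd p))) * indicator (S \<times> space M) p \<partial>(lborel \<Otimes>\<^sub>M M))"
    by (subst M.nn_integral_fst[symmetric]) auto
  also have "\<dots> = emeasure (distr sample (lborel \<Otimes>\<^sub>M M) (\<lambda>q. (Y 0 t q, fst (fst q)))) (S \<times> space M)"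
    unfolding joint_density[OF t] by (rule emeasure_density[symmetric]) auto
  also have "\<dots> = emeasure (distr sample lborel (Y 0 t)) S"
    by (subst (1 2) emeasure_distr)
       (auto intro!: arg_cong[where f = "emeasure sample"] simp: space_pair_measure)
  finally show "emeasure (density lborel (\<lambda>x. ennreal (\<phi> t x))) S = emeasure (distr sample lborel (Y 0 t)) S" .
qed simp

lemma integrable_\<phi>:
  assumes t: "t \<in> {0<..<1}"
  shows "(\<integral>\<^sup>+x. ennreal (\<phi> t x) \<partial>lborel) = 1" and "integrable lborel (\<phi> t)"
proof -
  note [measurable] = slice_measurable[OF t] \<phi>_measurable[OF t]
  have "(\<integral>\<^sup>+x. ennreal (\<phi> t x) \<partial>lborel) = emeasure (density lborel (\<lambda>x. ennreal (\<phi> t x))) UNIV"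
    by (simp add: emeasure_density)
  also have "\<dots> = 1"
    unfolding density_\<phi>[OF t] by (subst emeasure_distr) (auto simp: sample.P.emeasure_space_1)
  finally show *: "(\<integral>\<^sup>+x. ennreal (\<phi> t x) \<partial>lborel) = 1" .
  show "integrable lborel (\<phi> t)"
    by (rule integrableI_nonneg) (use * \<phi>_nonneg[OF t] in auto)
qed

lemma integral_\<phi>:
  assumes t: "t \<in> {0<..<1}" and [measurable]: "g \<in> borel_measurable borel"
  shows "(\<integral>x. \<phi> t x * g x \<partial>lborel) = (\<integral>q. g (Y 0 t q) \<partial>sample :: real)"
proof -
  note [measurable] = slice_measurable[OF t] \<phi>_measurable[OF t]
  have "(\<integral>x. \<phi> t x * g x \<partial>lborel) = (\<integral>x. g x \<partial>density lborel (\<lambda>x. ennreal (\<phi> t x)))"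
    using \<phi>_nonneg[OF t] by (subst integral_density) auto
  also have "\<dots> = (\<integral>q. g (Y 0 t q) \<partial>sample)"
    unfolding density_\<phi>[OF t] by (subst integral_distr) auto
  finally show ?thesis .
qed

end

section \<open>The Fokker--Planck equation for the interpolated density\<close>

context interpolation_density
begin

text \<open>
  The numerator of the second summand of the drift.
\<close>

definition flux :: "real \<Rightarrow> 'a \<Rightarrow> 'a" where
  "flux t x = (\<integral>\<omega>. \<rho> t (x - \<eta> t \<omega>) *\<^sub>R V t \<omega> \<partial>M)"

lemma \<phi>_drift:
  "\<phi> t x *\<^sub>R b t x = (\<phi> t x * log_deriv \<sigma> t) *\<^sub>R x + (if \<phi> t x = 0 then 0 else flux t x)"
  by (simp add: drift_def flux_def scaleR_add_right)

lemma flux_measurable: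
  assumes t: "t \<in> {0<..<1}"
  shows "flux t \<in> borel_measurable borel"
proof -
  note [measurable] = slice_measurable[OF t]
  show ?thesis unfolding flux_def[abs_def] by measurable
qed

lemma \<phi>_drift_measurable:
  assumes t: "t \<in> {0<..<1}"
  shows "(\<lambda>x. \<phi> t x *\<^sub>R b t x) \<in> borel_measurable borel"
proof -
  note [measurable] = flux_measurable[OF t] \<phi>_measurable[OF t]
  show ?thesis unfolding \<phi>_drift by measurable
qed

lemma nn_integral_flux_le:
  assumes t: "t \<in> {0<..<1}"
  shows "(\<integral>\<^sup>+x. ennreal (norm (flux t x)) \<partial>lborel) \<le> drift_mean t"
proof -
  note [measurable] = slice_measurable[OF t]
  have "(\<integral>\<^sup>+x. ennreal (norm (flux t x)) \<partial>lborel) \<le>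
      (\<integral>\<^sup>+x. \<integral>\<^sup>+\<omega>. ennreal (\<rho> t (x - \<eta> t \<omega>)) * ennreal (norm (V t \<omega>)) \<partial>M \<partial>lborel)"
  proof (rule nn_integral_mono)
    fix x :: 'a
    have "ennreal (norm (flux t x)) \<le> (\<integral>\<^sup>+\<omega>. ennreal (norm (\<rho> t (x - \<eta> t \<omega>) *\<^sub>R V t \<omega>)) \<partial>M)"
    proof (cases "integrable M (\<lambda>\<omega>. \<rho> t (x - \<eta> t \<omega>) *\<^sub>R V t \<omega>)")
      case True
      then show ?thesis unfolding flux_def by (rule integral_norm_bound_ennreal)
    next
      case False
      then show ?thesis unfolding flux_def by (simp add: not_integrable_integral_eq)
    qed
    also have "\<dots> = (\<integral>\<^sup>+\<omega>. ennreal (\<rho> t (x - \<eta> t \<omega>)) * ennreal (norm (V t \<omega>)) \<partial>M)"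
      by (simp add: \<rho>_nonneg[OF t] ennreal_mult)
    finally show "ennreal (norm (flux t x)) \<le> (\<integral>\<^sup>+\<omega>. ennreal (\<rho> t (x - \<eta> t \<omega>)) * ennreal (norm (V t \<omega>)) \<partial>M)" .
  qed
  also have "\<dots> = (\<integral>\<^sup>+p. ennreal (\<rho> t (fst p - \<eta> t (snd p))) * ennreal (norm (V t (snd p))) \<partial>(lborel \<Otimes>\<^sub>M M))"
    by (subst M.nn_integral_fst[symmetric]) auto
  also have "\<dots> = (\<integral>\<^sup>+p. ennreal (norm (V t (snd p))) \<partial>distr sample (lborel \<Otimes>\<^sub>M M) (\<lambda>q. (Y 0 t q, fst (fst q))))"
    unfolding joint_density[OF t] by (subst nn_integral_density) auto
  also have "\<dots> = (\<integral>\<^sup>+q. ennreal (norm (V t (fst (fst q)))) \<partial>sample)"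
    by (subst nn_integral_distr) auto
  also have "\<dots> = drift_mean t"
    by (rule nn_integral_sample_fst) measurable
  finally show ?thesis .
qed

text \<open>
  Restricting to a bounded set controls the part of the drift that is linear in \<open>x\<close>; the law of \<open>Y\<close>
  need not have a first moment.
\<close>

lemma nn_integral_\<phi>_drift_le:
  assumes t: "t \<in> {0<..<1}" and [measurable]: "S \<in> sets borel" and S: "\<And>x. x \<in> S \<Longrightarrow> norm x \<le> R"
    and R: "0 \<le> R"
  shows "(\<integral>\<^sup>+x. ennreal (norm (\<phi> t x *\<^sub>R b t x)) * indicator S x \<partial>lborel) \<le>
    ennreal (\<bar>log_deriv \<sigma> t\<bar> * R) + drift_mean t"
proof -
  note [measurable] = flux_measurable[OF t] \<phi>_measurable[OF t]
  have "(\<integral>\<^sup>+x. ennreal (norm (\<phi> t x *\<^sub>R b t x)) * indicator S x \<partial>lborel) \<le>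
      (\<integral>\<^sup>+x. ennreal (\<bar>log_deriv \<sigma> t\<bar> * R) * ennreal (\<phi> t x) + ennreal (norm (flux t x)) \<partial>lborel)"
  proof (rule nn_integral_mono)
    fix x :: 'a
    show "ennreal (norm (\<phi> t x *\<^sub>R b t x)) * indicator S x \<le>
        ennreal (\<bar>log_deriv \<sigma> t\<bar> * R) * ennreal (\<phi> t x) + ennreal (norm (flux t x))"
    proof (cases "x \<in> S")
      case True
      have "norm (\<phi> t x *\<^sub>R b t x) \<le> norm ((\<phi> t x * log_deriv \<sigma> t) *\<^sub>R x) + norm (if \<phi> t x = 0 then 0 else flux t x)"
        unfolding \<phi>_drift by (rule norm_triangle_ineq)
      also have "norm ((\<phi> t x * log_deriv \<sigma> t) *\<^sub>R x) \<le> (\<bar>log_deriv \<sigma> t\<bar> * R) * \<phi> t x"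
      proof -
        have "(\<phi> t x * \<bar>log_deriv \<sigma> t\<bar>) * norm x \<le> (\<phi> t x * \<bar>log_deriv \<sigma> t\<bar>) * R"
          by (intro mult_left_mono S[OF True] mult_nonneg_nonneg \<phi>_nonneg[OF t]) auto
        then show ?thesis using \<phi>_nonneg[OF t, of x] by (simp add: abs_mult mult_ac)
      qed
      also have "norm (if \<phi> t x = 0 then 0 else flux t x) \<le> norm (flux t x)" by simp
      finally have "norm (\<phi> t x *\<^sub>R b t x) \<le> (\<bar>log_deriv \<sigma> t\<bar> * R) * \<phi> t x + norm (flux t x)" by simp
      then have "ennreal (norm (\<phi> t x *\<^sub>R b t x)) \<le> ennreal ((\<bar>log_deriv \<sigma> t\<bar> * R) * \<phi> t x + norm (flux t x))"
        by (rule ennreal_leI)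
      then show ?thesis
        using True R \<phi>_nonneg[OF t, of x] by (simp add: ennreal_mult)
    qed simp
  qed
  also have "\<dots> = ennreal (\<bar>log_deriv \<sigma> t\<bar> * R) * (\<integral>\<^sup>+x. ennreal (\<phi> t x) \<partial>lborel) + (\<integral>\<^sup>+x. ennreal (norm (flux t x)) \<partial>lborel)"
    by (subst nn_integral_add) (auto simp: nn_integral_cmult)
  also have "\<dots> \<le> ennreal (\<bar>log_deriv \<sigma> t\<bar> * R) + drift_mean t"
    using nn_integral_flux_le[OF t] by (simp add: integrable_\<phi>(1)[OF t] add_left_mono)
  finally show ?thesis .
qed

lemma drift_norm_measurable:
  "drift_mean \<in> borel_measurable unit_time"
proof (rule M.borel_measurable_nn_integral)
  show "(\<lambda>(t, \<omega>). ennreal (norm (V t \<omega>))) \<in> borel_measurable (unit_time \<Otimes>\<^sub>M M)"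
    unfolding case_prod_unfold using V_joint by measurable
qed

lemma indicator_measurable [measurable]: "indicator {..T} \<in> borel_measurable unit_time"
  by (intro measurable_restrict_space1) simp

lemma drift_norm_finite:
  assumes "T \<in> {0<..<1}"
  shows "(\<integral>\<^sup>+t. drift_mean t * indicator {..T} t \<partial>unit_time) < \<infinity>"
proof -
  have "(\<integral>\<^sup>+t. drift_mean t * indicator {..T} t \<partial>unit_time) =
      (\<integral>\<^sup>+t. drift_mean t * indicator {..T} t * indicator {0<..<1} t \<partial>lborel)"
    by (subst nn_integral_restrict_space) auto
  also have "\<dots> \<le> (\<integral>\<^sup>+t\<in>{0..T}. drift_mean t \<partial>lborel)"
    by (intro nn_integral_mono) (auto simp: indicator_def)
  also have "\<dots> < \<infinity>" by (rule drift_bound[OF assms])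
  finally show ?thesis .
qed

lemma AE_drift_norm_finite:
  assumes "T \<in> {0<..<1}"
  shows "AE t in unit_time. t \<le> T \<longrightarrow> drift_mean t < \<infinity>"
proof -
  note [measurable] = drift_norm_measurable
  have "AE t in unit_time. drift_mean t * indicator {..T} t \<noteq> \<infinity>"
    by (rule nn_integral_PInf_AE) (use drift_norm_finite[OF assms] in auto)
  then show ?thesis
    by eventually_elim (auto simp: less_top indicator_def)
qed

lemma loc_integrable_\<phi>: "loc_integrable \<phi>"
  unfolding loc_integrable_def
proof (intro allI impI conjI)
  fix K :: "(real \<times> 'a) set" assume K: "compact K" "K \<subseteq> {0<..<1} \<times> UNIV"
  have sec: "{x. (t, x) \<in> K} \<in> sets lborel" for t
  proof -
    have "closed ((\<lambda>x. (t, x)) -` K)"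
      by (intro closed_vimage compact_imp_closed[OF K(1)] continuous_intros)
    then show ?thesis by (simp add: vimage_def)
  qed
  have empty: "{x. (t, x) \<in> K} = {}" if "t \<notin> {0<..<1}" for t using that K by auto
  show "AE t in lborel. set_integrable lborel {x. (t, x) \<in> K} (\<phi> t)"
  proof (rule AE_I2)
    fix t
    show "set_integrable lborel {x. (t, x) \<in> K} (\<phi> t)"
    proof (cases "t \<in> {0<..<1}")
      case True
      then show ?thesis unfolding set_integrable_def
        by (intro integrable_mult_indicator sec integrable_\<phi>)
    qed (simp add: set_integrable_def empty)
  qed
  have "(\<integral>\<^sup>+t. (\<integral>\<^sup>+x. ennreal (norm (\<phi> t x)) * indicator K (t, x) \<partial>lborel) \<partial>lborel) \<le>
      (\<integral>\<^sup>+t. indicator {0<..<1 :: real} t \<partial>lborel)"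
  proof (rule nn_integral_mono)
    fix t :: real
    show "(\<integral>\<^sup>+x. ennreal (norm (\<phi> t x)) * indicator K (t, x) \<partial>lborel) \<le> indicator {0<..<1} t"
    proof (cases "t \<in> {0<..<1}")
      case True
      have "(\<integral>\<^sup>+x. ennreal (norm (\<phi> t x)) * indicator K (t, x) \<partial>lborel) \<le> (\<integral>\<^sup>+x. ennreal (\<phi> t x) \<partial>lborel)"
        by (intro nn_integral_mono) (simp add: indicator_def \<phi>_nonneg[OF True])
      then show ?thesis using True by (simp add: integrable_\<phi>(1)[OF True])
    next
      case False
      then have "(t, x) \<notin> K" for x using empty[OF False] by auto
      then show ?thesis by simp
    qed
  qed
  also have "\<dots> < \<infinity>" by simp
  finally show "(\<integral>\<^sup>+t. (\<integral>\<^sup>+x. ennreal (norm (\<phi> t x)) * indicator K (t, x) \<partial>lborel) \<partial>lborel) < \<infinity>" .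
qed

lemma loc_integrable_\<phi>_drift: "loc_integrable (\<lambda>t x. \<phi> t x *\<^sub>R b t x)"
  unfolding loc_integrable_def
proof (intro allI impI conjI)
  fix K :: "(real \<times> 'a) set" assume K: "compact K" "K \<subseteq> {0<..<1} \<times> UNIV"
  obtain \<delta> T R where box: "0 < \<delta>" "\<delta> < T" "T < 1" "0 \<le> R"
    "\<And>t x. (t, x) \<in> K \<Longrightarrow> \<delta> < t \<and> t < T \<and> norm x \<le> R"
    using compact_time_box[OF K] by blast
  have T: "T \<in> {0<..<1}" using box by simp
  have sec[measurable]: "{x. (t, x) \<in> K} \<in> sets borel" for t
  proof -
    have "closed ((\<lambda>x. (t, x)) -` K)"
      by (intro closed_vimage compact_imp_closed[OF K(1)] continuous_intros)
    then show ?thesis by (simp add: vimage_def)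
  qed
  have empty: "{x. (t, x) \<in> K} = {}" if "t \<notin> {\<delta>..T}" for t
    using that box(5)[of t] by force
  have ind: "indicator K (t, x) = indicator {x. (t, x) \<in> K} x" for t :: real and x :: 'a
    by (simp add: indicator_def)
  have slice: "(\<integral>\<^sup>+x. ennreal (norm (\<phi> t x *\<^sub>R b t x)) * indicator K (t, x) \<partial>lborel) \<le>
      ennreal (\<bar>log_deriv \<sigma> t\<bar> * R) + drift_mean t" if "t \<in> {\<delta>..T}" for t
    unfolding ind by (rule nn_integral_\<phi>_drift_le) (use that box in auto)
  have "AE t in lborel. t \<in> {0<..<1} \<longrightarrow> t \<le> T \<longrightarrow> drift_mean t < \<infinity>"
    using AE_drift_norm_finite[OF T] by (subst (asm) AE_restrict_space_iff) auto
  then show "AE t in lborel. set_integrable lborel {x. (t, x) \<in> K} (\<lambda>x. \<phi> t x *\<^sub>R b t x)"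
  proof eventually_elim
    case (elim t)
    show ?case
    proof (cases "t \<in> {\<delta>..T}")
      case True
      then have t: "t \<in> {0<..<1}" using box by auto
      note [measurable] = \<phi>_drift_measurable[OF t]
      have "(\<integral>\<^sup>+x. ennreal (norm (indicator {x. (t, x) \<in> K} x *\<^sub>R (\<phi> t x *\<^sub>R b t x))) \<partial>lborel) =
          (\<integral>\<^sup>+x. ennreal (norm (\<phi> t x *\<^sub>R b t x)) * indicator K (t, x) \<partial>lborel)"
        by (intro nn_integral_cong) (simp add: indicator_def)
      also have "\<dots> \<le> ennreal (\<bar>log_deriv \<sigma> t\<bar> * R) + drift_mean t"
        by (rule slice[OF True])
      also have "\<dots> < \<infinity>" using elim t True by simp
      finally show ?thesis unfolding set_integrable_def
        by (intro integrableI_bounded) measurable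
    qed (simp add: set_integrable_def empty)
  qed
  have "bounded (log_deriv \<sigma> ` {\<delta>..T})"
    by (intro compact_imp_bounded compact_continuous_image continuous_on_subset[OF cont_ld]) (use box in auto)
  then obtain C where C: "\<And>t. t \<in> {\<delta>..T} \<Longrightarrow> \<bar>log_deriv \<sigma> t\<bar> \<le> C"
    unfolding bounded_iff by (metis imageI real_norm_def)
  note [measurable] = drift_norm_measurable
  have "(\<integral>\<^sup>+t. (\<integral>\<^sup>+x. ennreal (norm (\<phi> t x *\<^sub>R b t x)) * indicator K (t, x) \<partial>lborel) \<partial>lborel) \<le>
      (\<integral>\<^sup>+t. (ennreal (C * R) + drift_mean t * indicator {..T} t) * indicator {0<..<1} t \<partial>lborel)"
  proof (rule nn_integral_mono)
    fix t :: real
    show "(\<integral>\<^sup>+x. ennreal (norm (\<phi> t x *\<^sub>R b t x)) * indicator K (t, x) \<partial>lborel) \<le>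
        (ennreal (C * R) + drift_mean t * indicator {..T} t) * indicator {0<..<1} t"
    proof (cases "t \<in> {\<delta>..T}")
      case True
      have "ennreal (\<bar>log_deriv \<sigma> t\<bar> * R) \<le> ennreal (C * R)"
        by (intro ennreal_leI mult_right_mono C True box)
      then show ?thesis using True box slice[OF True] by (auto intro: order.trans add_right_mono)
    next
      case False
      then have "(t, x) \<notin> K" for x using empty[OF False] by auto
      then show ?thesis by simp
    qed
  qed
  also have "\<dots> = (\<integral>\<^sup>+t. ennreal (C * R) + drift_mean t * indicator {..T} t \<partial>unit_time)"
    by (subst nn_integral_restrict_space) auto
  also have "\<dots> = ennreal (C * R) + (\<integral>\<^sup>+t. drift_mean t * indicator {..T} t \<partial>unit_time)"
    by (subst nn_integral_add) (auto simp: L.emeasure_space_1[simplified])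
  also have "\<dots> < \<infinity>" using drift_norm_finite[OF T] by simp
  finally show "(\<integral>\<^sup>+t. (\<integral>\<^sup>+x. ennreal (norm (\<phi> t x *\<^sub>R b t x)) * indicator K (t, x) \<partial>lborel) \<partial>lborel) < \<infinity>" .
qed

text \<open>
  For almost every \<open>x\<close> the expectations are finite; if then \<open>\<phi> t x = 0\<close>, the integrand
  \<open>\<rho> t (x - \<eta> t)\<close> vanishes almost surely and so does the flux. Hence dividing by \<open>\<phi>\<close> and multiplying
  by it again changes the flux only on a null set.
\<close>

lemma integral_\<phi>_drift:
  assumes t: "t \<in> {0<..<1}" and fin: "drift_mean t < \<infinity>"
    and G[measurable]: "G \<in> borel_measurable borel" and B: "\<And>x. norm (G x) \<le> B" "0 \<le> B"
    and R: "\<And>x. R < norm x \<Longrightarrow> G x = 0" "0 \<le> R"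
  shows "(\<integral>x. (\<phi> t x *\<^sub>R b t x) \<bullet> G x \<partial>lborel) =
    (\<integral>q. (log_deriv \<sigma> t *\<^sub>R Y 0 t q + V t (fst (fst q))) \<bullet> G (Y 0 t q) \<partial>sample)"
proof -
  note [measurable] = slice_measurable[OF t]
  define H where "H p = (log_deriv \<sigma> t *\<^sub>R fst p + V t (snd p)) \<bullet> G (fst p)" for p :: "'a \<times> 'w"
  have [measurable]: "H \<in> borel_measurable (borel \<Otimes>\<^sub>M M)" unfolding H_def by measurable
  have intV: "integrable sample (\<lambda>q. V t (fst (fst q)))"
  proof (rule integrableI_bounded)
    show "(\<integral>\<^sup>+q. ennreal (norm (V t (fst (fst q)))) \<partial>sample) < \<infinity>"
      using nn_integral_sample_fst[of "\<lambda>\<omega>. ennreal (norm (V t \<omega>))"] fin by simp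
  qed measurable
  have H_bound: "norm (H p) \<le> B * (\<bar>log_deriv \<sigma> t\<bar> * R + norm (V t (snd p)))" for p
  proof (cases "R < norm (fst p)")
    case False
    have "norm (H p) \<le> norm (log_deriv \<sigma> t *\<^sub>R fst p + V t (snd p)) * norm (G (fst p))"
      unfolding H_def by (simp add: Cauchy_Schwarz_ineq2)
    also have "\<dots> \<le> (\<bar>log_deriv \<sigma> t\<bar> * R + norm (V t (snd p))) * B"
    proof (rule mult_mono)
      show "norm (log_deriv \<sigma> t *\<^sub>R fst p + V t (snd p)) \<le> \<bar>log_deriv \<sigma> t\<bar> * R + norm (V t (snd p))"
        by (rule norm_triangle_le) (use False in \<open>simp add: mult_left_mono\<close>)
    qed (use B R in auto)
    finally show ?thesis by (simp add: mult.commute)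
  qed (use R B in \<open>simp add: H_def\<close>)
  have intH: "integrable sample (\<lambda>q. H (Y 0 t q, fst (fst q)))"
  proof (rule Bochner_Integration.integrable_bound)
    show "integrable sample (\<lambda>q. B * (\<bar>log_deriv \<sigma> t\<bar> * R + norm (V t (fst (fst q)))))"
      by (intro integrable_mult_right Bochner_Integration.integrable_add sample.P.integrable_const integrable_norm intV)
    show "AE q in sample. norm (H (Y 0 t q, fst (fst q))) \<le> norm (B * (\<bar>log_deriv \<sigma> t\<bar> * R + norm (V t (fst (fst q)))))"
    proof (rule AE_I2)
      fix q
      show "norm (H (Y 0 t q, fst (fst q))) \<le> norm (B * (\<bar>log_deriv \<sigma> t\<bar> * R + norm (V t (fst (fst q)))))"
        using order.trans[OF H_bound[of "(Y 0 t q, fst (fst q))"] abs_ge_self] by (simp only: real_norm_def snd_conv)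
    qed
  qed measurable
  have intH': "integrable (lborel \<Otimes>\<^sub>M M) (\<lambda>p. \<rho> t (fst p - \<eta> t (snd p)) *\<^sub>R H p)"
    using integral_joint_density(1)[OF t, of H] intH by simp
  have intV': "integrable (lborel \<Otimes>\<^sub>M M) (\<lambda>p. \<rho> t (fst p - \<eta> t (snd p)) *\<^sub>R V t (snd p))"
    using integral_joint_density(1)[OF t, of "\<lambda>p. V t (snd p)"] intV by simp
  have AE: "AE x in lborel. (\<phi> t x *\<^sub>R b t x) \<bullet> G x = (\<integral>\<omega>. \<rho> t (x - \<eta> t \<omega>) *\<^sub>R H (x, \<omega>) \<partial>M)"
    using AE_integrable_\<rho>[OF t] XM.AE_integrable_fst'[OF intV']
  proof eventually_elim
    case (elim x)
    then have i1: "integrable M (\<lambda>\<omega>. \<rho> t (x - \<eta> t \<omega>))" and i2: "integrable M (\<lambda>\<omega>. \<rho> t (x - \<eta> t \<omega>) *\<^sub>R V t \<omega>)"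
      by simp_all
    have flux0: "flux t x = 0" if "\<phi> t x = 0"
    proof -
      have "AE \<omega> in M. \<rho> t (x - \<eta> t \<omega>) = 0"
        using that integral_nonneg_eq_0_iff_AE[OF i1] \<rho>_nonneg[OF t] by (simp add: interp_density_def)
      then have "AE \<omega> in M. \<rho> t (x - \<eta> t \<omega>) *\<^sub>R V t \<omega> = 0" by eventually_elim simp
      then show ?thesis unfolding flux_def by (rule integral_eq_zero_AE)
    qed
    have i3: "integrable M (\<lambda>\<omega>. \<rho> t (x - \<eta> t \<omega>) *\<^sub>R (log_deriv \<sigma> t *\<^sub>R x))"
      by (rule integrable_scaleR_left) (rule i1)
    have "(\<integral>\<omega>. \<rho> t (x - \<eta> t \<omega>) *\<^sub>R H (x, \<omega>) \<partial>M) =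
        (\<integral>\<omega>. (\<rho> t (x - \<eta> t \<omega>) *\<^sub>R (log_deriv \<sigma> t *\<^sub>R x) + \<rho> t (x - \<eta> t \<omega>) *\<^sub>R V t \<omega>) \<bullet> G x \<partial>M)"
      by (simp add: H_def inner_add_left algebra_simps)
    also have "\<dots> = (\<integral>\<omega>. \<rho> t (x - \<eta> t \<omega>) *\<^sub>R (log_deriv \<sigma> t *\<^sub>R x) + \<rho> t (x - \<eta> t \<omega>) *\<^sub>R V t \<omega> \<partial>M) \<bullet> G x"
      by (rule integral_inner_left) (intro Bochner_Integration.integrable_add i2 i3)
    also have "(\<integral>\<omega>. \<rho> t (x - \<eta> t \<omega>) *\<^sub>R (log_deriv \<sigma> t *\<^sub>R x) + \<rho> t (x - \<eta> t \<omega>) *\<^sub>R V t \<omega> \<partial>M) =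
        \<phi> t x *\<^sub>R (log_deriv \<sigma> t *\<^sub>R x) + flux t x"
      unfolding Bochner_Integration.integral_add[OF i3 i2] flux_def[symmetric] interp_density_def
      by (subst integral_scaleR_left) (simp_all add: i1)
    also have "\<dots> = \<phi> t x *\<^sub>R b t x"
      unfolding \<phi>_drift using flux0 by simp
    finally show ?case ..
  qed
  have "(\<integral>x. (\<phi> t x *\<^sub>R b t x) \<bullet> G x \<partial>lborel) = (\<integral>x. \<integral>\<omega>. \<rho> t (x - \<eta> t \<omega>) *\<^sub>R H (x, \<omega>) \<partial>M \<partial>lborel)"
  proof (rule integral_cong_AE[OF _ _ AE])
    show "(\<lambda>x. (\<phi> t x *\<^sub>R b t x) \<bullet> G x) \<in> borel_measurable lborel"
      using \<phi>_drift_measurable[OF t] by measurable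
    show "(\<lambda>x. \<integral>\<omega>. \<rho> t (x - \<eta> t \<omega>) *\<^sub>R H (x, \<omega>) \<partial>M) \<in> borel_measurable lborel"
      using borel_measurable_integrable[OF XM.integrable_fst'[OF intH']] by simp
  qed
  also have "\<dots> = (\<integral>p. \<rho> t (fst p - \<eta> t (snd p)) *\<^sub>R H p \<partial>(lborel \<Otimes>\<^sub>M M))"
    using XM.integral_fst'[OF intH'] by simp
  also have "\<dots> = (\<integral>q. H (Y 0 t q, fst (fst q)) \<partial>sample)"
    by (rule integral_joint_density(2)[OF t]) measurable
  finally show ?thesis by (simp add: H_def)
qed

text \<open>
  Each of the three integrals is rewritten as an expectation over the explicit interpolation, where
  the weak equation is available. For times after \<open>T\<close> the flux integral vanishes with the test
  function, and up to \<open>T\<close> the mean of \<open>norm (V t)\<close> is finite at almost every time.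
\<close>

theorem fokker_planck: "fokker_planck_distr D b \<phi>"
  unfolding fokker_planck_distr_def
proof (intro conjI allI impI)
  show "loc_integrable \<phi>" by (rule loc_integrable_\<phi>)
  show "loc_integrable (\<lambda>t x. \<phi> t x *\<^sub>R b t x)" by (rule loc_integrable_\<phi>_drift)
  fix \<psi> :: "real \<times> 'a \<Rightarrow> real" assume \<psi>: "test_function \<psi>"
  obtain \<delta> T R where box: "0 < \<delta>" "\<delta> < T" "T < 1" "0 \<le> R"
    "\<And>t x. (t, x) \<in> closure {z. \<psi> z \<noteq> 0} \<Longrightarrow> \<delta> < t \<and> t < T \<and> norm x \<le> R"
    using compact_time_box[of "closure {z. \<psi> z \<noteq> 0}"] \<psi> unfolding test_function_def by blast
  interpret tested_interpolation M P0 \<sigma> a \<eta> \<psi> \<delta> T R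
    by unfold_locales (rule \<psi> box | (erule box(5)))+
  have T: "T \<in> {0<..<1}" using box by simp
  obtain B where B: "0 \<le> B" "\<And>z. norm (gr z) \<le> B" using test_bound by metis
  have meas: "(\<lambda>x. f (t, x)) \<in> borel_measurable borel" if "continuous_on UNIV f"
    for f :: "real \<times> 'a \<Rightarrow> 'b::topological_space" and t
    by (intro borel_measurable_continuous_onI continuous_on_compose2[OF that] continuous_intros) auto
  define It where "It t = (\<integral>x. \<phi> t x * vector_derivative (\<lambda>s. \<psi> (s, x)) (at t) \<partial>lborel)" for t
  define Id where "Id t = (\<integral>x. \<phi> t x * (D t * laplacian (\<lambda>y. \<psi> (t, y)) x) \<partial>lborel)" for t
  define Ib where "Ib t = (\<integral>x. (\<phi> t x *\<^sub>R b t x) \<bullet> grad (\<lambda>y. \<psi> (t, y)) x \<partial>lborel)" for t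
  have It: "It t = (\<integral>q. pt (t, Y 0 t q) \<partial>sample)" if t: "t \<in> {0<..<1}" for t
    unfolding It_def test_function_slice[OF \<psi>] by (rule integral_\<phi>[OF t meas[OF cont_test(1)]])
  have Id: "Id t = (\<integral>q. diffusion 0 t q \<partial>sample)" if t: "t \<in> {0<..<1}" for t
    unfolding Id_def test_function_slice[OF \<psi>]
    by (rule integral_\<phi>[OF t]) (intro borel_measurable_times borel_measurable_const meas[OF cont_test(3)])
  have Ib: "Ib t = (\<integral>q. transport 0 t q \<partial>sample)"
    if t: "t \<in> {0<..<1}" and fin: "t \<le> T \<longrightarrow> drift_mean t < \<infinity>" for t
  proof (cases "t \<le> T")
    case True
    have "gr (t, x) = 0" if "R < norm x" for x
    proof -
      have "(t, x) \<notin> K" using box(5)[of t x] that by auto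
      then show ?thesis by (rule off_support(4))
    qed
    then show ?thesis unfolding Ib_def test_function_slice[OF \<psi>]
      by (intro integral_\<phi>_drift[OF t _ meas[OF cont_test(2)] B(2) B(1) _ box(4)]) (use fin True in auto)
  next
    case False
    have "gr (t, x) = 0" for x
    proof -
      have "(t, x) \<notin> K" using box(5)[of t x] False by auto
      then show ?thesis by (rule off_support(4))
    qed
    then show ?thesis unfolding Ib_def test_function_slice[OF \<psi>] by simp
  qed
  note tp = integrable_time_part[of 0] and bp = integrable_drift_part[of 0] and dp = integrable_diffusion_part[of 0]
  have jt: "integrable unit_time (\<lambda>t. \<integral>q. pt (t, Y 0 t q) \<partial>sample)"
    and jd: "integrable unit_time (\<lambda>t. \<integral>q. diffusion 0 t q \<partial>sample)"
    and jb: "integrable unit_time (\<lambda>t. \<integral>q. transport 0 t q \<partial>sample)"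
    using LN.integrable_fst'[OF tp] LN.integrable_fst'[OF dp] LN.integrable_fst'[OF bp] by (simp_all only: fst_conv snd_conv)
  have AEt: "AE t in unit_time. It t = (\<integral>q. pt (t, Y 0 t q) \<partial>sample)"
    and AEd: "AE t in unit_time. Id t = (\<integral>q. diffusion 0 t q \<partial>sample)"
    by (rule AE_I2, rule It Id, simp)+
  have AEb: "AE t in unit_time. Ib t = (\<integral>q. transport 0 t q \<partial>sample)"
    using AE_space AE_drift_norm_finite[OF T] by eventually_elim (rule Ib, simp_all)
  have "(\<integral>t. \<integral>q. pt (t, Y 0 t q) \<partial>sample \<partial>unit_time) +
      (\<integral>t. \<integral>q. transport 0 t q \<partial>sample \<partial>unit_time) +
      (\<integral>t. \<integral>q. diffusion 0 t q \<partial>sample \<partial>unit_time) = 0"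
    using weak_equation[unfolded A_def
        Bochner_Integration.integral_add[OF Bochner_Integration.integrable_add[OF tp bp] dp]
        Bochner_Integration.integral_add[OF tp bp]]
      LN.integral_fst'[OF tp] LN.integral_fst'[OF dp] LN.integral_fst'[OF bp]
    by (simp only: fst_conv snd_conv)
  then have sum: "- (LINT t:{0<..<1}|lebesgue. It t) = (LINT t:{0<..<1}|lebesgue. Id t) + (LINT t:{0<..<1}|lebesgue. Ib t)"
    unfolding set_integral_unit_time(2)[OF jt AEt] set_integral_unit_time(2)[OF jd AEd] set_integral_unit_time(2)[OF jb AEb]
    by linarith
  show "let It = (\<lambda>t. LINT x|lborel. \<phi> t x * vector_derivative (\<lambda>s. \<psi> (s, x)) (at t));
            Id = (\<lambda>t. LINT x|lborel. \<phi> t x * (D t * laplacian (\<lambda>y. \<psi> (t, y)) x));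
            Ib = (\<lambda>t. LINT x|lborel. (\<phi> t x *\<^sub>R b t x) \<bullet> grad (\<lambda>y. \<psi> (t, y)) x)
        in set_integrable lebesgue {0<..<1} It \<and> set_integrable lebesgue {0<..<1} Id \<and>
           set_integrable lebesgue {0<..<1} Ib \<and>
           - (LINT t:{0<..<1}|lebesgue. It t) = (LINT t:{0<..<1}|lebesgue. Id t) + (LINT t:{0<..<1}|lebesgue. Ib t)"
    unfolding Let_def It_def[symmetric] Id_def[symmetric] Ib_def[symmetric]
    using sum set_integral_unit_time(1)[OF jt AEt] set_integral_unit_time(1)[OF jd AEd] set_integral_unit_time(1)[OF jb AEb]
    by blast
qed

end

section \<open>Laws of the processes\<close>

text \<open>
  The variance of the Wiener integral of \<open>\<surd>a'\<close> is \<open>a t\<close>, by the fundamental theorem of calculus.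
\<close>

lemma variance_integrand:
  assumes C1: "C1_on {0..<1} a" and a0: "a 0 = 0" and nonneg: "\<And>t. t \<in> {0..<1} \<Longrightarrow> deriv_on {0..<1} a t \<ge> 0"
    and t: "t \<in> {0<..<1}"
  shows "(\<lambda>s. indicator {0..t} s * sqrt (deriv_on {0..<1} a s)) \<in> borel_measurable borel"
    and "(\<integral>\<^sup>+s\<in>{0..t}. ennreal ((sqrt (deriv_on {0..<1} a s))\<^sup>2) \<partial>lborel) = ennreal (a t)"
proof -
  let ?d = "deriv_on {0..<1} a"
  have sub: "{0..t} \<subseteq> {0..<1}" using t by auto
  have cont: "continuous_on {0..t} ?d"
    using C1 sub by (auto simp: C1_on_def deriv_on_def[abs_def] intro: continuous_on_subset)
  show "(\<lambda>s. indicator {0..t} s * sqrt (?d s)) \<in> borel_measurable borel"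
    using borel_measurable_continuous_on_indicator[of "{0..t}" "\<lambda>s. sqrt (?d s)"] cont
    by (simp add: continuous_on_real_sqrt)
  have "has_bochner_integral lborel (\<lambda>s. indicator {0..t} s *\<^sub>R ?d s) (a t - a 0)"
  proof (rule has_bochner_integral_FTC_Icc[OF _ _ cont])
    fix s assume "0 \<le> s" "s \<le> t"
    then have "s \<in> {0..<1}" using sub by auto
    then have "(a has_vector_derivative ?d s) (at s within {0..<1})"
      using C1 unfolding C1_on_def deriv_on_def by (simp add: vector_derivative_works)
    then show "(a has_vector_derivative ?d s) (at s within {0..t})"
      by (rule has_vector_derivative_within_subset) (rule sub)
  qed (use t in simp)
  then have "(\<integral>\<^sup>+s. ennreal (indicator {0..t} s *\<^sub>R ?d s) \<partial>lborel) = ennreal (a t)"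
    using nonneg sub a0
    by (subst nn_integral_eq_integral) (auto simp: has_bochner_integral_iff indicator_def intro!: AE_I2)
  moreover have "ennreal ((sqrt (?d s))\<^sup>2) * indicator {0..t} s = ennreal (indicator {0..t} s *\<^sub>R ?d s)" for s
    using nonneg[of s] sub by (auto simp: indicator_def)
  ultimately show "(\<integral>\<^sup>+s\<in>{0..t}. ennreal ((sqrt (?d s))\<^sup>2) \<partial>lborel) = ennreal (a t)"
    by simp
qed

lemma distr_pair_left:
  assumes "prob_space G" and [measurable]: "f \<in> measurable N S" "h \<in> measurable (S \<Otimes>\<^sub>M G) L"
  shows "distr (distr N S f \<Otimes>\<^sub>M G) L h = distr (N \<Otimes>\<^sub>M G) L (\<lambda>p. h (f (fst p), snd p))"
proof -
  interpret G: prob_space G by fact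
  have "distr N S f \<Otimes>\<^sub>M distr G G (\<lambda>z. z) = distr (N \<Otimes>\<^sub>M G) (S \<Otimes>\<^sub>M G) (\<lambda>(r, z). (f r, z))"
    by (rule pair_measure_distr) (simp_all add: G.sigma_finite_measure_axioms)
  then show ?thesis
    by (simp add: distr_distr o_def split_beta)
qed

lemma nn_integral_indicator_distr:
  assumes "X \<in> measurable M N" "A \<in> sets N"
  shows "emeasure (distr M N X) A = (\<integral>\<^sup>+\<omega>. indicator A (X \<omega>) \<partial>M)"
  using assms by (subst nn_integral_indicator[symmetric], simp) (subst nn_integral_distr, auto)

lemma distr_independent_combination:
  fixes X :: "'w \<Rightarrow> 'a::euclidean_space" and Z :: "'w \<Rightarrow> 'a"
  assumes "prob_space M" and [measurable]: "X \<in> borel_measurable M" "Z \<in> borel_measurable M"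
    and law: "distr M (borel \<Otimes>\<^sub>M borel) (\<lambda>\<omega>. (X \<omega>, Z \<omega>)) = distr M borel X \<Otimes>\<^sub>M distr M borel Z"
  shows "distr M borel (\<lambda>\<omega>. s *\<^sub>R X \<omega> + Z \<omega>) =
    distr (M \<Otimes>\<^sub>M distr M borel X) borel (\<lambda>r. s *\<^sub>R snd r + Z (fst r))"
proof (rule measure_eqI)
  interpret M: prob_space M by fact
  interpret X: prob_space "distr M borel X" by (rule M.prob_space_distr) simp
  interpret MX: pair_sigma_finite M "distr M borel X" ..
  fix A assume "A \<in> sets (distr M borel (\<lambda>\<omega>. s *\<^sub>R X \<omega> + Z \<omega>))"
  then have [measurable]: "A \<in> sets borel" by simp
  have "emeasure (distr M borel (\<lambda>\<omega>. s *\<^sub>R X \<omega> + Z \<omega>)) A = (\<integral>\<^sup>+\<omega>. indicator A (s *\<^sub>R X \<omega> + Z \<omega>) \<partial>M)"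
    by (rule nn_integral_indicator_distr) auto
  also have "\<dots> = (\<integral>\<^sup>+\<omega>. \<integral>\<^sup>+\<omega>'. indicator A (s *\<^sub>R X \<omega> + Z \<omega>') \<partial>M \<partial>M)"
    by (rule nn_integral_joint_law[OF \<open>prob_space M\<close> _ _ law, of "\<lambda>p. indicator A (s *\<^sub>R fst p + snd p)",
          unfolded fst_conv snd_conv]) measurable
  also have "\<dots> = (\<integral>\<^sup>+x. \<integral>\<^sup>+\<omega>'. indicator A (s *\<^sub>R x + Z \<omega>') \<partial>M \<partial>distr M borel X)"
    by (subst nn_integral_distr) auto
  also have "\<dots> = (\<integral>\<^sup>+r. indicator A (s *\<^sub>R snd r + Z (fst r)) \<partial>(M \<Otimes>\<^sub>M distr M borel X))"
    by (subst MX.nn_integral_snd[symmetric]) auto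
  also have "\<dots> = emeasure (distr (M \<Otimes>\<^sub>M distr M borel X) borel (\<lambda>r. s *\<^sub>R snd r + Z (fst r))) A"
    by (rule nn_integral_indicator_distr[symmetric]) auto
  finally show "emeasure (distr M borel (\<lambda>\<omega>. s *\<^sub>R X \<omega> + Z \<omega>)) A =
      emeasure (distr (M \<Otimes>\<^sub>M distr M borel X) borel (\<lambda>r. s *\<^sub>R snd r + Z (fst r))) A" .
qed simp

lemma distr_snd_pair_gaussian:
  assumes "prob_space N"
  shows "distr (N \<Otimes>\<^sub>M std_gaussian) borel (\<lambda>p. sqrt v *\<^sub>R snd p) = (gaussian v :: 'a::euclidean_space measure)"
proof (rule measure_eqI)
  interpret N: prob_space N by fact
  interpret G: prob_space "std_gaussian :: 'a measure" by (rule prob_space_std_gaussian)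
  fix A :: "'a set" assume "A \<in> sets (distr (N \<Otimes>\<^sub>M std_gaussian) borel (\<lambda>p. sqrt v *\<^sub>R snd p))"
  then have [measurable]: "A \<in> sets borel" by simp
  have "emeasure (distr (N \<Otimes>\<^sub>M std_gaussian) borel (\<lambda>p. sqrt v *\<^sub>R snd p)) A =
      (\<integral>\<^sup>+p. indicator A (sqrt v *\<^sub>R snd p) \<partial>(N \<Otimes>\<^sub>M std_gaussian))"
    by (rule nn_integral_indicator_distr) auto
  also have "\<dots> = (\<integral>\<^sup>+z. indicator A (sqrt v *\<^sub>R z) \<partial>std_gaussian)"
    by (subst G.nn_integral_fst[symmetric]) (auto simp: N.emeasure_space_1)
  also have "\<dots> = emeasure (gaussian v) A"
    unfolding gaussian_def by (rule nn_integral_indicator_distr[symmetric]) auto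
  finally show "emeasure (distr (N \<Otimes>\<^sub>M std_gaussian) borel (\<lambda>p. sqrt v *\<^sub>R snd p)) A = emeasure (gaussian v) A" .
qed simp

text \<open>
  The coupling is realized by the coordinate projections on the product space under the joint law.
\<close>

lemma Wasserstein_le_coupling:
  fixes X Z :: "'w \<Rightarrow> 'a::euclidean_space"
  assumes "prob_space M" and [measurable]: "X \<in> borel_measurable M" "Z \<in> borel_measurable M"
  shows "Wasserstein p (distr M borel X) (distr M borel Z) \<le> Lp_norm M p (\<lambda>\<omega>. X \<omega> - Z \<omega>)"
proof -
  interpret prob_space M by fact
  let ?N = "distr M (borel \<Otimes>\<^sub>M borel) (\<lambda>\<omega>. (X \<omega>, Z \<omega>))"
  have m[measurable]: "(\<lambda>\<omega>. (X \<omega>, Z \<omega>)) \<in> measurable M (borel \<Otimes>\<^sub>M borel)" by measurable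
  have "prob_space ?N" by (rule prob_space_distr) measurable
  moreover have "distr ?N borel fst = distr M borel X" "distr ?N borel snd = distr M borel Z"
    by (subst distr_distr; simp add: o_def)+
  moreover have "Lp_norm ?N p (\<lambda>p. fst p - snd p) = Lp_norm M p (\<lambda>\<omega>. X \<omega> - Z \<omega>)"
    by (subst Lp_norm_distr) auto
  moreover have "fst \<in> borel_measurable ?N" "snd \<in> borel_measurable ?N" by simp_all
  ultimately show ?thesis
    unfolding Wasserstein_def by (intro Inf_lower CollectI exI[of _ ?N] exI[of _ fst] exI[of _ snd]) auto
qed

section \<open>Density, Fokker--Planck equation and convergence rate\<close>

theorem theorem3p1:
  fixes M :: "'w measure"
    and \<mu> \<nu> :: "'a::euclidean_space measure"
    and \<sigma> a :: "real \<Rightarrow> real"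
    and W \<xi> \<eta> X :: "real \<Rightarrow> 'w \<Rightarrow> 'a"
    and \<rho> \<phi> :: "real \<Rightarrow> 'a \<Rightarrow> real"
    and b :: "real \<Rightarrow> 'a \<Rightarrow> 'a"
  assumes "prob_space M"
    and "prob_space \<mu>" and "sets \<mu> = sets borel"
    and "prob_space \<nu>" and "sets \<nu> = sets borel"
    and "C1_on {0..<1} \<sigma>" and "\<And>t. t \<in> {0..<1} \<Longrightarrow> \<sigma> t > 0"
    and "\<sigma> 0 = 1" and "(\<sigma> \<longlongrightarrow> 0) (at_left 1)"
    and "C1_on {0..<1} a" and "\<And>t. t \<in> {0..<1} \<Longrightarrow> a t \<ge> 0"
    and "a 0 = 0" and "\<And>t. t \<in> {0..<1} \<Longrightarrow> deriv_on {0..<1} a t \<ge> 0"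
    and "brownian_motion M W"
    and "\<And>t. t \<in> {0..1} \<Longrightarrow> \<eta> t \<in> borel_measurable M"
    and "\<And>\<omega>. \<omega> \<in> space M \<Longrightarrow> C1_on {0..1} (\<lambda>t. \<eta> t \<omega>)"
    and "indep_rv M (path_space {0..1}) (sample_path {0..1} \<eta>) (path_space {0..}) (sample_path {0..} W)"
    and "indep_rv M borel (\<xi> 0)
           (path_space {0..1} \<Otimes>\<^sub>M path_space {0..}) (\<lambda>\<omega>. (sample_path {0..1} \<eta> \<omega>, sample_path {0..} W \<omega>))"
    and "linear_SDE_solution M W \<sigma> a \<xi>"
    and X_def: "X = (\<lambda>t \<omega>. \<xi> t \<omega> + \<eta> t \<omega>)"
    and "distr M borel (X 0) = \<mu>"
    and "\<And>t x. t \<in> {0<..<1} \<Longrightarrow> \<rho> t x \<ge> 0"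
    and "\<And>t. t \<in> {0<..<1} \<Longrightarrow> distributed M lborel (\<xi> t) (\<lambda>x. ennreal (\<rho> t x))"
    and "distr M borel (\<eta> 1) = \<nu>"
    and "\<And>T. T \<in> {0<..<1} \<Longrightarrow>
           (\<integral>\<^sup>+t\<in>{0..T}. (\<integral>\<^sup>+\<omega>. ennreal (norm (eta_drift \<sigma> \<eta> t \<omega>)) \<partial>M) \<partial>lborel) < \<infinity>"
    and \<phi>_def: "\<phi> = interp_density M \<eta> \<rho>"
    and b_def: "b = drift M \<sigma> \<eta> \<rho>"
  shows "(\<forall>t\<in>{0<..<1}. distributed M lborel (X t) (\<lambda>x. ennreal (\<phi> t x))) \<and>
         fokker_planck_distr (\<lambda>t. deriv_on {0..<1} a t * (\<sigma> t)\<^sup>2 / 2) b \<phi> \<and>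
         (\<forall>p\<ge>1. \<forall>t\<in>{0<..<1}.
            Wasserstein p (density lborel (\<lambda>x. ennreal (\<phi> t x))) \<nu>
              \<le> ennreal (\<sigma> t) *
                   (Lp_norm M p (\<xi> 0) + ennreal (gauss_Lp_const TYPE('a) p * sqrt (a t))) +
                 Lp_norm M p (\<lambda>\<omega>. \<eta> t \<omega> - \<eta> 1 \<omega>))"
proof -
  interpret M: prob_space M by fact
  note C1_\<sigma> = assms(6) and \<sigma>_pos = assms(7) and C1_a = assms(10) and a_nonneg = assms(11)
    and a0 = assms(12) and da_nonneg = assms(13) and BM = assms(14) and \<eta>_meas = assms(15)
    and C1_\<eta> = assms(16) and ind_\<eta>W = assms(17) and ind_\<xi> = assms(18) and SDE = assms(19)
    and \<rho>_nonneg = assms(22) and \<rho>_dist = assms(23) and \<eta>_1 = assms(24) and drift_bound = assms(25)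
  let ?PE = "path_space {0..1} :: (real \<Rightarrow> 'a) measure" and ?PW = "path_space {0..} :: (real \<Rightarrow> 'a) measure"
  let ?E = "sample_path {0..1} \<eta>" and ?W = "sample_path {0..} W"
  have [measurable]: "?E \<in> measurable M ?PE" and W_path[measurable]: "?W \<in> measurable M ?PW"
    using ind_\<eta>W by (auto simp: indep_rv_def)
  have \<xi>_meas: "\<xi> t \<in> borel_measurable M" if "t \<in> {0..<1}" for t
    using SDE that by (auto simp: linear_SDE_solution_def)
  have [measurable]: "\<xi> 0 \<in> borel_measurable M" by (rule \<xi>_meas) simp
  have [measurable]: "\<eta> 1 \<in> borel_measurable M" by (rule \<eta>_meas) simp
  define P0 where "P0 = distr M borel (\<xi> 0)"
  have P0: "prob_space P0" "sets P0 = sets borel"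
    unfolding P0_def by (auto intro: M.prob_space_distr)
  interpret GI: gaussian_interpolation M P0 \<sigma> a \<eta>
    by (rule gaussian_interpolation.intro[OF M.prob_space_axioms P0(1)], unfold_locales)
       (use P0 C1_\<sigma> \<sigma>_pos C1_a a_nonneg \<eta>_meas C1_\<eta> drift_bound in auto)
  note law_\<eta>W = indep_rv_distr[OF M.prob_space_axioms ind_\<eta>W]
    and law_\<xi> = indep_rv_distr[OF M.prob_space_axioms ind_\<xi>]
  \<comment> \<open>This is all that is used about Brownian motion; it is applied to \<open>\<xi> t\<close>, to \<open>X t\<close> and to the Wiener integral itself.\<close>
  have add_J: "distr M borel (\<lambda>\<omega>. g (\<xi> 0 \<omega>, ?E \<omega>) + c *\<^sub>R J \<omega>) =
      distr (distr M borel (\<lambda>\<omega>. g (\<xi> 0 \<omega>, ?E \<omega>)) \<Otimes>\<^sub>M std_gaussian) borel (\<lambda>(y, z). y + (c * sqrt (a t)) *\<^sub>R z)"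
    if t: "t \<in> {0<..<1}" and J: "wiener_integral M W (\<lambda>s. sqrt (deriv_on {0..<1} a s)) t J"
      and [measurable]: "g \<in> borel_measurable (borel \<Otimes>\<^sub>M ?PE)" for t J g c
  proof (rule distr_add_wiener_integral[OF BM J])
    show "(\<lambda>s. indicator {0..t} s * sqrt (deriv_on {0..<1} a s)) \<in> borel_measurable borel"
      "(\<integral>\<^sup>+s\<in>{0..t}. ennreal ((sqrt (deriv_on {0..<1} a s))\<^sup>2) \<partial>lborel) = ennreal (a t)"
      by (rule variance_integrand[OF C1_a a0 da_nonneg t]; assumption)+
    show "distr M (borel \<Otimes>\<^sub>M ?PW) (\<lambda>\<omega>. (g (\<xi> 0 \<omega>, ?E \<omega>), ?W \<omega>)) =
        distr M borel (\<lambda>\<omega>. g (\<xi> 0 \<omega>, ?E \<omega>)) \<Otimes>\<^sub>M distr M ?PW ?W"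
      by (rule joint_law_combine[OF M.prob_space_axioms _ _ _ law_\<xi> law_\<eta>W]) measurable
  qed (use a_nonneg t in auto)
  have \<eta>_path: "?E \<omega> t = \<eta> t \<omega>" if "t \<in> {0<..<1}" for t \<omega>
    using that by (simp add: sample_path_def)
  have law_\<xi>\<eta>: "distr M (borel \<Otimes>\<^sub>M borel) (\<lambda>\<omega>. (\<xi> 0 \<omega>, \<eta> t \<omega>)) = distr M borel (\<xi> 0) \<Otimes>\<^sub>M distr M borel (\<eta> t)"
    if t: "t \<in> {0<..<1}" for t
  proof -
    have m: "(\<lambda>p. fst p t) \<in> borel_measurable (?PE \<Otimes>\<^sub>M ?PW)"
      by (rule measurable_compose[OF measurable_fst measurable_component_singleton]) (use t in auto)
    have "distr M (borel \<Otimes>\<^sub>M borel) (\<lambda>\<omega>. (\<xi> 0 \<omega>, fst (?E \<omega>, ?W \<omega>) t)) =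
        distr M borel (\<lambda>\<omega>. \<xi> 0 \<omega>) \<Otimes>\<^sub>M distr M borel (\<lambda>\<omega>. fst (?E \<omega>, ?W \<omega>) t)"
      by (rule joint_law_compose[OF M.prob_space_axioms _ _ law_\<xi> _ m, where f = "\<lambda>x. x"]) measurable
    then show ?thesis by (simp only: fst_conv \<eta>_path[OF t])
  qed
  have solution: "\<exists>J. wiener_integral M W (\<lambda>s. sqrt (deriv_on {0..<1} a s)) t J \<and>
      (AE \<omega> in M. \<xi> t \<omega> = \<sigma> t *\<^sub>R \<xi> 0 \<omega> + \<sigma> t *\<^sub>R J \<omega>)" if "t \<in> {0<..<1}" for t
    using SDE that by (auto simp: linear_SDE_solution_def)
  have J_meas: "J \<in> borel_measurable M" if "wiener_integral M W f t J" for f t J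
    using that by (simp add: wiener_integral_def)
  have law_\<xi>t: "distr M borel (\<xi> t) =
      distr (P0 \<Otimes>\<^sub>M std_gaussian) borel (\<lambda>(x, z). \<sigma> t *\<^sub>R x + (\<sigma> t * sqrt (a t)) *\<^sub>R z)" if t: "t \<in> {0<..<1}" for t
  proof -
    obtain J where J: "wiener_integral M W (\<lambda>s. sqrt (deriv_on {0..<1} a s)) t J"
      "AE \<omega> in M. \<xi> t \<omega> = \<sigma> t *\<^sub>R \<xi> 0 \<omega> + \<sigma> t *\<^sub>R J \<omega>" using solution[OF t] by blast
    note [measurable] = J_meas[OF J(1)] \<xi>_meas[of t]
    have "distr M borel (\<xi> t) = distr M borel (\<lambda>\<omega>. \<sigma> t *\<^sub>R \<xi> 0 \<omega> + \<sigma> t *\<^sub>R J \<omega>)"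
      by (rule distr_cong_AE) (use J t in auto)
    also have "\<dots> = distr (distr M borel (\<lambda>\<omega>. \<sigma> t *\<^sub>R \<xi> 0 \<omega>) \<Otimes>\<^sub>M std_gaussian) borel (\<lambda>(y, z). y + (\<sigma> t * sqrt (a t)) *\<^sub>R z)"
      using add_J[OF t J(1), of "\<lambda>p. \<sigma> t *\<^sub>R fst p" "\<sigma> t"] by simp
    also have "distr M borel (\<lambda>\<omega>. \<sigma> t *\<^sub>R \<xi> 0 \<omega>) = distr P0 borel (\<lambda>x. \<sigma> t *\<^sub>R x)"
      unfolding P0_def by (subst distr_distr) (auto simp: o_def)
    also have "distr (distr P0 borel (\<lambda>x. \<sigma> t *\<^sub>R x) \<Otimes>\<^sub>M std_gaussian) borel (\<lambda>(y, z). y + (\<sigma> t * sqrt (a t)) *\<^sub>R z) =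
        distr (P0 \<Otimes>\<^sub>M std_gaussian) borel (\<lambda>(x, z). \<sigma> t *\<^sub>R x + (\<sigma> t * sqrt (a t)) *\<^sub>R z)"
      by (subst distr_pair_left[OF prob_space_std_gaussian]) (auto simp: case_prod_unfold P0_def)
    finally show ?thesis .
  qed
  interpret ID: interpolation_density M P0 \<sigma> a \<eta> \<rho>
  proof unfold_locales
    fix t :: real assume t: "t \<in> {0<..<1}"
    show "0 \<le> \<rho> t x" for x by (rule \<rho>_nonneg[OF t])
    have "(\<lambda>x. ennreal (\<rho> t x)) \<in> borel_measurable lborel"
      using \<rho>_dist[OF t] by (simp add: distributed_def)
    then have "(\<lambda>x. enn2real (ennreal (\<rho> t x))) \<in> borel_measurable borel" by simp
    then show "\<rho> t \<in> borel_measurable borel" using \<rho>_nonneg[OF t] by simp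
    have "density lborel (\<lambda>x. ennreal (\<rho> t x)) = distr M borel (\<xi> t)"
      using distributed_distr_eq_density[OF \<rho>_dist[OF t]] by (simp cong: distr_cong)
    then show "density lborel (\<lambda>x. ennreal (\<rho> t x)) =
        distr (P0 \<Otimes>\<^sub>M std_gaussian) borel (\<lambda>(x, z). \<sigma> t *\<^sub>R x + (\<sigma> t * sqrt (a t)) *\<^sub>R z)"
      unfolding law_\<xi>t[OF t] .
  qed
  have law_X: "distr M borel (X t) = density lborel (\<lambda>x. ennreal (\<phi> t x))" if t: "t \<in> {0<..<1}" for t
  proof -
    obtain J where J: "wiener_integral M W (\<lambda>s. sqrt (deriv_on {0..<1} a s)) t J"
      "AE \<omega> in M. \<xi> t \<omega> = \<sigma> t *\<^sub>R \<xi> 0 \<omega> + \<sigma> t *\<^sub>R J \<omega>" using solution[OF t] by blast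
    note [measurable] = J_meas[OF J(1)] \<xi>_meas[of t] \<eta>_meas[of t] ID.slice_measurable(4)[OF t]
    have [measurable]: "\<xi> t \<in> borel_measurable M" "\<eta> t \<in> borel_measurable M"
      using \<xi>_meas[of t] \<eta>_meas[of t] t by auto
    have "distr M borel (X t) = distr M borel (\<lambda>\<omega>. (\<sigma> t *\<^sub>R \<xi> 0 \<omega> + \<eta> t \<omega>) + \<sigma> t *\<^sub>R J \<omega>)"
      unfolding X_def by (rule distr_cong_AE) (use J(2) in \<open>auto simp: add_ac\<close>)
    also have "\<dots> = distr (distr M borel (\<lambda>\<omega>. \<sigma> t *\<^sub>R \<xi> 0 \<omega> + \<eta> t \<omega>) \<Otimes>\<^sub>M std_gaussian) borel (\<lambda>(y, z). y + (\<sigma> t * sqrt (a t)) *\<^sub>R z)"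
    proof -
      have "(\<lambda>p. \<sigma> t *\<^sub>R fst p + snd p t) \<in> borel_measurable (borel \<Otimes>\<^sub>M ?PE)"
        using measurable_compose[OF measurable_snd[of "borel :: 'a measure" ?PE] measurable_component_singleton[of t "{0..1}"]] t
        by simp
      from add_J[OF t J(1) this, of "\<sigma> t"] show ?thesis by (simp add: \<eta>_path[OF t])
    qed
    also have "distr M borel (\<lambda>\<omega>. \<sigma> t *\<^sub>R \<xi> 0 \<omega> + \<eta> t \<omega>) =
        distr (M \<Otimes>\<^sub>M P0) borel (\<lambda>r. \<sigma> t *\<^sub>R snd r + \<eta> t (fst r))"
      unfolding P0_def by (rule distr_independent_combination[OF M.prob_space_axioms _ _ law_\<xi>\<eta>[OF t]]) auto
    also have "distr (distr (M \<Otimes>\<^sub>M P0) borel (\<lambda>r. \<sigma> t *\<^sub>R snd r + \<eta> t (fst r)) \<Otimes>\<^sub>M std_gaussian) borel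
          (\<lambda>(y, z). y + (\<sigma> t * sqrt (a t)) *\<^sub>R z) = distr GI.sample borel (GI.Y 0 t)"
      by (subst distr_pair_left[OF prob_space_std_gaussian]) (auto simp: P0_def GI.Y_def[abs_def])
    also have "\<dots> = density lborel (\<lambda>x. ennreal (\<phi> t x))"
      unfolding \<phi>_def ID.density_\<phi>[OF t] by (rule distr_cong) auto
    finally show ?thesis .
  qed
  have part1: "distributed M lborel (X t) (\<lambda>x. ennreal (\<phi> t x))" if t: "t \<in> {0<..<1}" for t
    unfolding distributed_def
  proof (intro conjI)
    have "distr M lborel (X t) = distr M borel (X t)" by (rule distr_cong) auto
    then show "distr M lborel (X t) = density lborel (\<lambda>x. ennreal (\<phi> t x))" unfolding law_X[OF t] .
    show "(\<lambda>x. ennreal (\<phi> t x)) \<in> borel_measurable lborel"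
      using ID.\<phi>_measurable[OF t] by (simp add: \<phi>_def)
    show "X t \<in> measurable M lborel"
      using \<xi>_meas[of t] \<eta>_meas[of t] t by (simp add: X_def)
  qed
  have part2: "fokker_planck_distr (\<lambda>t. deriv_on {0..<1} a t * (\<sigma> t)\<^sup>2 / 2) b \<phi>"
    using ID.fokker_planck unfolding GI.D_def[abs_def] \<phi>_def b_def .
  have part3: "Wasserstein p (density lborel (\<lambda>x. ennreal (\<phi> t x))) \<nu>
      \<le> ennreal (\<sigma> t) * (Lp_norm M p (\<xi> 0) + ennreal (gauss_Lp_const TYPE('a) p * sqrt (a t))) +
        Lp_norm M p (\<lambda>\<omega>. \<eta> t \<omega> - \<eta> 1 \<omega>)" if p: "1 \<le> p" and t: "t \<in> {0<..<1}" for p t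
  proof -
    obtain J where J: "wiener_integral M W (\<lambda>s. sqrt (deriv_on {0..<1} a s)) t J"
      "AE \<omega> in M. \<xi> t \<omega> = \<sigma> t *\<^sub>R \<xi> 0 \<omega> + \<sigma> t *\<^sub>R J \<omega>" using solution[OF t] by blast
    have \<sigma>: "0 < \<sigma> t" and at: "0 \<le> a t" using \<sigma>_pos a_nonneg t by auto
    have [measurable]: "J \<in> borel_measurable M" "\<xi> t \<in> borel_measurable M" "\<eta> t \<in> borel_measurable M"
      using J_meas[OF J(1)] \<xi>_meas[of t] \<eta>_meas[of t] t by auto
    \<comment> \<open>The law of the Wiener integral alone is the special case of a vanishing first summand.\<close>
    have "distr M borel J = distr M borel (\<lambda>\<omega>. 0 + 1 *\<^sub>R J \<omega>)" by simp
    also have "\<dots> = distr (distr M borel (\<lambda>\<omega>. 0) \<Otimes>\<^sub>M std_gaussian) borel (\<lambda>(y, z). y + (1 * sqrt (a t)) *\<^sub>R z)"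
      by (rule add_J[OF t J(1), of "\<lambda>_. 0"]) simp
    also have "\<dots> = distr (M \<Otimes>\<^sub>M std_gaussian) borel (\<lambda>p. sqrt (a t) *\<^sub>R snd p)"
      by (subst distr_pair_left[OF prob_space_std_gaussian]) auto
    also have "\<dots> = gaussian (a t)" by (rule distr_snd_pair_gaussian[OF M.prob_space_axioms])
    finally have law_J: "distr M borel J = gaussian (a t)" .
    have "Lp_norm M p J = Lp_norm (distr M borel J) p (\<lambda>x. x)"
      by (rule Lp_norm_distr[symmetric]) auto
    also have "\<dots> = ennreal (gauss_Lp_const TYPE('a) p * sqrt (a t))"
      unfolding law_J by (rule Lp_norm_gaussian[OF p at])
    finally have "Lp_norm M p J = ennreal (gauss_Lp_const TYPE('a) p * sqrt (a t))" .
    moreover have "Lp_norm M p (\<lambda>\<omega>. \<sigma> t *\<^sub>R (\<xi> 0 \<omega> + J \<omega>)) \<le> ennreal (\<sigma> t) * (Lp_norm M p (\<xi> 0) + Lp_norm M p J)"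
      using Lp_norm_triangle[of "\<xi> 0" M J p] p \<sigma> by (subst Lp_norm_scaleR) (auto intro: mult_left_mono)
    moreover have "Lp_norm M p (\<lambda>\<omega>. X t \<omega> - \<eta> 1 \<omega>) =
        Lp_norm M p (\<lambda>\<omega>. \<sigma> t *\<^sub>R (\<xi> 0 \<omega> + J \<omega>) + (\<eta> t \<omega> - \<eta> 1 \<omega>))"
      unfolding X_def
      by (rule Lp_norm_cong_AE) (use J(2) in \<open>eventually_elim, simp add: scaleR_add_right\<close>)
    moreover have "Lp_norm M p (\<lambda>\<omega>. \<sigma> t *\<^sub>R (\<xi> 0 \<omega> + J \<omega>) + (\<eta> t \<omega> - \<eta> 1 \<omega>)) \<le>
        Lp_norm M p (\<lambda>\<omega>. \<sigma> t *\<^sub>R (\<xi> 0 \<omega> + J \<omega>)) + Lp_norm M p (\<lambda>\<omega>. \<eta> t \<omega> - \<eta> 1 \<omega>)"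
      by (rule Lp_norm_triangle) (use p in auto)
    moreover have "Wasserstein p (distr M borel (X t)) (distr M borel (\<eta> 1)) \<le> Lp_norm M p (\<lambda>\<omega>. X t \<omega> - \<eta> 1 \<omega>)"
      by (rule Wasserstein_le_coupling[OF M.prob_space_axioms]) (auto simp: X_def)
    ultimately show ?thesis
      unfolding law_X[OF t] \<eta>_1 by (auto intro: order.trans add_right_mono)
  qed
  show ?thesis using part1 part2 part3 by blast
qed

end
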